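(* Fix an o-minimal structure on $\mathbb{R}$, and let $X\subset\mathbb{R}^n$ be a $d$-dimensional definable set. Then $X$ is $C^1$ smooth if and only if $X$ is a topological manifold and $C_5(X,p)$ is a $d$-dimensional set for every $p\in X$.
   Context: "Definable" means definable in the fixed o-minimal structure on $\mathbb{R}$ (a structure containing all real algebraic sets); dimension is o-minimal dimension. $X$ is $C^1$ smooth at $p\in X$ if $X$ is a $C^1$ (embedded) submanifold of $\mathbb{R}^n$ in a neighbourhood of $p$; $X$ is $C^1$ smooth if this holds at all $p\in X$. Topological manifolds are without boundary and carry the subspace topology; manifolds and $C^1$ smooth sets are understood to have constant dimension (here $d$). $v\in C_5(X,p)$ iff there are $x_i,y_i\in X$, $x_i\to p$, $y_i\to p$, and $t_i>0$ with $\frac{1}{t_i}(x_i-y_i)\to v$. *)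

theory Defs
  imports "HOL-Analysis.Analysis"
begin

text \<open>
  Since an o-minimal structure involves the spaces \<open>\<real>\<^sup>n\<close> for all \<open>n\<close> at once, \<open>\<real>\<^sup>n\<close> is taken to be
  the library's \<^const>\<open>Euclidean_space\<close> \<open>n\<close>: the functions \<open>x :: nat \<Rightarrow> real\<close> with \<open>x i = 0\<close> for
  \<open>i \<ge> n\<close>, so the coordinates are \<open>x 0, \<dots>, x (n - 1)\<close>.  In particular \<open>\<real>\<^sup>d \<subseteq> \<real>\<^sup>n\<close> for
  \<open>d \<le> n\<close>, and \<open>x \<mapsto> x(n := 0)\<close> is the projection of \<open>\<real>\<^sup>n\<^sup>+\<^sup>1\<close> onto its first \<open>n\<close> coordinates.
\<close>

abbreviation Rn :: "nat \<Rightarrow> (nat \<Rightarrow> real) set"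
  where "Rn n \<equiv> topspace (Euclidean_space n)"

abbreviation subspace_top :: "nat \<Rightarrow> (nat \<Rightarrow> real) set \<Rightarrow> (nat \<Rightarrow> real) topology"
  where "subspace_top n X \<equiv> subtopology (Euclidean_space n) X"


section \<open>O-minimal structures\<close>

inductive polynomial_fun :: "nat \<Rightarrow> ((nat \<Rightarrow> real) \<Rightarrow> real) \<Rightarrow> bool" for n where
  const: "polynomial_fun n (\<lambda>x. c)"
| coord: "i < n \<Longrightarrow> polynomial_fun n (\<lambda>x. x i)"
| add: "polynomial_fun n f \<Longrightarrow> polynomial_fun n g \<Longrightarrow> polynomial_fun n (\<lambda>x. f x + g x)"
| mult: "polynomial_fun n f \<Longrightarrow> polynomial_fun n g \<Longrightarrow> polynomial_fun n (\<lambda>x. f x * g x)"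

definition real_algebraic_set :: "nat \<Rightarrow> (nat \<Rightarrow> real) set \<Rightarrow> bool"
  where "real_algebraic_set n A \<longleftrightarrow>
    (\<exists>P. (\<forall>p\<in>P. polynomial_fun n p) \<and> A = {x \<in> Rn n. \<forall>p\<in>P. p x = 0})"

text \<open>\<open>S n\<close> is the collection of definable subsets of \<open>\<real>\<^sup>n\<close>.  Intervals in the last axiom may be
  unbounded or degenerate, so points are included.\<close>

locale o_minimal_structure =
  fixes S :: "nat \<Rightarrow> (nat \<Rightarrow> real) set set"
  assumes subset_Rn: "A \<in> S n \<Longrightarrow> A \<subseteq> Rn n"
    and union: "A \<in> S n \<Longrightarrow> B \<in> S n \<Longrightarrow> A \<union> B \<in> S n"
    and complement: "A \<in> S n \<Longrightarrow> Rn n - A \<in> S n"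
    and prod_right: "A \<in> S n \<Longrightarrow> {x \<in> Rn (Suc n). x(n := 0) \<in> A} \<in> S (Suc n)"
    and prod_left: "A \<in> S n \<Longrightarrow> {x \<in> Rn (Suc n). (\<lambda>i. x (Suc i)) \<in> A} \<in> S (Suc n)"
    and projection: "A \<in> S (Suc n) \<Longrightarrow> (\<lambda>x. x(n := 0)) ` A \<in> S n"
    and algebraic: "real_algebraic_set n A \<Longrightarrow> A \<in> S n"
    and o_minimal: "A \<in> S 1 \<longleftrightarrow>
      (\<exists>F. finite F \<and> (\<forall>I\<in>F. is_interval I) \<and> A = {x \<in> Rn 1. x 0 \<in> \<Union>F})"


section \<open>Cells and o-minimal dimension\<close>

definition graph_over :: "nat \<Rightarrow> (nat \<Rightarrow> real) set \<Rightarrow> ((nat \<Rightarrow> real) \<Rightarrow> real) \<Rightarrow> (nat \<Rightarrow> real) set"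
  where "graph_over n C f = {x \<in> Rn (Suc n). x(n := 0) \<in> C \<and> x n = f (x(n := 0))}"

definition band_over :: "nat \<Rightarrow> (nat \<Rightarrow> real) set \<Rightarrow> ((nat \<Rightarrow> real) \<Rightarrow> ereal) \<Rightarrow>
    ((nat \<Rightarrow> real) \<Rightarrow> ereal) \<Rightarrow> (nat \<Rightarrow> real) set"
  where "band_over n C f g = {x \<in> Rn (Suc n). x(n := 0) \<in> C \<and>
    f (x(n := 0)) < ereal (x n) \<and> ereal (x n) < g (x(n := 0))}"

definition cont_definable :: "(nat \<Rightarrow> (nat \<Rightarrow> real) set set) \<Rightarrow> nat \<Rightarrow> (nat \<Rightarrow> real) set \<Rightarrow>
    ((nat \<Rightarrow> real) \<Rightarrow> real) \<Rightarrow> bool"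
  where "cont_definable S n C f \<longleftrightarrow>
    graph_over n C f \<in> S (Suc n) \<and> continuous_map (subspace_top n C) euclideanreal f"

text \<open>Boundary functions of bands: a continuous definable real function, or one of the two
  constants \<open>\<plusminus>\<infinity>\<close>.\<close>

definition cont_definable_ext :: "(nat \<Rightarrow> (nat \<Rightarrow> real) set set) \<Rightarrow> nat \<Rightarrow> (nat \<Rightarrow> real) set \<Rightarrow>
    ((nat \<Rightarrow> real) \<Rightarrow> ereal) \<Rightarrow> bool"
  where "cont_definable_ext S n C f \<longleftrightarrow>
    (\<exists>h. cont_definable S n C h \<and> (\<forall>x\<in>C. f x = ereal (h x))) \<or>
    (\<forall>x\<in>C. f x = \<infinity>) \<or> (\<forall>x\<in>C. f x = - \<infinity>)"

text \<open>\<open>cell S n k C\<close>: \<open>C \<subseteq> \<real>\<^sup>n\<close> is an \<open>(i\<^sub>1, \<dots>, i\<^sub>n)\<close>-cell with \<open>i\<^sub>1 + \<dots> + i\<^sub>n = k\<close>.  The recursion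
  starts from the one-point space \<open>\<real>\<^sup>0\<close>, so that in \<open>\<real>\<^sup>1\<close> it produces the points and the nonempty
  open intervals.\<close>

inductive cell :: "(nat \<Rightarrow> (nat \<Rightarrow> real) set set) \<Rightarrow> nat \<Rightarrow> nat \<Rightarrow> (nat \<Rightarrow> real) set \<Rightarrow> bool"
  for S where
  base: "cell S 0 0 (Rn 0)"
| graph: "cell S n k C \<Longrightarrow> cont_definable S n C f \<Longrightarrow> cell S (Suc n) k (graph_over n C f)"
| band: "cell S n k C \<Longrightarrow> cont_definable_ext S n C f \<Longrightarrow> cont_definable_ext S n C g \<Longrightarrow>
    (\<forall>x\<in>C. f x < g x) \<Longrightarrow> cell S (Suc n) (Suc k) (band_over n C f g)"

text \<open>\<open>dim X = d\<close>, where \<open>dim X\<close> is the largest dimension of a cell contained in \<open>X\<close>; the empty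
  set (of dimension \<open>-\<infinity>\<close>) has no dimension in \<open>nat\<close>.\<close>

definition has_dim :: "(nat \<Rightarrow> (nat \<Rightarrow> real) set set) \<Rightarrow> nat \<Rightarrow> (nat \<Rightarrow> real) set \<Rightarrow> nat \<Rightarrow> bool"
  where "has_dim S n X d \<longleftrightarrow>
    (\<exists>C. cell S n d C \<and> C \<subseteq> X) \<and> (\<forall>k C. cell S n k C \<and> C \<subseteq> X \<longrightarrow> k \<le> d)"


section \<open>Topological manifolds and smooth sets\<close>

definition topological_manifold :: "nat \<Rightarrow> 'a topology \<Rightarrow> bool"
  where "topological_manifold d T \<longleftrightarrow> Hausdorff_space T \<and> second_countable T \<and>
    (\<forall>p \<in> topspace T. \<exists>U V. openin T U \<and> p \<in> U \<and> openin (Euclidean_space d) V \<and>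
      subtopology T U homeomorphic_space subtopology (Euclidean_space d) V)"

text \<open>\<open>f\<close> is real-valued of class \<open>C\<^sup>1\<close> on \<open>U\<close> (intended for \<open>U\<close> open in \<open>\<real>\<^sup>n\<close>): all its partial
  derivatives exist and are continuous on \<open>U\<close>.\<close>

definition C1_real :: "nat \<Rightarrow> (nat \<Rightarrow> real) set \<Rightarrow> ((nat \<Rightarrow> real) \<Rightarrow> real) \<Rightarrow> bool"
  where "C1_real n U f \<longleftrightarrow> (\<forall>i<n. \<exists>D. continuous_map (subspace_top n U) euclideanreal D \<and>
    (\<forall>x\<in>U. ((\<lambda>t. f (x(i := t))) has_real_derivative D x) (at (x i))))"

definition C1_diffeo :: "nat \<Rightarrow> (nat \<Rightarrow> real) set \<Rightarrow> (nat \<Rightarrow> real) set \<Rightarrow>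
    ((nat \<Rightarrow> real) \<Rightarrow> nat \<Rightarrow> real) \<Rightarrow> bool"
  where "C1_diffeo n U V \<Phi> \<longleftrightarrow>
    openin (Euclidean_space n) U \<and> openin (Euclidean_space n) V \<and> bij_betw \<Phi> U V \<and>
    (\<forall>j<n. C1_real n U (\<lambda>x. \<Phi> x j)) \<and> (\<forall>j<n. C1_real n V (\<lambda>y. inv_into U \<Phi> y j))"

text \<open>Near \<open>p\<close>, \<open>X \<subseteq> \<real>\<^sup>n\<close> is an embedded \<open>C\<^sup>1\<close> submanifold of dimension \<open>d\<close>: a \<open>C\<^sup>1\<close> diffeomorphism
  of neighbourhoods in \<open>\<real>\<^sup>n\<close> straightens \<open>X\<close> to the coordinate subspace \<open>\<real>\<^sup>d \<times> {0}\<close>, which here is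
  \<open>Rn d\<close>.\<close>

definition C1_smooth_at :: "nat \<Rightarrow> nat \<Rightarrow> (nat \<Rightarrow> real) set \<Rightarrow> (nat \<Rightarrow> real) \<Rightarrow> bool"
  where "C1_smooth_at n d X p \<longleftrightarrow> d \<le> n \<and>
    (\<exists>U V \<Phi>. C1_diffeo n U V \<Phi> \<and> p \<in> U \<and> \<Phi> ` (U \<inter> X) = V \<inter> Rn d)"

definition C1_smooth :: "nat \<Rightarrow> nat \<Rightarrow> (nat \<Rightarrow> real) set \<Rightarrow> bool"
  where "C1_smooth n d X \<longleftrightarrow> (\<forall>p\<in>X. C1_smooth_at n d X p)"


section \<open>The cone \<open>C\<^sub>5\<close>\<close>

definition C5 :: "nat \<Rightarrow> (nat \<Rightarrow> real) set \<Rightarrow> (nat \<Rightarrow> real) \<Rightarrow> (nat \<Rightarrow> real) set"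
  where "C5 n X p = {v. \<exists>(x :: nat \<Rightarrow> nat \<Rightarrow> real) (y :: nat \<Rightarrow> nat \<Rightarrow> real) (t :: nat \<Rightarrow> real).
    (\<forall>i. x i \<in> X \<and> y i \<in> X \<and> t i > 0) \<and>
    limitin (Euclidean_space n) x p sequentially \<and>
    limitin (Euclidean_space n) y p sequentially \<and>
    limitin (Euclidean_space n) (\<lambda>i j. (1 / t i) * (x i j - y i j)) v sequentially}"

end

theory Submission
  imports Defs "HOL-Homology.Invariance_of_Domain"
begin

text \<open>
  Over \<open>\<real>\<close>, cell decomposition can be avoided: since definable subsets of the line are finite unions
  of intervals, the Baire category theorem and induction on the dimension show that every box
  contains a smaller box inside a given definable set or inside its complement.  Hence definable
  functions are continuous on some box, and a definable continuous injection of an \<open>m\<close>-dimensional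
  box has a cell of dimension at least \<open>m\<close> in its image.  So a closed definable set whose image under
  some polynomial map to \<open>\<real>\<^sup>m\<close> has interior points contains such a cell.

  If \<open>T = C\<^sub>5(X, p)\<close> contains no cell of dimension above \<open>d\<close>, this gives a linear projection to
  \<open>\<real>\<^sup>d\<close> whose kernel meets \<open>T\<close> only in \<open>0\<close>.  It is injective on \<open>X\<close> near \<open>p\<close> with Lipschitz inverse, so by
  invariance of domain \<open>X\<close> is locally the graph of a Lipschitz map \<open>G\<close>.  If the difference quotients of
  \<open>G\<close> in a direction \<open>w\<close> had two limits at a point, then, by connectedness and the Lipschitz property,
  the cone there would have all intermediate values over all directions close to \<open>w\<close>, hence
  a projection to \<open>\<real>\<^sup>d\<^sup>+\<^sup>1\<close> with interior points.  So \<open>G\<close> is strictly differentiable, thus of class \<open>C\<^sup>1\<close>.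

  Conversely, at a smooth point the cone is the tangent space.
\<close>

text \<open>A jump of the quotients in a single direction gives only a segment in the cone.
  Dimension d + 1 is contradicted only by an open set of pairs (direction, value), and the Lipschitz
  bound supplies it: a small change of direction moves both extreme quotients so little that an
  interval between them survives. On the definable side the obstacle is that \<open>has_dim\<close>
  speaks of cells, so an estimate needs an actual cell inside a set. It is grown one ambient
  coordinate at a time: where the last coordinate is determined by the others it becomes a graph;
  where the fibres contain intervals, passing to a level set of the last coordinate costs one
  dimension and a band restores it. Closedness of the cone yields definable sections: on compact
  pieces the lexicographically least point of a fibre exists. The manifold hypothesis serves to make
  the projection of a piece of \<open>X\<close> open; the cone is then used at every point of this
  piece, so that the derivative exists and is continuous on an open set.\<close>

section \<open>Tuples padded with zeros, and polynomial functions\<close>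

text \<open>Serves both as the projection onto the first \<open>m\<close> coordinates and as the
  constructor of an \<open>m\<close>-tuple; the padding with 0 is forced by the form of
  \<open>Rn m\<close>.\<close>

definition vecn :: "nat \<Rightarrow> (nat \<Rightarrow> real) \<Rightarrow> nat \<Rightarrow> real"
  where "vecn m f = (\<lambda>i. if i < m then f i else 0)"

lemma vecn_apply [simp]: "i < m \<Longrightarrow> vecn m f i = f i"
  by (simp add: vecn_def)

lemma vecn_apply_ge [simp]: "m \<le> i \<Longrightarrow> vecn m f i = 0"
  by (simp add: vecn_def)

lemma Rn_iff: "x \<in> Rn n \<longleftrightarrow> (\<forall>i\<ge>n. x i = 0)"
  by (simp add: topspace_Euclidean_space)

lemma vecn_in_Rn [simp, intro]: "vecn m f \<in> Rn m"
  by (simp add: Rn_iff)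

lemma vecn_Rn: "x \<in> Rn m \<Longrightarrow> vecn m x = x"
  by (auto simp: Rn_iff vecn_def fun_eq_iff not_less)

lemma vecn_vec [simp]: "m \<le> k \<Longrightarrow> vecn m (vecn k f) = vecn m f"
  by (auto simp: vecn_def)

lemma vecn_vec_shift [simp]: "j + m \<le> k \<Longrightarrow> vecn m (\<lambda>i. vecn k f (j + i)) = vecn m (\<lambda>i. f (j + i))"
  by (auto simp: vecn_def)

lemma vecn_cong: "(\<And>i. i < m \<Longrightarrow> f i = g i) \<Longrightarrow> vecn m f = vecn m g"
  by (auto simp: vecn_def)

lemma Rn_ext: "x \<in> Rn n \<Longrightarrow> y \<in> Rn n \<Longrightarrow> (\<And>i. i < n \<Longrightarrow> x i = y i) \<Longrightarrow> x = y"
  by (metis vecn_Rn vecn_cong)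

lemma Rn_mono: "m \<le> n \<Longrightarrow> x \<in> Rn m \<Longrightarrow> x \<in> Rn n"
  by (simp add: Rn_iff)

lemma upd_Rn_Suc: "x \<in> Rn (Suc n) \<Longrightarrow> x(n := 0) = vecn n x"
  by (auto simp: Rn_iff vecn_def fun_eq_iff)

lemma upd_in_Rn: "x \<in> Rn n \<Longrightarrow> i < n \<Longrightarrow> x(i := t) \<in> Rn n"
  by (auto simp: Rn_iff)

lemma upd_in_Rn_Suc: "x \<in> Rn n \<Longrightarrow> x(n := t) \<in> Rn (Suc n)"
  by (auto simp: Rn_iff)

lemma vecn_upd [simp]: "x \<in> Rn n \<Longrightarrow> vecn n (x(n := t)) = x"
  by (auto simp: Rn_iff vecn_def fun_eq_iff)

lemma vecn_upd_last: "x \<in> Rn (Suc n) \<Longrightarrow> (vecn n x)(n := x n) = x"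
  by (auto simp: Rn_iff vecn_def fun_eq_iff)

lemma polynomial_fun_mono: "polynomial_fun n f \<Longrightarrow> n \<le> m \<Longrightarrow> polynomial_fun m f"
  by (induction rule: polynomial_fun.induct) (auto intro: polynomial_fun.intros)

text \<open>A polynomial in the first \<open>n\<close> variables does not see the coordinates
  appended for bound variables, so it may be read in any larger space.\<close>

lemma polynomial_fun_vec: "polynomial_fun n f \<Longrightarrow> f (vecn n x) = f x"
  by (induction rule: polynomial_fun.induct) auto

lemma polynomial_fun_uminus: "polynomial_fun n f \<Longrightarrow> polynomial_fun n (\<lambda>x. - f x)"
  using polynomial_fun.mult[OF polynomial_fun.const[of n "-1"]] by force

lemma polynomial_fun_diff:
  "polynomial_fun n f \<Longrightarrow> polynomial_fun n g \<Longrightarrow> polynomial_fun n (\<lambda>x. f x - g x)"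
  using polynomial_fun.add[OF _ polynomial_fun_uminus] by force

lemma polynomial_fun_sum:
  "finite I \<Longrightarrow> (\<And>i. i \<in> I \<Longrightarrow> polynomial_fun n (f i)) \<Longrightarrow> polynomial_fun n (\<lambda>x. \<Sum>i\<in>I. f i x)"
  by (induction rule: finite_induct) (auto intro: polynomial_fun.intros)

lemmas polynomial_intros = polynomial_fun.const polynomial_fun.coord polynomial_fun.add
  polynomial_fun.mult polynomial_fun_diff polynomial_fun_uminus

section \<open>First-order definability\<close>

context o_minimal_structure
begin

text \<open>Bound variables are appended after the free ones: under a quantifier the free variables become
  \<open>vecn n z\<close> and a bound tuple becomes the block \<open>vecn m (\<lambda>i. z (n + i))\<close>.\<close>

definition dfn :: "nat \<Rightarrow> ((nat \<Rightarrow> real) \<Rightarrow> bool) \<Rightarrow> bool"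
  where "dfn n P \<longleftrightarrow> {x \<in> Rn n. P x} \<in> S n"

text \<open>The value is appended as coordinate \<open>n\<close>, so this is definability of the
  graph. Functions are total; one that matters only on a box is extended by 0 outside it.\<close>

definition dfun :: "nat \<Rightarrow> ((nat \<Rightarrow> real) \<Rightarrow> real) \<Rightarrow> bool"
  where "dfun n f \<longleftrightarrow> dfn (Suc n) (\<lambda>z. z n = f (vecn n z))"

lemma dfn_mem: "A \<in> S n \<Longrightarrow> dfn n (\<lambda>x. x \<in> A)"
proof -
  assume A: "A \<in> S n"
  then have "{x \<in> Rn n. x \<in> A} = A" using subset_Rn by blast
  then show ?thesis using A by (simp add: dfn_def)
qed

lemma dfn_cong: "(\<And>x. x \<in> Rn n \<Longrightarrow> P x \<longleftrightarrow> Q x) \<Longrightarrow> dfn n P \<longleftrightarrow> dfn n Q"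
  unfolding dfn_def by (rule arg_cong[where f = "\<lambda>A. A \<in> S n"]) auto

lemma dfn_not: "dfn n P \<Longrightarrow> dfn n (\<lambda>x. \<not> P x)"
proof -
  have "Rn n - {x \<in> Rn n. P x} = {x \<in> Rn n. \<not> P x}" by auto
  then show "dfn n P \<Longrightarrow> dfn n (\<lambda>x. \<not> P x)"
    unfolding dfn_def using complement[of "{x \<in> Rn n. P x}" n] by simp
qed

lemma dfn_disj: "dfn n P \<Longrightarrow> dfn n Q \<Longrightarrow> dfn n (\<lambda>x. P x \<or> Q x)"
proof -
  have "{x \<in> Rn n. P x} \<union> {x \<in> Rn n. Q x} = {x \<in> Rn n. P x \<or> Q x}" by auto
  then show "dfn n P \<Longrightarrow> dfn n Q \<Longrightarrow> dfn n (\<lambda>x. P x \<or> Q x)"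
    unfolding dfn_def using union[of "{x \<in> Rn n. P x}" n "{x \<in> Rn n. Q x}"] by simp
qed

lemma dfn_conj: "dfn n P \<Longrightarrow> dfn n Q \<Longrightarrow> dfn n (\<lambda>x. P x \<and> Q x)"
proof -
  assume "dfn n P" "dfn n Q"
  then have "dfn n (\<lambda>x. \<not> (\<not> P x \<or> \<not> Q x))"
    using dfn_not dfn_disj by blast
  then show ?thesis by simp
qed

lemma dfn_imp: "dfn n P \<Longrightarrow> dfn n Q \<Longrightarrow> dfn n (\<lambda>x. P x \<longrightarrow> Q x)"
  using dfn_disj[of n "\<lambda>x. \<not> P x" Q] dfn_not[of n P] by (simp only: disj_not1 simp_thms)

lemma dfn_poly_zero: "polynomial_fun n f \<Longrightarrow> dfn n (\<lambda>x. f x = 0)"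
  unfolding dfn_def by (rule algebraic) (auto simp: real_algebraic_set_def intro!: exI[of _ "{f}"])

lemma dfn_const: "dfn n (\<lambda>x. P)"
proof -
  have "dfn n (\<lambda>x. True)"
    using dfn_poly_zero[OF polynomial_fun.const[of n 0]] by simp
  then show ?thesis
    using dfn_not[of n "\<lambda>x. True"] by (cases P) auto
qed

lemma dfn_all_less: "(\<And>i. i < (m::nat) \<Longrightarrow> dfn n (P i)) \<Longrightarrow> dfn n (\<lambda>x. \<forall>i<m. P i x)"
proof (induction m)
  case 0
  then show ?case by (simp add: dfn_const)
next
  case (Suc m)
  have "dfn n (\<lambda>x. (\<forall>i<m. P i x) \<and> P m x)"
    using Suc by (intro dfn_conj) auto
  moreover have "(\<lambda>x. (\<forall>i<m. P i x) \<and> P m x) = (\<lambda>x. \<forall>i<Suc m. P i x)"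
    by (auto simp: less_Suc_eq)
  ultimately show ?case by simp
qed

text \<open>The existential quantifier is the projection axiom: the bound variable is the last
  coordinate, which the projection resets to 0.\<close>

lemma dfn_ex:
  assumes "dfn (Suc n) (\<lambda>z. P (vecn n z) (z n))"
  shows "dfn n (\<lambda>x. \<exists>t. P x t)"
proof -
  have "(\<lambda>x. x(n := 0)) ` {z \<in> Rn (Suc n). P (vecn n z) (z n)} = {x \<in> Rn n. \<exists>t. P x t}"
  proof (intro equalityI subsetI)
    fix x assume "x \<in> {x \<in> Rn n. \<exists>t. P x t}"
    then obtain t where t: "x \<in> Rn n" "P x t" by auto
    then have "x(n := t) \<in> {z \<in> Rn (Suc n). P (vecn n z) (z n)}"
      by (simp add: upd_in_Rn_Suc)
    moreover have "x = (x(n := t))(n := 0)"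
      using t(1) by (auto simp: Rn_iff fun_eq_iff)
    ultimately show "x \<in> (\<lambda>x. x(n := 0)) ` {z \<in> Rn (Suc n). P (vecn n z) (z n)}"
      by (intro image_eqI[where x = "x(n := t)"])
  qed (auto simp: upd_Rn_Suc)
  then show ?thesis
    using projection[OF assms[unfolded dfn_def]] by (simp add: dfn_def)
qed

lemma dfn_all:
  assumes "dfn (Suc n) (\<lambda>z. P (vecn n z) (z n))"
  shows "dfn n (\<lambda>x. \<forall>t. P x t)"
  using dfn_not[OF dfn_ex[where P = "\<lambda>x t. \<not> P x t", OF dfn_not[OF assms]]] by simp

lemma dfn_exs:
  assumes "dfn (n + m) (\<lambda>z. P (vecn n z) (vecn m (\<lambda>i. z (n + i))))"
  shows "dfn n (\<lambda>x. \<exists>y\<in>Rn m. P x y)"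
  using assms
proof (induction m arbitrary: P)
  case 0
  have "vecn 0 (\<lambda>i. z (n + i)) = (\<lambda>_. 0)" for z by (auto simp: vecn_def)
  moreover have "Rn 0 = {\<lambda>_. 0}" by (auto simp: Rn_iff)
  ultimately show ?case
    using 0 dfn_cong[of n "\<lambda>x. P x (\<lambda>_. 0)" "\<lambda>z. P (vecn n z) (vecn 0 (\<lambda>i. z (n + i)))"]
    by (simp add: vecn_Rn)
next
  case (Suc m)
  have eq: "(vecn m (\<lambda>i. z (n + i)))(m := z (n + m)) = vecn (Suc m) (\<lambda>i. z (n + i))" for z :: "nat \<Rightarrow> real"
    by (auto simp: vecn_def fun_eq_iff)
  \<comment> \<open>The last bound coordinate is removed first, so that the induction hypothesis
    applies to a predicate that already contains this quantifier.\<close>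
  have "dfn (n + m) (\<lambda>z. \<exists>t. P (vecn n z) ((vecn m (\<lambda>i. z (n + i)))(m := t)))"
    by (rule dfn_ex) (use Suc.prems eq in simp)
  then have "dfn n (\<lambda>x. \<exists>y\<in>Rn m. \<exists>t. P x (y(m := t)))"
    by (rule Suc.IH)
  moreover have "(\<exists>y\<in>Rn m. \<exists>t. P x (y(m := t))) \<longleftrightarrow> (\<exists>y\<in>Rn (Suc m). P x y)" for x
    by (metis upd_in_Rn_Suc vecn_in_Rn vecn_upd_last)
  ultimately show ?case by simp
qed

text \<open>Puts \<open>k\<close> dummy variables in front by iterating \<open>prod_left\<close>; a
  block of bound variables stands behind the free ones and is read in this way.\<close>

lemma dfn_shift: "dfn m P \<Longrightarrow> dfn (k + m) (\<lambda>z. P (vecn m (\<lambda>i. z (k + i))))"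
proof (induction k)
  case 0
  then show ?case
    using dfn_cong[of m P "\<lambda>z. P (vecn m z)"] by (simp add: vecn_Rn)
next
  case (Suc k)
  have "(\<lambda>i. x (Suc i)) \<in> Rn (k + m)" if "x \<in> Rn (Suc (k + m))" for x
    using that by (simp add: Rn_iff)
  then have "{x \<in> Rn (Suc (k + m)). (\<lambda>i. x (Suc i)) \<in> {z \<in> Rn (k + m). P (vecn m (\<lambda>i. z (k + i)))}}
      = {x \<in> Rn (Suc (k + m)). P (vecn m (\<lambda>i. x (Suc (k + i))))}"
    by auto
  then show ?case
    using prod_left[OF Suc.IH[OF Suc.prems, unfolded dfn_def]] by (simp add: dfn_def)
qed

text \<open>Substitution is expressed by a quantifier: some tuple \<open>y\<close> equals the
  substituted values and satisfies \<open>P\<close>. The equations are algebraic.\<close>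

lemma dfn_subst_poly:
  assumes P: "dfn m P" and f: "\<And>i. i < m \<Longrightarrow> polynomial_fun n (f i)"
  shows "dfn n (\<lambda>x. P (vecn m (\<lambda>i. f i x)))"
proof -
  have "dfn (n + m) (\<lambda>z. \<forall>i<m. f i z - z (n + i) = 0)"
    by (intro dfn_all_less dfn_poly_zero polynomial_intros polynomial_fun_mono[OF f]) auto
  then have "dfn (n + m) (\<lambda>z. \<forall>i<m. f i (vecn n z) - vecn m (\<lambda>i. z (n + i)) i = 0)"
    by (rule iffD1[OF dfn_cong, rotated]) (simp add: polynomial_fun_vec[OF f])
  then have "dfn (n + m) (\<lambda>z. (\<forall>i<m. f i (vecn n z) - vecn m (\<lambda>i. z (n + i)) i = 0)
      \<and> P (vecn m (\<lambda>i. z (n + i))))"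
    by (intro dfn_conj dfn_shift P)
  then have "dfn n (\<lambda>x. \<exists>y\<in>Rn m. (\<forall>i<m. f i x - y i = 0) \<and> P y)"
    by (rule dfn_exs)
  moreover have "(\<exists>y\<in>Rn m. (\<forall>i<m. f i x - y i = 0) \<and> P y) \<longleftrightarrow> P (vecn m (\<lambda>i. f i x))" for x
  proof
    assume "\<exists>y\<in>Rn m. (\<forall>i<m. f i x - y i = 0) \<and> P y"
    then obtain y where y: "y \<in> Rn m" "\<forall>i<m. f i x - y i = 0" "P y" by auto
    then have "y = vecn m (\<lambda>i. f i x)" by (intro Rn_ext[OF y(1)]) auto
    then show "P (vecn m (\<lambda>i. f i x))" using y by simp
  qed (auto intro!: bexI[of _ "vecn m (\<lambda>i. f i x)"])
  ultimately show ?thesis by simp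
qed

text \<open>Permuting, repeating or skipping variables is a substitution of coordinate functions;
  the axioms themselves speak only of the first and the last coordinate.\<close>

lemma dfn_pick: "dfn m P \<Longrightarrow> (\<And>i. i < m \<Longrightarrow> \<sigma> i < n) \<Longrightarrow> dfn n (\<lambda>x. P (vecn m (\<lambda>i. x (\<sigma> i))))"
  by (rule dfn_subst_poly) (auto intro: polynomial_intros)

lemma dfn_subst:
  assumes P: "dfn m P" and f: "\<And>i. i < m \<Longrightarrow> dfun n (f i)"
  shows "dfn n (\<lambda>x. P (vecn m (\<lambda>i. f i x)))"
proof -
  have "dfn (n + m) (\<lambda>z. z (n + i) = f i (vecn n z))" if i: "i < m" for i
  proof -
    \<comment> \<open>The graph of \<open>f i\<close> lives on the coordinates 0, ..., n; its value
      slot is moved to the place of the bound variable number \<open>i\<close>.\<close>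
    have "dfn (n + m) (\<lambda>z. (\<lambda>w. w n = f i (vecn n w)) (vecn (Suc n) (\<lambda>l. z (if l < n then l else n + i))))"
      by (rule dfn_pick[OF f[OF i, unfolded dfun_def]]) (use i in auto)
    moreover have "vecn n (vecn (Suc n) (\<lambda>l. z (if l < n then l else n + i))) = vecn n z" for z :: "nat \<Rightarrow> real"
      by (auto simp: vecn_def)
    ultimately show ?thesis by simp
  qed
  then have "dfn (n + m) (\<lambda>z. (\<forall>i<m. z (n + i) = f i (vecn n z)) \<and> P (vecn m (\<lambda>i. z (n + i))))"
    by (intro dfn_conj dfn_shift P dfn_all_less)
  then have "dfn (n + m) (\<lambda>z. (\<forall>i<m. vecn m (\<lambda>i. z (n + i)) i = f i (vecn n z)) \<and> P (vecn m (\<lambda>i. z (n + i))))"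
    by (rule iffD1[OF dfn_cong, rotated]) simp
  then have "dfn n (\<lambda>x. \<exists>y\<in>Rn m. (\<forall>i<m. y i = f i x) \<and> P y)"
    by (rule dfn_exs)
  moreover have "(\<exists>y\<in>Rn m. (\<forall>i<m. y i = f i x) \<and> P y) \<longleftrightarrow> P (vecn m (\<lambda>i. f i x))" for x
  proof
    assume "\<exists>y\<in>Rn m. (\<forall>i<m. y i = f i x) \<and> P y"
    then obtain y where y: "y \<in> Rn m" "\<forall>i<m. y i = f i x" "P y" by auto
    then have "y = vecn m (\<lambda>i. f i x)" by (intro Rn_ext[OF y(1)]) auto
    then show "P (vecn m (\<lambda>i. f i x))" using y by simp
  qed (auto intro!: bexI[of _ "vecn m (\<lambda>i. f i x)"])
  ultimately show ?thesis by simp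
qed

lemma dfun_poly: "polynomial_fun n f \<Longrightarrow> dfun n f"
  unfolding dfun_def
  using dfn_poly_zero[OF polynomial_fun_diff[OF polynomial_fun.coord[of n "Suc n"] polynomial_fun_mono[of n f]]]
  by (simp add: polynomial_fun_vec)

lemma dfun_coord: "i < n \<Longrightarrow> dfun n (\<lambda>x. x i)"
  by (simp add: dfun_poly polynomial_intros)

lemma dfun_const: "dfun n (\<lambda>x. c)"
  by (simp add: dfun_poly polynomial_intros)

lemma dfun_weaken:
  assumes "dfun n f"
  shows "dfun (Suc n) (\<lambda>z. f (vecn n z))"
proof -
  have "dfn (Suc (Suc n)) (\<lambda>z. (\<lambda>w. w n = f (vecn n w)) (vecn (Suc n) (\<lambda>l. z (if l < n then l else Suc n))))"
    by (rule dfn_pick[OF assms[unfolded dfun_def]]) auto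
  moreover have "vecn n (vecn (Suc n) (\<lambda>l. z (if l < n then l else Suc n))) = vecn n z" for z :: "nat \<Rightarrow> real"
    by (auto simp: vecn_def)
  ultimately show ?thesis by (simp add: dfun_def)
qed

text \<open>The functions \<open>g i\<close> are substituted into the graph relation of
  \<open>f\<close>, while the last slot keeps the value variable.\<close>

lemma dfun_comp:
  assumes f: "dfun m f" and g: "\<And>i. i < m \<Longrightarrow> dfun n (g i)"
  shows "dfun n (\<lambda>x. f (vecn m (\<lambda>i. g i x)))"
proof -
  have "dfn (Suc n) (\<lambda>z. (\<lambda>w. w m = f (vecn m w)) (vecn (Suc m) (\<lambda>l. if l < m then g l (vecn n z) else z n)))"
  proof (rule dfn_subst[OF f[unfolded dfun_def]])
    fix i assume "i < Suc m"
    show "dfun (Suc n) (\<lambda>z. if i < m then g i (vecn n z) else z n)"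
      using dfun_weaken[OF g[of i]] dfun_coord[of n "Suc n"] by (cases "i < m") auto
  qed
  moreover have "vecn m (vecn (Suc m) (\<lambda>l. if l < m then g l (vecn n z) else z n)) = vecn m (\<lambda>i. g i (vecn n z))" for z
    by (auto simp: vecn_def)
  ultimately show ?thesis by (simp add: dfun_def)
qed

text \<open>The order becomes definable through the half line, which is an interval and hence
  definable by the o-minimality axiom.\<close>

lemma dfn_pos: "dfn 1 (\<lambda>w. 0 < w 0)"
  unfolding dfn_def o_minimal by (intro exI[of _ "{{0<..}}"]) auto

lemma dfn_less: "dfun n f \<Longrightarrow> dfun n g \<Longrightarrow> dfn n (\<lambda>x. f x < g x)"
proof -
  assume fg: "dfun n f" "dfun n g"
  have 1: "dfn 2 (\<lambda>w. (\<lambda>w. 0 < w 0) (vecn 1 (\<lambda>i. w 1 - w 0)))"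
    by (rule dfn_subst_poly[OF dfn_pos]) (auto intro!: polynomial_intros)
  have "dfn n (\<lambda>x. (\<lambda>w. (\<lambda>w. 0 < w 0) (vecn 1 (\<lambda>i. w 1 - w 0))) (vecn 2 (\<lambda>i. if i = 0 then f x else g x)))"
  proof (rule dfn_subst[OF 1])
    show "dfun n (\<lambda>x. if i = 0 then f x else g x)" for i :: nat
      using fg by (cases "i = 0") auto
  qed
  then show ?thesis by simp
qed

lemma dfn_le: "dfun n f \<Longrightarrow> dfun n g \<Longrightarrow> dfn n (\<lambda>x. f x \<le> g x)"
  using dfn_not[OF dfn_less[of n g f]] by (simp add: not_less)

lemma dfn_eq: "dfun n f \<Longrightarrow> dfun n g \<Longrightarrow> dfn n (\<lambda>x. f x = g x)"
  using dfn_conj[OF dfn_le[of n f g] dfn_le[of n g f]] by (simp add: order_eq_iff)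

lemma dfun_poly2:
  assumes "polynomial_fun 2 (\<lambda>w. F (w 0) (w 1))" "dfun n f" "dfun n g"
  shows "dfun n (\<lambda>x. F (f x) (g x))"
proof -
  have "dfun n (\<lambda>x. (\<lambda>w. F (w 0) (w 1)) (vecn 2 (\<lambda>i. if i = 0 then f x else g x)))"
  proof (rule dfun_comp)
    show "dfun n (\<lambda>x. if i = 0 then f x else g x)" for i :: nat
      using assms by (cases "i = 0") auto
  qed (use assms dfun_poly in auto)
  then show ?thesis by simp
qed

lemma dfun_add: "dfun n f \<Longrightarrow> dfun n g \<Longrightarrow> dfun n (\<lambda>x. f x + g x)"
  by (rule dfun_poly2[where F = "\<lambda>a b. a + b"]) (auto intro!: polynomial_intros)

lemma dfun_diff: "dfun n f \<Longrightarrow> dfun n g \<Longrightarrow> dfun n (\<lambda>x. f x - g x)"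
  by (rule dfun_poly2[where F = "\<lambda>a b. a - b"]) (auto intro!: polynomial_intros)

lemma dfun_mult: "dfun n f \<Longrightarrow> dfun n g \<Longrightarrow> dfun n (\<lambda>x. f x * g x)"
  by (rule dfun_poly2[where F = "\<lambda>a b. a * b"]) (auto intro!: polynomial_intros)

lemma dfn_abs_less: "dfun n f \<Longrightarrow> dfun n g \<Longrightarrow> dfn n (\<lambda>x. \<bar>f x\<bar> < g x)"
proof -
  assume fg: "dfun n f" "dfun n g"
  have "dfn n (\<lambda>x. f x < g x \<and> 0 - f x < g x)"
    by (intro dfn_conj dfn_less dfun_diff dfun_const fg)
  then show ?thesis by (simp add: abs_less_iff)
qed

lemma dfn_iff: "dfn n P \<Longrightarrow> dfn n Q \<Longrightarrow> dfn n (\<lambda>x. P x \<longleftrightarrow> Q x)"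
  using dfn_conj[OF dfn_imp[of n P Q] dfn_imp[of n Q P]]
  by (simp only: iff_conv_conj_imp)

text \<open>With these rules definability follows from the shape of a formula, without any
  set-theoretic description of the set.\<close>

lemmas dfn_intros = dfn_const dfn_not dfn_conj dfn_disj dfn_imp dfn_iff dfn_less dfn_le dfn_eq
  dfn_abs_less dfn_all_less dfn_ex dfn_all dfn_exs

lemmas dfun_intros = dfun_const dfun_coord dfun_add dfun_diff dfun_mult

end

section \<open>Boxes and category\<close>

text \<open>Realizes the abstract space as a subspace of the function type with its product
  topology, so that \<open>continuous_on\<close>, \<open>open\<close> and \<open>compact\<close>
  become available.\<close>

lemma Euclidean_space_eq: "Euclidean_space n = top_of_set (Rn n)"
  by (simp add: Euclidean_space_def euclidean_product_topology)

lemma openin_Rn_open: "openin (Euclidean_space n) U \<longleftrightarrow> (\<exists>T. open T \<and> U = Rn n \<inter> T)"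
  by (subst Euclidean_space_eq) (rule openin_open)

text \<open>Boxes stand in for general open sets: they are definable, and a box over one more
  coordinate is a box times an interval, which is what inductions on \<open>m\<close> need. For
  \<open>m = 0\<close> the box is a single point.\<close>

definition bx :: "nat \<Rightarrow> (nat \<Rightarrow> real) \<Rightarrow> (nat \<Rightarrow> real) \<Rightarrow> (nat \<Rightarrow> real) set"
  where "bx m a b = {x \<in> Rn m. \<forall>i<m. a i < x i \<and> x i < b i}"

definition proper :: "nat \<Rightarrow> (nat \<Rightarrow> real) \<Rightarrow> (nat \<Rightarrow> real) \<Rightarrow> bool"
  where "proper m a b \<longleftrightarrow> (\<forall>i<m. a i < b i)"

lemma bx_Rn: "bx m a b \<subseteq> Rn m"
  by (auto simp: bx_def)

lemma bx_nonempty: "proper m a b \<Longrightarrow> bx m a b \<noteq> {}"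
proof -
  assume "proper m a b"
  then have "vecn m (\<lambda>i. (a i + b i) / 2) \<in> bx m a b"
    by (auto simp: bx_def proper_def)
  then show ?thesis by blast
qed

lemma open_coordinate_box: "open {y :: nat \<Rightarrow> real. \<forall>i<n. \<bar>y i - x i\<bar> < r}"
proof -
  have "open {y :: nat \<Rightarrow> real. \<forall>i\<in>{..<n}. y (id i) \<in> ball (x i) r}"
    by (rule product_topology_basis') auto
  then show ?thesis
    by (simp add: dist_real_def abs_minus_commute Ball_def)
qed

lemma openin_Rn_iff:
  "openin (Euclidean_space n) U \<longleftrightarrow>
    U \<subseteq> Rn n \<and> (\<forall>x\<in>U. \<exists>r>0. \<forall>y\<in>Rn n. (\<forall>i<n. \<bar>y i - x i\<bar> < r) \<longrightarrow> y \<in> U)"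
proof
  assume "openin (Euclidean_space n) U"
  then obtain T where T: "open T" "U = Rn n \<inter> T"
    by (auto simp: openin_Rn_open)
  have "\<exists>r>0. \<forall>y\<in>Rn n. (\<forall>i<n. \<bar>y i - x i\<bar> < r) \<longrightarrow> y \<in> U" if x: "x \<in> U" for x
  proof -
    have "openin (product_topology (\<lambda>i. euclidean) UNIV) T" "x \<in> T"
      using T x by (auto simp: open_fun_def)
    from product_topology_open_contains_basis[OF this]
    obtain X where X: "x \<in> Pi\<^sub>E UNIV X" "\<And>i. open (X i)" "Pi\<^sub>E UNIV X \<subseteq> T"
      by (simp, blast)
    have "\<forall>i. \<exists>r>0. ball (x i) r \<subseteq> X i"
      using X(1,2) by (meson PiE_mem UNIV_I openE)
    then obtain r where r: "\<And>i. r i > 0" "\<And>i. ball (x i) (r i) \<subseteq> X i"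
      by metis
    \<comment> \<open>Coordinates from \<open>n\<close> on are 0 for both points, so only finitely
      many radii count; the 1 keeps the minimum meaningful for \<open>n = 0\<close>.\<close>
    define s where "s = Min (insert 1 (r ` {..<n}))"
    have s: "s > 0" "\<And>i. i < n \<Longrightarrow> s \<le> r i"
      using r by (auto simp: s_def)
    have "y \<in> U" if y: "y \<in> Rn n" "\<forall>i<n. \<bar>y i - x i\<bar> < s" for y
    proof -
      have "y i \<in> X i" for i
      proof (cases "i < n")
        case True
        then have "y i \<in> ball (x i) (r i)"
          using y(2) s(2)[OF True] by (force simp: dist_real_def abs_minus_commute)
        then show ?thesis using r(2) by blast
      next
        case False
        then have "y i = x i" using y(1) x T by (auto simp: Rn_iff)
        then show ?thesis using X(1) by auto
      qed
      then show ?thesis using X(3) T y(1) by auto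
    qed
    then show ?thesis using s(1) by auto
  qed
  then show "U \<subseteq> Rn n \<and> (\<forall>x\<in>U. \<exists>r>0. \<forall>y\<in>Rn n. (\<forall>i<n. \<bar>y i - x i\<bar> < r) \<longrightarrow> y \<in> U)"
    using T by blast
next
  assume U: "U \<subseteq> Rn n \<and> (\<forall>x\<in>U. \<exists>r>0. \<forall>y\<in>Rn n. (\<forall>i<n. \<bar>y i - x i\<bar> < r) \<longrightarrow> y \<in> U)"
  show "openin (Euclidean_space n) U"
  proof (subst openin_subopen, intro ballI)
    fix x assume x: "x \<in> U"
    from bspec[OF conjunct2[OF U] x]
    obtain r where r: "r > 0" "\<forall>y\<in>Rn n. (\<forall>i<n. \<bar>y i - x i\<bar> < r) \<longrightarrow> y \<in> U"
      by (elim exE conjE) (rule that)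
    let ?T = "Rn n \<inter> {y. \<forall>i<n. \<bar>y i - x i\<bar> < r}"
    have "openin (Euclidean_space n) ?T"
      unfolding openin_Rn_open by (rule exI[of _ "{y. \<forall>i<n. \<bar>y i - x i\<bar> < r}"])
        (simp add: open_coordinate_box)
    moreover have "x \<in> ?T" using x U r(1) by force
    moreover have "?T \<subseteq> U" using r(2) by blast
    ultimately show "\<exists>T. openin (Euclidean_space n) T \<and> x \<in> T \<and> T \<subseteq> U"
      by (intro exI conjI)
  qed
qed

lemma openin_RnD:
  assumes "openin (Euclidean_space n) U" "x \<in> U"
  obtains r where "r > 0" "\<forall>y\<in>Rn n. (\<forall>i<n. \<bar>y i - x i\<bar> < r) \<longrightarrow> y \<in> U"
proof -
  have "\<exists>r>0. \<forall>y\<in>Rn n. (\<forall>i<n. \<bar>y i - x i\<bar> < r) \<longrightarrow> y \<in> U"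
    using assms by (simp only: openin_Rn_iff)
  then show thesis
    by (elim exE conjE) (rule that)
qed

lemma openin_bx: "openin (Euclidean_space m) (bx m a b)"
  unfolding openin_Rn_iff
proof (intro conjI bx_Rn ballI)
  fix x assume x: "x \<in> bx m a b"
  define r where "r = Min (insert 1 ((\<lambda>i. min (x i - a i) (b i - x i)) ` {..<m}))"
  have "r > 0"
    using x by (auto simp: r_def bx_def)
  moreover have "r \<le> min (x i - a i) (b i - x i)" if "i < m" for i
    unfolding r_def using that by (intro Min_le) auto
  ultimately have "r > 0" "\<forall>y\<in>Rn m. (\<forall>i<m. \<bar>y i - x i\<bar> < r) \<longrightarrow> y \<in> bx m a b"
    by (fastforce simp: bx_def)+
  then show "\<exists>r>0. \<forall>y\<in>Rn m. (\<forall>i<m. \<bar>y i - x i\<bar> < r) \<longrightarrow> y \<in> bx m a b"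
    by blast
qed

lemma openin_contains_bx:
  assumes "openin (Euclidean_space m) U" "x \<in> U" "e > 0"
  obtains c d where "proper m c d" "x \<in> bx m c d" "bx m c d \<subseteq> U"
    "\<forall>i<m. x i - e < c i \<and> c i < x i \<and> x i < d i \<and> d i < x i + e"
proof -
  obtain r where r: "r > 0" "\<forall>y\<in>Rn m. (\<forall>i<m. \<bar>y i - x i\<bar> < r) \<longrightarrow> y \<in> U"
    by (rule openin_RnD[OF assms(1,2)])
  define s where "s = min r e / 2"
  have s: "s > 0" "s < r" "s < e" using r assms(3) by (auto simp: s_def)
  have x: "x \<in> Rn m" using assms(1,2) openin_subset by blast
  show thesis
  proof (rule that[of "\<lambda>i. x i - s" "\<lambda>i. x i + s"])
    show "bx m (\<lambda>i. x i - s) (\<lambda>i. x i + s) \<subseteq> U"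
    proof
      fix y assume "y \<in> bx m (\<lambda>i. x i - s) (\<lambda>i. x i + s)"
      then have y: "y \<in> Rn m" "\<forall>i<m. x i - s < y i \<and> y i < x i + s" by (auto simp: bx_def)
      have "\<forall>i<m. \<bar>y i - x i\<bar> < r"
      proof (intro allI impI)
        fix i assume "i < m"
        then show "\<bar>y i - x i\<bar> < r" using spec[OF y(2), of i] s by (simp add: abs_less_iff)
      qed
      then show "y \<in> U" using r(2) y(1) by blast
    qed
  qed (use s x in \<open>auto simp: proper_def bx_def\<close>)
qed

text \<open>In this form continuity compares finitely many coordinates, so for a definable function
  it is a first-order condition.\<close>

lemma continuous_on_Rn_iff:
  fixes f :: "(nat \<Rightarrow> real) \<Rightarrow> real"
  assumes "U \<subseteq> Rn n"
  shows "continuous_on U f \<longleftrightarrow>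
    (\<forall>x\<in>U. \<forall>e>0. \<exists>d>0. \<forall>y\<in>U. (\<forall>i<n. \<bar>y i - x i\<bar> < d) \<longrightarrow> \<bar>f y - f x\<bar> < e)"
proof
  assume L: "continuous_on U f"
  show "\<forall>x\<in>U. \<forall>e>0. \<exists>d>0. \<forall>y\<in>U. (\<forall>i<n. \<bar>y i - x i\<bar> < d) \<longrightarrow> \<bar>f y - f x\<bar> < e"
  proof (intro ballI allI impI)
    fix x and e :: real assume x: "x \<in> U" and e: "e > 0"
    obtain A where A: "open A" "x \<in> A" "\<forall>y\<in>U. y \<in> A \<longrightarrow> f y \<in> ball (f x) e"
      using L[unfolded continuous_on_topological] x e by (metis centre_in_ball open_ball)
    have "openin (Euclidean_space n) (Rn n \<inter> A)"
      using A by (auto simp: openin_Rn_open)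
    moreover have "x \<in> Rn n \<inter> A" using A x assms by blast
    ultimately obtain d
      where d: "d > 0" "\<forall>y\<in>Rn n. (\<forall>i<n. \<bar>y i - x i\<bar> < d) \<longrightarrow> y \<in> Rn n \<inter> A"
      by (rule openin_RnD)
    have "\<forall>y\<in>U. (\<forall>i<n. \<bar>y i - x i\<bar> < d) \<longrightarrow> \<bar>f y - f x\<bar> < e"
      using A(3) d(2) assms by (auto simp: dist_real_def abs_minus_commute subset_iff)
    then show "\<exists>d>0. \<forall>y\<in>U. (\<forall>i<n. \<bar>y i - x i\<bar> < d) \<longrightarrow> \<bar>f y - f x\<bar> < e"
      using d(1) by blast
  qed
next
  assume R: "\<forall>x\<in>U. \<forall>e>0. \<exists>d>0. \<forall>y\<in>U. (\<forall>i<n. \<bar>y i - x i\<bar> < d) \<longrightarrow> \<bar>f y - f x\<bar> < e"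
  show "continuous_on U f"
    unfolding continuous_on_topological
  proof (intro ballI allI impI)
    fix x B assume x: "x \<in> U" and B: "open B" "f x \<in> B"
    then obtain e where e: "e > 0" "ball (f x) e \<subseteq> B"
      by (meson openE)
    with R x obtain d where d: "d > 0" "\<forall>y\<in>U. (\<forall>i<n. \<bar>y i - x i\<bar> < d) \<longrightarrow> \<bar>f y - f x\<bar> < e"
      by blast
    have "\<forall>y\<in>U. y \<in> {y. \<forall>i<n. \<bar>y i - x i\<bar> < d} \<longrightarrow> f y \<in> B"
      using d(2) e(2) by (auto simp: dist_real_def abs_minus_commute subset_iff)
    then show "\<exists>A. open A \<and> x \<in> A \<and> (\<forall>y\<in>U. y \<in> A \<longrightarrow> f y \<in> B)"
      using d(1) open_coordinate_box[of n x d] by (intro exI[of _ "{y. \<forall>i<n. \<bar>y i - x i\<bar> < d}"]) auto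
  qed
qed

section \<open>Definable sets contain or avoid a box\<close>

text \<open>The intervals are treated one by one: either the new one contains two points of the
  current interval and hence everything between them, or it meets it in at most one point, which can
  be cut off.\<close>

lemma finite_intervals_dichotomy:
  fixes a b :: real
  assumes "finite F" "\<forall>I\<in>F. is_interval I" "a < b"
  shows "\<exists>p q. a \<le> p \<and> p < q \<and> q \<le> b \<and> (\<forall>I\<in>F. {p<..<q} \<subseteq> I \<or> {p<..<q} \<inter> I = {})"
  using assms
proof (induction F rule: finite_induct)
  case empty
  then show ?case by auto
next
  case (insert I F)
  then obtain p q where pq: "a \<le> p" "p < q" "q \<le> b" "\<forall>I\<in>F. {p<..<q} \<subseteq> I \<or> {p<..<q} \<inter> I = {}"
    by auto
  show ?case
  proof (cases "\<exists>s t. s < t \<and> s \<in> I \<and> t \<in> I \<and> p < s \<and> t < q")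
    case True
    then obtain s t where st: "s < t" "s \<in> I" "t \<in> I" "p < s" "t < q" by auto
    have "{s<..<t} \<subseteq> I"
      using mem_is_interval_1_I[OF bspec[OF insert.prems(1), of I] st(2,3)] by auto
    moreover have "{s<..<t} \<subseteq> J \<or> {s<..<t} \<inter> J = {}" if "J \<in> F" for J
    proof -
      have "{s<..<t} \<subseteq> {p<..<q}" using st by auto
      then show ?thesis using bspec[OF pq(4) that] by blast
    qed
    ultimately show ?thesis using st pq by (intro exI[of _ s] exI[of _ t]) auto
  next
    case False
    \<comment> \<open>\<open>I\<close> has at most one point inside the current interval; to the
      right of that point nothing of \<open>I\<close> is left.\<close>
    obtain u where u: "p \<le> u" "u < q" "{u<..<q} \<inter> I = {}"
    proof (cases "\<exists>u\<in>I. p < u \<and> u < q")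
      case True
      then obtain u where "u \<in> I" "p < u" "u < q" by auto
      then show ?thesis using False by (intro that[of u]) auto
    next
      case F: False
      then show ?thesis using pq by (intro that[of p]) auto
    qed
    moreover have "{u<..<q} \<subseteq> J \<or> {u<..<q} \<inter> J = {}" if "J \<in> F" for J
    proof -
      have "{u<..<q} \<subseteq> {p<..<q}" using u by auto
      then show ?thesis using bspec[OF pq(4) that] by blast
    qed
    ultimately show ?thesis using pq by (intro exI[of _ u] exI[of _ q]) auto
  qed
qed

context o_minimal_structure
begin

lemma dfn_bx: "dfn m (\<lambda>x. x \<in> bx m a b)"
proof -
  have "dfn m (\<lambda>x. \<forall>i<m. a i < x i \<and> x i < b i)"
    by (intro dfn_intros dfun_intros)
  then show ?thesis
    by (rule iffD1[OF dfn_cong, rotated]) (simp add: bx_def)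
qed

lemma one_dim_intervals:
  assumes "dfn 1 (\<lambda>w. Q (w 0))"
  obtains F where "finite F" "\<forall>I\<in>F. is_interval I" "{t. Q t} = \<Union>F"
proof -
  obtain F where F: "finite F" "\<forall>I\<in>F. is_interval I"
    "{w \<in> Rn 1. Q (w 0)} = {x \<in> Rn 1. x 0 \<in> \<Union>F}"
    using assms unfolding dfn_def o_minimal by blast
  have "Q t \<longleftrightarrow> t \<in> \<Union>F" for t
  proof -
    have "vecn 1 (\<lambda>_. t) \<in> {w \<in> Rn 1. Q (w 0)} \<longleftrightarrow> vecn 1 (\<lambda>_. t) \<in> {x \<in> Rn 1. x 0 \<in> \<Union>F}"
      unfolding F(3) ..
    then show ?thesis by simp
  qed
  then show thesis using F that[of F] by auto
qed

text \<open>The endpoints are made rational so that only countably many triples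
  \<open>(p, q, s)\<close> occur, as the category argument requires.\<close>

lemma one_dim_dichotomy:
  fixes a b :: real
  assumes "dfn 1 (\<lambda>w. Q (w 0))" "a < b"
  obtains p q :: rat and s where "a < of_rat p" "p < q" "of_rat q < b"
    "\<forall>t. of_rat p < t \<and> t < of_rat q \<longrightarrow> (Q t \<longleftrightarrow> s)"
proof -
  obtain F where F: "finite F" "\<forall>I\<in>F. is_interval I" "{t. Q t} = \<Union>F"
    by (rule one_dim_intervals[OF assms(1)])
  obtain p q :: real where pq: "a \<le> p" "p < q" "q \<le> b" "\<forall>I\<in>F. {p<..<q} \<subseteq> I \<or> {p<..<q} \<inter> I = {}"
    using finite_intervals_dichotomy[OF F(1,2) assms(2)] by auto
  obtain q' where q': "p < of_rat q'" "of_rat q' < q" using of_rat_dense[OF pq(2)] by blast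
  obtain p' where p': "p < of_rat p'" "of_rat p' < (of_rat q' :: real)" using of_rat_dense[OF q'(1)] by blast
  have "(\<forall>t\<in>{p<..<q}. Q t) \<or> (\<forall>t\<in>{p<..<q}. \<not> Q t)"
    using F(3) pq(4) by blast
  then obtain s where "\<forall>t\<in>{p<..<q}. Q t \<longleftrightarrow> s" by blast
  then show thesis
    using p' q' pq by (intro that[of p' q' s]) (auto simp: of_rat_less)
qed

lemma closure_of_meets: "x \<in> T closure_of A \<Longrightarrow> openin T U \<Longrightarrow> x \<in> U \<Longrightarrow> \<exists>y. y \<in> A \<and> y \<in> U"
  unfolding in_closure_of by blast

text \<open>If no box lies inside a single \<open>P k\<close>, then each \<open>P k\<close> is
  nowhere dense: a box inside the closure would contain a smaller box inside \<open>P k\<close> or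
  disjoint from it, and both are impossible. Countably many such sets cannot cover a box. The
  dichotomy is a hypothesis because this argument runs inside the induction that proves it.\<close>

lemma box_cover_aux:
  fixes P :: "nat \<Rightarrow> (nat \<Rightarrow> real) \<Rightarrow> bool"
  assumes dich: "\<forall>k a b. proper m a b \<longrightarrow> (\<exists>c d. proper m c d \<and> bx m c d \<subseteq> bx m a b \<and>
      ((\<forall>x\<in>bx m c d. P k x) \<or> (\<forall>x\<in>bx m c d. \<not> P k x)))"
    and ab: "proper m a b"
    and cover: "\<forall>x\<in>bx m a b. \<exists>k. P k x"
  shows "\<exists>k c d. proper m c d \<and> bx m c d \<subseteq> bx m a b \<and> (\<forall>x\<in>bx m c d. P k x)"
proof (rule ccontr)
  assume none: "\<not> ?thesis"
  let ?A = "\<lambda>k. {x \<in> bx m a b. P k x}"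
  let ?T = "\<lambda>k. Euclidean_space m closure_of ?A k"
  have int: "Euclidean_space m interior_of ?T k = {}" for k
  proof (rule ccontr)
    assume "Euclidean_space m interior_of ?T k \<noteq> {}"
    then obtain x where x: "x \<in> Euclidean_space m interior_of ?T k" by blast
    let ?O = "Euclidean_space m interior_of ?T k"
    have O: "openin (Euclidean_space m) ?O" "?O \<subseteq> ?T k"
      by (auto simp: interior_of_subset)
    \<comment> \<open>The interior of the closure need not lie in the original box, so the search
      continues at a point of \<open>?A k\<close> inside both.\<close>
    obtain y where y: "y \<in> ?O" "y \<in> ?A k"
      using closure_of_meets[OF subsetD[OF O(2) x] O(1) x] by blast
    have "openin (Euclidean_space m) (?O \<inter> bx m a b)"
      using O openin_bx by blast
    moreover have "y \<in> ?O \<inter> bx m a b" using y by blast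
    ultimately obtain c d where cd: "proper m c d" "bx m c d \<subseteq> ?O \<inter> bx m a b"
      by (rule openin_contains_bx[OF _ _ zero_less_one])
    obtain c' d' where c'd': "proper m c' d'" "bx m c' d' \<subseteq> bx m c d"
      "(\<forall>x\<in>bx m c' d'. P k x) \<or> (\<forall>x\<in>bx m c' d'. \<not> P k x)"
      using dich cd(1) by blast
    have "\<forall>x\<in>bx m c' d'. \<not> P k x"
      using c'd' cd none by blast
    moreover obtain z where z: "z \<in> bx m c' d'"
      using bx_nonempty[OF c'd'(1)] by blast
    moreover have "z \<in> ?T k" using z c'd'(2) cd(2) O(2) by blast
    ultimately show False
      using closure_of_meets[OF _ openin_bx[of m c' d'], of z "?A k"] by blast
  qed
  have "Euclidean_space m interior_of \<Union>(range ?T) = {}"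
    by (rule Baire_category_alt) (auto simp: completely_metrizable_Euclidean_space int)
  moreover have "bx m a b \<subseteq> \<Union>(range ?T)"
  proof
    fix x assume x: "x \<in> bx m a b"
    then obtain k where "P k x" using cover by blast
    then have "x \<in> ?A k" "?A k \<subseteq> topspace (Euclidean_space m)" using x bx_Rn by blast+
    then show "x \<in> \<Union>(range ?T)" using closure_of_subset by blast
  qed
  ultimately show False
    using interior_of_maximal[OF _ openin_bx] bx_nonempty[OF ab] by blast
qed

text \<open>Over each point of the base the truth value of \<open>P\<close> is constant on some
  rational interval. There are countably many such intervals, so by category, with the induction
  hypothesis as dichotomy on the base, one of them works over a whole box; the product of the two is
  the required box.\<close>

lemma box_dichotomy:
  assumes "dfn m P" "proper m a b"
  shows "\<exists>c d. proper m c d \<and> bx m c d \<subseteq> bx m a b \<and>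
    ((\<forall>x\<in>bx m c d. P x) \<or> (\<forall>x\<in>bx m c d. \<not> P x))"
  using assms
proof (induction m arbitrary: P a b)
  case 0
  have "bx 0 a b = {\<lambda>_. 0}" by (auto simp: bx_def Rn_iff)
  then show ?case
    by (intro exI[of _ a] exI[of _ b]) (simp add: proper_def)
next
  case (Suc m)
  \<comment> \<open>The number \<open>k\<close> encodes a rational interval strictly inside the last
    side of the box and the truth value that \<open>P\<close> takes on it above
    \<open>x\<close>.\<close>
  let ?E = "\<lambda>k x. case (from_nat k :: rat \<times> rat \<times> bool) of (p, q, s) \<Rightarrow>
    a m < of_rat p \<and> p < q \<and> of_rat q < b m \<and>
    (\<forall>t. of_rat p < t \<and> t < of_rat q \<longrightarrow> (P (x(m := t)) \<longleftrightarrow> s))"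
  have dE: "dfn m (?E k)" for k
  proof -
    obtain p q :: rat and s :: bool where k: "from_nat k = (p, q, s)" by (metis prod_cases3)
    have upd: "(vecn m z)(m := z m) = vecn (Suc m) z" for z by (auto simp: vecn_def)
    have "dfn (Suc m) (\<lambda>z. P ((vecn m z)(m := z m)))"
      unfolding upd by (rule dfn_pick[OF Suc.prems(1)])
    then show ?thesis
      unfolding k prod.case by (intro dfn_intros dfun_intros) auto
  qed
  have ab: "proper m a b" "a m < b m"
    using Suc.prems(2) by (auto simp: proper_def)
  have cover: "\<exists>k. ?E k x" if x: "x \<in> bx m a b" for x
  proof -
    have x': "x \<in> Rn m" using x bx_Rn by blast
    have upd: "vecn (Suc m) (\<lambda>l. if l < m then x l else w 0) = x(m := w 0)" for w :: "nat \<Rightarrow> real"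
      using x' by (auto simp: vecn_def Rn_iff)
    have "dfn 1 (\<lambda>w. P (vecn (Suc m) (\<lambda>l. if l < m then x l else w 0)))"
    proof (rule dfn_subst_poly[OF Suc.prems(1)])
      show "polynomial_fun 1 (\<lambda>w. if i < m then x i else w 0)" for i
        by (cases "i < m") (auto intro: polynomial_intros)
    qed
    then have "dfn 1 (\<lambda>w. (\<lambda>t. P (x(m := t))) (w 0))" by (simp add: upd)
    then obtain p q s where
      "a m < of_rat p" "p < q" "of_rat q < b m"
      "\<forall>t. of_rat p < t \<and> t < of_rat q \<longrightarrow> (P (x(m := t)) \<longleftrightarrow> s)"
      using ab(2) by (rule one_dim_dichotomy)
    then have "?E (to_nat (p, q, s)) x" by simp
    then show ?thesis by (rule exI)
  qed
  obtain k c d where cd: "proper m c d" "bx m c d \<subseteq> bx m a b" "\<forall>x\<in>bx m c d. ?E k x"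
  proof -
    have "\<forall>k a b. proper m a b \<longrightarrow> (\<exists>c d. proper m c d \<and> bx m c d \<subseteq> bx m a b \<and>
      ((\<forall>x\<in>bx m c d. ?E k x) \<or> (\<forall>x\<in>bx m c d. \<not> ?E k x)))"
      by (intro allI impI Suc.IH[OF dE])
    moreover have "\<forall>x\<in>bx m a b. \<exists>k. ?E k x"
      by (rule ballI) (rule cover)
    ultimately have "\<exists>k c d. proper m c d \<and> bx m c d \<subseteq> bx m a b \<and> (\<forall>x\<in>bx m c d. ?E k x)"
      by (intro box_cover_aux ab)
    then show thesis
      by (elim exE conjE) (rule that)
  qed
  obtain p q :: rat and s :: bool where k: "from_nat k = (p, q, s)" by (metis prod_cases3)
  have pq: "a m < of_rat p" "p < q" "of_rat q < b m"
    "\<forall>x\<in>bx m c d. \<forall>t. of_rat p < t \<and> t < of_rat q \<longrightarrow> (P (x(m := t)) \<longleftrightarrow> s)"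
    using cd(3) bx_nonempty[OF cd(1)] by (auto simp: k)
  let ?c = "c(m := of_rat p)" and ?d = "d(m := of_rat q)"
  have pr: "proper (Suc m) ?c ?d"
    using cd(1) pq(2) by (auto simp: proper_def less_Suc_eq of_rat_less)
  have mem: "vecn m x \<in> bx m c d \<and> of_rat p < x m \<and> x m < of_rat q \<and> (vecn m x)(m := x m) = x"
    if "x \<in> bx (Suc m) ?c ?d" for x
    using that by (auto simp: bx_def vecn_upd_last less_Suc_eq)
  have "bx (Suc m) ?c ?d \<subseteq> bx (Suc m) a b"
  proof
    fix x assume x: "x \<in> bx (Suc m) ?c ?d"
    then have "vecn m x \<in> bx m a b" using mem cd(2) by blast
    then have "a i < x i \<and> x i < b i" if "i < m" for i
      using that by (auto simp: bx_def)
    moreover have "a m < x m \<and> x m < b m"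
      using mem[OF x] pq by linarith
    ultimately show "x \<in> bx (Suc m) a b" using x by (auto simp: bx_def less_Suc_eq)
  qed
  moreover have "P x \<longleftrightarrow> s" if "x \<in> bx (Suc m) ?c ?d" for x
    using bspec[OF pq(4), of "vecn m x"] mem[OF that] by force
  ultimately show ?case using pr by blast
qed

text \<open>Turns a countable parameter that exists at each point, such as a radius
  \<open>1 / real (Suc k)\<close>, an integer level or a pair of rationals, into one parameter valid
  on a whole smaller box.\<close>

lemma box_cover:
  fixes P :: "'i::countable \<Rightarrow> (nat \<Rightarrow> real) \<Rightarrow> bool"
  assumes P: "\<And>k. dfn m (P k)" and ab: "proper m a b"
    and cover: "\<forall>x\<in>bx m a b. \<exists>k. P k x"
  obtains k c d where "proper m c d" "bx m c d \<subseteq> bx m a b" "\<forall>x\<in>bx m c d. P k x"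
proof -
  have "\<forall>k a b. proper m a b \<longrightarrow> (\<exists>c d. proper m c d \<and> bx m c d \<subseteq> bx m a b \<and>
      ((\<forall>x\<in>bx m c d. P (from_nat k) x) \<or> (\<forall>x\<in>bx m c d. \<not> P (from_nat k) x)))"
    by (intro allI impI box_dichotomy P)
  moreover have "\<forall>x\<in>bx m a b. \<exists>k. P (from_nat k) x"
    using cover by (metis from_nat_to_nat)
  ultimately have "\<exists>k c d. proper m c d \<and> bx m c d \<subseteq> bx m a b \<and> (\<forall>x\<in>bx m c d. P (from_nat k) x)"
    by (intro box_cover_aux ab)
  then show thesis
    by (elim exE conjE) (rule that)
qed

end

section \<open>Functions on boxes\<close>

lemma continuous_on_coord: "continuous_on A (\<lambda>x :: nat \<Rightarrow> real. x i)"
  by (rule continuous_on_subset[OF continuous_on_product_coordinates]) simp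

lemma continuous_on_vecn:
  "(\<And>i. i < m \<Longrightarrow> continuous_on A (\<lambda>x. f x i)) \<Longrightarrow> continuous_on A (\<lambda>x. vecn m (f x))"
proof (rule continuous_on_coordinatewise_then_product)
  show "continuous_on A (\<lambda>x. vecn m (f x) i)" if "\<And>i. i < m \<Longrightarrow> continuous_on A (\<lambda>x. f x i)" for i
    using that by (cases "i < m") (auto simp: vecn_def)
qed

lemma bx_open_at:
  assumes "x \<in> bx m a b"
  obtains r where "r > 0" "\<forall>y\<in>Rn m. (\<forall>i<m. \<bar>y i - x i\<bar> < r) \<longrightarrow> y \<in> bx m a b"
  by (rule openin_RnD[OF openin_bx assms])

lemma sub_box_small:
  assumes "proper m a b" "e > 0"
  obtains c d where "proper m c d" "bx m c d \<subseteq> bx m a b"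
    "\<forall>x\<in>bx m c d. \<forall>y\<in>bx m c d. \<forall>i<m. \<bar>y i - x i\<bar> < e"
proof -
  obtain z where z: "z \<in> bx m a b" using bx_nonempty[OF assms(1)] by blast
  have e2: "e / 2 > 0" using assms by simp
  obtain c d where cd: "proper m c d" "z \<in> bx m c d" "bx m c d \<subseteq> bx m a b"
    "\<forall>i<m. z i - e / 2 < c i \<and> c i < z i \<and> z i < d i \<and> d i < z i + e / 2"
    by (rule openin_contains_bx[OF openin_bx z e2])
  have "\<forall>x\<in>bx m c d. \<forall>y\<in>bx m c d. \<forall>i<m. \<bar>y i - x i\<bar> < e"
  proof (intro ballI allI impI)
    fix x y i assume "x \<in> bx m c d" "y \<in> bx m c d" "i < m"
    then have "c i < x i" "x i < d i" "c i < y i" "y i < d i" "d i - c i < e"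
      using cd(4) by (auto simp: bx_def dest!: spec[of _ i])
    then show "\<bar>y i - x i\<bar> < e" by linarith
  qed
  then show thesis by (rule that[OF cd(1,3)])
qed

lemma sub_box_small_image:
  fixes f :: "(nat \<Rightarrow> real) \<Rightarrow> real"
  assumes "proper m a b" "continuous_on (bx m a b) f" "e > 0"
  obtains c d where "proper m c d" "bx m c d \<subseteq> bx m a b"
    "\<forall>x\<in>bx m c d. \<forall>y\<in>bx m c d. \<bar>f y - f x\<bar> < e"
proof -
  obtain z where z: "z \<in> bx m a b" using bx_nonempty[OF assms(1)] by blast
  have "e / 2 > 0" using assms by simp
  then obtain dl where dl: "dl > 0" "\<forall>y\<in>bx m a b. (\<forall>i<m. \<bar>y i - z i\<bar> < dl) \<longrightarrow> \<bar>f y - f z\<bar> < e / 2"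
    using assms(2) z unfolding continuous_on_Rn_iff[OF bx_Rn] by meson
  obtain c d where cd: "proper m c d" "z \<in> bx m c d" "bx m c d \<subseteq> bx m a b"
    "\<forall>i<m. z i - dl < c i \<and> c i < z i \<and> z i < d i \<and> d i < z i + dl"
    by (rule openin_contains_bx[OF openin_bx z dl(1)])
  have near: "\<bar>f y - f z\<bar> < e / 2" if y: "y \<in> bx m c d" for y
  proof -
    have "\<bar>y i - z i\<bar> < dl" if "i < m" for i
      using y that spec[OF cd(4), of i] by (auto simp: bx_def abs_less_iff dest!: spec[of _ i])
    then show ?thesis using dl(2) cd(3) y by blast
  qed
  have "\<forall>x\<in>bx m c d. \<forall>y\<in>bx m c d. \<bar>f y - f x\<bar> < e"
  proof (intro ballI)
    fix x y assume "x \<in> bx m c d" "y \<in> bx m c d"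
    then show "\<bar>f y - f x\<bar> < e" using near[of x] near[of y] by linarith
  qed
  then show thesis by (rule that[OF cd(1,3)])
qed

lemma bx_line: "x \<in> bx m c d \<Longrightarrow> c i < t \<Longrightarrow> t < d i \<Longrightarrow> i < m \<Longrightarrow> x(i := t) \<in> bx m c d"
  by (auto simp: bx_def Rn_iff)

lemma continuous_on_line:
  fixes g :: "(nat \<Rightarrow> real) \<Rightarrow> real"
  assumes "continuous_on A g" "\<And>t. t \<in> T \<Longrightarrow> x(i := t) \<in> A"
  shows "continuous_on T (\<lambda>t. g (x(i := t)))"
proof (rule continuous_on_compose2[OF assms(1)])
  show "continuous_on T (\<lambda>t. x(i := t))"
  proof (rule continuous_on_coordinatewise_then_product)
    show "continuous_on T (\<lambda>t. (x(i := t)) j)" for j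
      by (cases "j = i") auto
  qed
qed (use assms(2) in auto)

text \<open>Along each coordinate line the function has derivative 0 and so is constant; two points
  of a box are joined by changing one coordinate at a time.\<close>

lemma locally_constant_on_box:
  fixes g :: "(nat \<Rightarrow> real) \<Rightarrow> real"
  assumes loc: "\<forall>i<m. \<forall>x\<in>bx m c d. \<exists>e>0. \<forall>t. \<bar>t - x i\<bar> < e \<and> x(i := t) \<in> bx m c d \<longrightarrow> g (x(i := t)) = g x"
    and x: "x \<in> bx m c d" and y: "y \<in> bx m c d"
  shows "g x = g y"
proof -
  let ?z = "\<lambda>k l. if l < k then y l else x l"
  have "?z k \<in> bx m c d" for k
    using x y by (auto simp: bx_def Rn_iff)
  then have line: "g (z(i := s)) = g z" if "z \<in> bx m c d" "i < m" "c i < s" "s < d i" for z i s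
  proof -
    note z = that
    let ?\<phi> = "\<lambda>t. g (z(i := t))"
    have "(?\<phi> has_real_derivative 0) (at t within {c i<..<d i})" if t: "t \<in> {c i<..<d i}" for t
    proof -
      have zt: "z(i := t) \<in> bx m c d" using t z bx_line by auto
      from bspec[OF mp[OF spec[OF loc] z(2)] this]
      obtain e where e: "e > 0"
        "\<forall>s. \<bar>s - t\<bar> < e \<and> z(i := s) \<in> bx m c d \<longrightarrow> ?\<phi> s = ?\<phi> t"
        unfolding fun_upd_upd fun_upd_same by (elim exE conjE) (rule that)
      show ?thesis
      proof (rule has_field_derivative_transform_within[OF DERIV_const[of "?\<phi> t"] e(1) t])
        fix s assume "s \<in> {c i<..<d i}" "dist s t < e"
        then show "?\<phi> t = ?\<phi> s"
          using e(2) bx_line[OF z(1), of i s] z(2) by (auto simp: dist_real_def)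
      qed
    qed
    then have "\<exists>k. \<forall>t\<in>{c i<..<d i}. ?\<phi> t = k"
      by (intro has_field_derivative_zero_constant) auto
    moreover have "z i \<in> {c i<..<d i}" using z by (auto simp: bx_def)
    moreover have "s \<in> {c i<..<d i}" using z by auto
    ultimately have "?\<phi> s = ?\<phi> (z i)" by metis
    then show ?thesis by simp
  qed
  have "g (?z k) = g x" if "k \<le> m" for k
    using that
  proof (induction k)
    case (Suc k)
    have "?z (Suc k) = (?z k)(k := y k)" by (auto simp: less_Suc_eq)
    moreover have "g ((?z k)(k := y k)) = g (?z k)"
    proof (rule line)
      show "?z k \<in> bx m c d" using x y by (auto simp: bx_def Rn_iff)
    qed (use Suc y in \<open>auto simp: bx_def\<close>)
    ultimately show ?case using Suc by simp
  qed simp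
  moreover have "?z m = y" using x y by (intro Rn_ext[of _ m]) (auto simp: bx_def Rn_iff)
  ultimately show ?thesis by (metis le_refl)
qed

text \<open>An interval with two points contains an open interval, so here every member of
  \<open>F\<close> has at most one point. For definable subsets of the line this is the alternative
  between finite sets and sets with interior.\<close>

lemma finite_of_no_pair:
  fixes F :: "real set set"
  assumes "finite F" "\<forall>I\<in>F. is_interval I" "\<not> (\<exists>u v. u < v \<and> {u<..<v} \<subseteq> \<Union>F)"
  shows "finite (\<Union>F)"
proof (rule finite_Union[OF assms(1)])
  fix I assume I: "I \<in> F"
  have "x = y" if "x \<in> I" "y \<in> I" for x y
  proof (rule ccontr)
    assume "x \<noteq> y"
    then have "{min x y<..<max x y} \<subseteq> I"
      using mem_is_interval_1_I[OF bspec[OF assms(2) I], of "min x y" "max x y"] that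
      by (auto simp: min_def max_def split: if_splits)
    then show False
      using assms(3) I \<open>x \<noteq> y\<close> by (metis Union_upper min_def max_def linorder_neqE order.asym order.trans less_eq_real_def)
  qed
  then show "finite I"
    by (metis finite.emptyI finite.insertI finite_subset is_singletonI' is_singleton_def order_refl)
qed

section \<open>Generic continuity and level sets of definable functions\<close>

context o_minimal_structure
begin

lemma dfn_alls:
  assumes "dfn (n + m) (\<lambda>z. P (vecn n z) (vecn m (\<lambda>i. z (n + i))))"
  shows "dfn n (\<lambda>x. \<forall>y\<in>Rn m. P x y)"
  using dfn_not[OF dfn_exs[where P = "\<lambda>x y. \<not> P x y", OF dfn_not[OF assms]]] by simp

text \<open>The condition \<open>b\<close> does not depend on the argument; it decides which
  expression fills a given slot of a substituted tuple.\<close>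

lemma dfun_cases:
  "(b \<Longrightarrow> dfun n f) \<Longrightarrow> (\<not> b \<Longrightarrow> dfun n g) \<Longrightarrow> dfun n (\<lambda>x. if b then f x else g x)"
  by (cases b) simp_all

text \<open>Continuity at a point is a definable condition, so on some box it holds everywhere or
  nowhere. In the second case category gives a box where the oscillation is bounded below at every
  point, and a further box on which the values lie in a thin strip; these contradict each
  other.\<close>

lemma generic_continuity:
  assumes f: "dfun m f" and ab: "proper m a b"
  obtains c d where "proper m c d" "bx m c d \<subseteq> bx m a b" "continuous_on (bx m c d) f"
proof -
  let ?C = "\<lambda>x e. \<exists>t. 0 < t \<and> (\<forall>y\<in>Rn m. y \<in> bx m a b \<and> (\<forall>i<m. \<bar>y i - x i\<bar> < t) \<longrightarrow> \<bar>f y - f x\<bar> < e)"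
  note df = dfun_comp[OF f] dfn_subst[OF dfn_bx]
  have dC: "dfn m (\<lambda>x. \<forall>e. 0 < e \<longrightarrow> ?C x e)"
    by (intro dfn_intros dfn_alls dfun_intros df; simp add: dfun_coord)
  have dN: "dfn m (\<lambda>x. \<not> ?C x e)" for e
    by (intro dfn_intros dfn_alls dfun_intros df; simp add: dfun_coord)
  obtain c d where cd: "proper m c d" "bx m c d \<subseteq> bx m a b"
    "(\<forall>x\<in>bx m c d. \<forall>e. 0 < e \<longrightarrow> ?C x e) \<or> (\<forall>x\<in>bx m c d. \<not> (\<forall>e. 0 < e \<longrightarrow> ?C x e))"
    using box_dichotomy[OF dC ab] by (elim exE conjE) (rule that)
  have "\<forall>x\<in>bx m c d. \<forall>e. 0 < e \<longrightarrow> ?C x e"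
  proof (rule ccontr)
    assume "\<not> ?thesis"
    then have none: "\<forall>x\<in>bx m c d. \<not> (\<forall>e. 0 < e \<longrightarrow> ?C x e)" using cd(3) by argo
    have "\<forall>x\<in>bx m c d. \<exists>k::nat. \<not> ?C x (1 / real (Suc k))"
    proof
      fix x assume "x \<in> bx m c d"
      then obtain e where e: "0 < e" "\<not> ?C x e" using none by blast
      obtain k where k: "1 / real (Suc k) < e" using nat_approx_posE[OF e(1)] by blast
      have "\<not> ?C x (1 / real (Suc k))"
      proof
        assume "?C x (1 / real (Suc k))"
        then obtain t where "0 < t"
          "\<forall>y\<in>Rn m. y \<in> bx m a b \<and> (\<forall>i<m. \<bar>y i - x i\<bar> < t) \<longrightarrow> \<bar>f y - f x\<bar> < 1 / real (Suc k)"
          by blast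
        then have "?C x e" using k by (intro exI[of _ t]) (auto intro: less_trans)
        then show False using e by blast
      qed
      then show "\<exists>k::nat. \<not> ?C x (1 / real (Suc k))" by (rule exI)
    qed
    then obtain k and c1 d1 where 1: "proper m c1 d1" "bx m c1 d1 \<subseteq> bx m c d"
      "\<forall>x\<in>bx m c1 d1. \<not> ?C x (1 / real (Suc k))"
      by (rule box_cover[OF dN cd(1)])
    \<comment> \<open>The range is cut into strips of width \<open>w\<close>, half the oscillation
      bound. They are indexed by the integers, and on a box inside one strip the values differ by
      less than \<open>w\<close>.\<close>
    define u where "u = 1 / real (Suc k)"
    define w where "w = u / 2"
    have "u > 0" by (simp add: u_def)
    then have w: "w > 0" "1 / real (Suc k) = 2 * w"
      by (simp_all only: w_def u_def[symmetric])
    have dj: "dfn m (\<lambda>x. of_int j * w \<le> f x \<and> f x < (of_int j + 1) * w)" for j :: int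
      by (intro dfn_intros dfun_intros f)
    have "\<forall>x\<in>bx m c1 d1. \<exists>j::int. of_int j * w \<le> f x \<and> f x < (of_int j + 1) * w"
    proof
      fix x
      have "of_int \<lfloor>f x / w\<rfloor> \<le> f x / w" "f x / w < of_int \<lfloor>f x / w\<rfloor> + 1" by linarith+
      then show "\<exists>j::int. of_int j * w \<le> f x \<and> f x < (of_int j + 1) * w"
        using w(1) by (intro exI[of _ "\<lfloor>f x / w\<rfloor>"])
          (simp add: pos_le_divide_eq[symmetric] pos_divide_less_eq[symmetric])
    qed
    then obtain j and c2 d2 where 2: "proper m c2 d2" "bx m c2 d2 \<subseteq> bx m c1 d1"
      "\<forall>x\<in>bx m c2 d2. of_int j * w \<le> f x \<and> f x < (of_int j + 1) * w"
      by (rule box_cover[OF dj 1(1)])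
    obtain x where x: "x \<in> bx m c2 d2" using bx_nonempty[OF 2(1)] by blast
    then obtain r where r: "r > 0" "\<forall>y\<in>Rn m. (\<forall>i<m. \<bar>y i - x i\<bar> < r) \<longrightarrow> y \<in> bx m c2 d2"
      by (rule bx_open_at)
    have "?C x (1 / real (Suc k))"
    proof (intro exI[of _ r] conjI ballI impI r(1))
      fix y assume y: "y \<in> Rn m" "y \<in> bx m a b \<and> (\<forall>i<m. \<bar>y i - x i\<bar> < r)"
      then have "y \<in> bx m c2 d2" using r(2) by blast
      then have "of_int j * w \<le> f y \<and> f y < (of_int j + 1) * w" "of_int j * w \<le> f x \<and> f x < (of_int j + 1) * w"
        using 2(3) x by blast+
      then show "\<bar>f y - f x\<bar> < 1 / real (Suc k)"
        unfolding w(2) distrib_right by linarith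
    qed
    then show False using 1(3) x 2(2) by blast
  qed
  then have "continuous_on (bx m c d) f"
    unfolding continuous_on_Rn_iff[OF bx_Rn]
  proof (intro ballI allI impI)
    fix x and e :: real assume *: "\<forall>x\<in>bx m c d. \<forall>e. 0 < e \<longrightarrow> ?C x e" and x: "x \<in> bx m c d" "0 < e"
    then obtain t where t: "0 < t" "\<forall>y\<in>Rn m. y \<in> bx m a b \<and> (\<forall>i<m. \<bar>y i - x i\<bar> < t) \<longrightarrow> \<bar>f y - f x\<bar> < e"
      by blast
    then show "\<exists>d'>0. \<forall>y\<in>bx m c d. (\<forall>i<m. \<bar>y i - x i\<bar> < d') \<longrightarrow> \<bar>f y - f x\<bar> < e"
      using cd(2) bx_Rn by (intro exI[of _ t]) blast
  qed
  then show thesis by (rule that[OF cd(1,2)])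
qed

text \<open>The level set is cut out transversally to a coordinate along which \<open>g\<close> is injective; the
  resulting implicit function need only be definable, as it is then continuous on some smaller box.\<close>

lemma level_set_box:
  assumes g: "dfun m g" and ab: "proper m a b" and cont: "continuous_on (bx m a b) g"
    and nonconst: "\<forall>c d. proper m c d \<and> bx m c d \<subseteq> bx m a b \<longrightarrow> (\<exists>x\<in>bx m c d. \<exists>y\<in>bx m c d. g x \<noteq> g y)"
  shows "\<exists>m0 c d r v. m = Suc m0 \<and> proper m0 c d \<and> (\<forall>x. r x \<in> Rn m) \<and> (\<forall>j<m. dfun m0 (\<lambda>x. r x j)) \<and>
    r ` bx m0 c d \<subseteq> bx m a b \<and> inj_on r (bx m0 c d) \<and> continuous_on (bx m0 c d) r \<and>
    (\<forall>x\<in>bx m0 c d. g (r x) = v)"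
proof -
  \<comment> \<open>Local constancy at \<open>x\<close> along coordinate \<open>i\<close>; its
    failure on a box for one \<open>i\<close> selects the coordinate to solve for.\<close>
  let ?L = "\<lambda>i x. \<exists>e. 0 < e \<and> (\<forall>t. \<bar>t - x i\<bar> < e \<and> x(i := t) \<in> bx m a b \<longrightarrow> g (x(i := t)) = g x)"
  have upd: "x(i := t) = vecn m (\<lambda>l. if l = i then t else x l)" if "x \<in> Rn m" "i < m" for x :: "nat \<Rightarrow> real" and i t
    using that by (auto simp: vecn_def Rn_iff fun_eq_iff)
  note df = dfun_comp[OF g] dfn_subst[OF dfn_bx]
  have dL: "dfn m (?L i)" if i: "i < m" for i
  proof -
    have "dfn m (\<lambda>x. \<exists>e. 0 < e \<and> (\<forall>t. \<bar>t - x i\<bar> < e \<and> vecn m (\<lambda>l. if l = i then t else x l) \<in> bx m a b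
      \<longrightarrow> g (vecn m (\<lambda>l. if l = i then t else x l)) = g (vecn m x)))"
      by (intro dfn_intros dfun_intros df dfun_cases; use i in \<open>simp add: dfun_coord\<close>)
    then show ?thesis
    proof (rule iffD1[OF dfn_cong, rotated])
      fix x :: "nat \<Rightarrow> real" assume x: "x \<in> Rn m"
      show "(\<exists>e. 0 < e \<and> (\<forall>t. \<bar>t - x i\<bar> < e \<and> vecn m (\<lambda>l. if l = i then t else x l) \<in> bx m a b
        \<longrightarrow> g (vecn m (\<lambda>l. if l = i then t else x l)) = g (vecn m x))) \<longleftrightarrow> ?L i x"
        by (simp only: upd[OF x i] vecn_Rn[OF x])
    qed
  qed
  \<comment> \<open>Otherwise the dichotomy, applied to one coordinate after the other, leads to a
    box on which \<open>g\<close> is locally constant in all of them, hence constant, against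
    \<open>nonconst\<close>.\<close>
  have "\<exists>i<m. \<exists>c d. proper m c d \<and> bx m c d \<subseteq> bx m a b \<and> (\<forall>x\<in>bx m c d. \<not> ?L i x)"
  proof (rule ccontr)
    assume none: "\<not> ?thesis"
    have "\<exists>c d. proper m c d \<and> bx m c d \<subseteq> bx m a b \<and> (\<forall>i<k. \<forall>x\<in>bx m c d. ?L i x)" if "k \<le> m" for k
      using that
    proof (induction k)
      case 0
      show ?case by (intro exI[of _ a] exI[of _ b] conjI ab) simp_all
    next
      case (Suc k)
      from Suc.IH[OF Suc_leD[OF Suc.prems]] obtain c d where cd: "proper m c d" "bx m c d \<subseteq> bx m a b" "\<forall>i<k. \<forall>x\<in>bx m c d. ?L i x"
        by (elim exE conjE) (rule that)
      have k: "k < m" using Suc.prems by simp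
      obtain c' d' where cd': "proper m c' d'" "bx m c' d' \<subseteq> bx m c d"
        "(\<forall>x\<in>bx m c' d'. ?L k x) \<or> (\<forall>x\<in>bx m c' d'. \<not> ?L k x)"
        using box_dichotomy[OF dL[OF k] cd(1)] by (elim exE conjE) (rule that)
      have sub: "bx m c' d' \<subseteq> bx m a b" using cd(2) cd'(2) by (rule order_trans[rotated])
      have "\<not> (\<forall>x\<in>bx m c' d'. \<not> ?L k x)"
      proof
        assume "\<forall>x\<in>bx m c' d'. \<not> ?L k x"
        then have "\<exists>i<m. \<exists>c d. proper m c d \<and> bx m c d \<subseteq> bx m a b \<and> (\<forall>x\<in>bx m c d. \<not> ?L i x)"
          by (intro exI[of _ k] conjI k exI[of _ c'] exI[of _ d'] cd'(1) sub)
        with none show False by (rule notE)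
      qed
      with cd'(3) have Lk: "\<forall>x\<in>bx m c' d'. ?L k x" by argo
      have "\<forall>i<Suc k. \<forall>x\<in>bx m c' d'. ?L i x"
      proof (intro allI impI ballI)
        fix i x assume "i < Suc k" and x: "x \<in> bx m c' d'"
        then consider "i < k" | "i = k" by linarith
        then show "?L i x"
        proof cases
          case 1
          then show ?thesis using cd(3) subsetD[OF cd'(2) x] by (elim allE[of _ i] impE ballE[of _ _ x]) auto
        next
          case 2
          then show ?thesis using bspec[OF Lk x] by simp
        qed
      qed
      then show ?case by (intro exI[of _ c'] exI[of _ d'] conjI cd'(1) sub)
    qed
    from this[OF le_refl] obtain c d where cd: "proper m c d" "bx m c d \<subseteq> bx m a b"
      "\<forall>i<m. \<forall>x\<in>bx m c d. ?L i x"
      by (elim exE conjE) (rule that)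
    have "\<exists>x\<in>bx m c d. \<exists>y\<in>bx m c d. g x \<noteq> g y"
      using nonconst cd(1,2) by metis
    then obtain x y where xy: "x \<in> bx m c d" "y \<in> bx m c d" "g x \<noteq> g y" by metis
    have "g x = g y"
    proof (rule locally_constant_on_box[OF _ xy(1,2)], intro allI impI ballI)
      fix i z assume "i < m" "z \<in> bx m c d"
      then have "?L i z" using cd(3) by metis
      then obtain e where "0 < e" "\<forall>t. \<bar>t - z i\<bar> < e \<and> z(i := t) \<in> bx m a b \<longrightarrow> g (z(i := t)) = g z"
        by (elim exE conjE) (rule that)
      then show "\<exists>e>0. \<forall>t. \<bar>t - z i\<bar> < e \<and> z(i := t) \<in> bx m c d \<longrightarrow> g (z(i := t)) = g z"
        using cd(2) by (intro exI[of _ e] conjI) (auto dest: subsetD)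
    qed
    with xy(3) show False by (rule notE)
  qed
  then obtain i c d where i: "i < m" and cd: "proper m c d" "bx m c d \<subseteq> bx m a b" "\<forall>x\<in>bx m c d. \<not> ?L i x"
    by (elim exE conjE) (rule that)

  \<comment> \<open>\<open>x\<close> is the only point of its level set on the line in direction
    \<open>i\<close> within distance \<open>1 / real (Suc k)\<close>.\<close>
  let ?I = "\<lambda>k x. \<forall>t. \<bar>t - x i\<bar> < 1 / real (Suc k) \<and> x(i := t) \<in> bx m c d \<and> g (x(i := t)) = g x \<longrightarrow> t = x i"
  have dI: "dfn m (?I k)" for k
  proof -
    have "dfn m (\<lambda>x. \<forall>t. \<bar>t - x i\<bar> < 1 / real (Suc k) \<and> vecn m (\<lambda>l. if l = i then t else x l) \<in> bx m c d
      \<and> g (vecn m (\<lambda>l. if l = i then t else x l)) = g (vecn m x) \<longrightarrow> t = x i)"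
      by (intro dfn_intros dfun_intros df dfun_cases; use i in \<open>simp add: dfun_coord\<close>)
    then show ?thesis
    proof (rule iffD1[OF dfn_cong, rotated])
      fix x :: "nat \<Rightarrow> real" assume x: "x \<in> Rn m"
      show "(\<forall>t. \<bar>t - x i\<bar> < 1 / real (Suc k) \<and> vecn m (\<lambda>l. if l = i then t else x l) \<in> bx m c d
        \<and> g (vecn m (\<lambda>l. if l = i then t else x l)) = g (vecn m x) \<longrightarrow> t = x i) \<longleftrightarrow> ?I k x"
        by (simp only: upd[OF x i] vecn_Rn[OF x])
    qed
  qed
  have "\<forall>x\<in>bx m c d. \<exists>k. ?I k x"
  proof
    fix x assume x: "x \<in> bx m c d"
    then have xR: "x \<in> Rn m" using bx_Rn by (rule subsetD[rotated])
    define Q where "Q t \<longleftrightarrow> x(i := t) \<in> bx m c d \<and> g (x(i := t)) = g x" for t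
    have "dfn m (\<lambda>y. y \<in> bx m c d \<and> g y = g x)"
      by (intro dfn_intros dfn_bx g dfun_intros)
    then have "dfn 1 (\<lambda>w. (\<lambda>y. y \<in> bx m c d \<and> g y = g x) (vecn m (\<lambda>l. if l = i then w 0 else x l)))"
    proof (rule dfn_subst_poly)
      show "polynomial_fun 1 (\<lambda>w. if l = i then w 0 else x l)" for l
        by (cases "l = i") (auto intro: polynomial_intros)
    qed
    then have "dfn 1 (\<lambda>w. Q (w 0))"
      by (simp add: Q_def upd[OF xR i])
    then obtain F where F: "finite F" "\<forall>I\<in>F. is_interval I" "{t. Q t} = \<Union>F"
      by (rule one_dim_intervals)
    \<comment> \<open>An interval inside a level set would make \<open>g\<close> locally constant
      along \<open>i\<close> at its midpoint. So the level set on this line is finite and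
      \<open>x\<close> is isolated in it.\<close>
    have "\<not> (\<exists>u v. u < v \<and> {u<..<v} \<subseteq> \<Union>F)"
    proof
      assume "\<exists>u v. u < v \<and> {u<..<v} \<subseteq> \<Union>F"
      then obtain u v where uv: "u < v" "{u<..<v} \<subseteq> {t. Q t}" unfolding F(3) by metis
      define t0 where "t0 = (u + v) / 2"
      have near: "Q t" if "\<bar>t - t0\<bar> < (v - u) / 2" for t
      proof -
        have "t \<in> {u<..<v}" using that by (auto simp: t0_def abs_less_iff field_simps)
        then show ?thesis using uv(2) by auto
      qed
      have Q0: "Q t0" by (rule near) (use uv in simp)
      have "?L i (x(i := t0))"
      proof (intro exI[of _ "(v - u) / 2"] conjI allI impI)
        show "0 < (v - u) / 2" using uv by simp
        fix t assume "\<bar>t - (x(i := t0)) i\<bar> < (v - u) / 2 \<and> (x(i := t0))(i := t) \<in> bx m a b"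
        then have "Q t" by (intro near) simp
        then show "g ((x(i := t0))(i := t)) = g (x(i := t0))" using Q0 by (simp add: Q_def)
      qed
      moreover have "\<not> ?L i (x(i := t0))"
        using bspec[OF cd(3), of "x(i := t0)"] Q0 unfolding Q_def by argo
      ultimately show False by (rule notE[rotated])
    qed
    then have "finite {t. Q t}"
      unfolding F(3) by (intro finite_of_no_pair F)
    then obtain dl where dl: "dl > 0" "\<forall>t\<in>{t. Q t}. t \<noteq> x i \<longrightarrow> dl \<le> dist (x i) t"
      using finite_set_avoid[of "{t. Q t}" "x i"] by metis
    obtain k where k: "1 / real (Suc k) < dl" using nat_approx_posE[OF dl(1)] by metis
    have "?I k x"
    proof (intro allI impI)
      fix t assume t: "\<bar>t - x i\<bar> < 1 / real (Suc k) \<and> x(i := t) \<in> bx m c d \<and> g (x(i := t)) = g x"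
      then have "Q t" by (simp add: Q_def)
      then have "t \<noteq> x i \<longrightarrow> dl \<le> \<bar>x i - t\<bar>" using dl(2) by (simp add: dist_real_def)
      then show "t = x i" using t k by (simp add: abs_minus_commute)
    qed
    then show "\<exists>k. ?I k x" by (rule exI)
  qed
  then obtain k c1 d1 where 1: "proper m c1 d1" "bx m c1 d1 \<subseteq> bx m c d" "\<forall>x\<in>bx m c1 d1. ?I k x"
    by (rule box_cover[OF dI cd(1)])
  \<comment> \<open>A box shorter than the uniform isolation radius, so that \<open>g\<close> is
    injective along coordinate \<open>i\<close> throughout it.\<close>
  have "1 / real (Suc k) > 0" by simp
  then obtain c2 d2 where 2: "proper m c2 d2" "bx m c2 d2 \<subseteq> bx m c1 d1"
    "\<forall>x\<in>bx m c2 d2. \<forall>y\<in>bx m c2 d2. \<forall>l<m. \<bar>y l - x l\<bar> < 1 / real (Suc k)"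
    by (rule sub_box_small[OF 1(1)])
  have inj_line: "t = x i" if "x \<in> bx m c2 d2" "x(i := t) \<in> bx m c2 d2" "g (x(i := t)) = g x" for x t
  proof -
    have "\<bar>(x(i := t)) i - x i\<bar> < 1 / real (Suc k)" using 2(3) that(1,2) i by metis
    then show ?thesis
      using spec[OF bspec[OF 1(3) subsetD[OF 2(2) that(1)]], of t] that 1(2) 2(2) by (auto dest: subsetD)
  qed
  have sub: "bx m c2 d2 \<subseteq> bx m a b" using 2(2) 1(2) cd(2) by (meson order_trans)
  have cont2: "continuous_on (bx m c2 d2) g" by (rule continuous_on_subset[OF cont sub])

  obtain m0 where m: "m = Suc m0" using i by (cases m) auto
  obtain x0 where x0: "x0 \<in> bx m c2 d2" using bx_nonempty[OF 2(1)] by (metis ex_in_conv)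
  have x0i: "c2 i < x0 i" "x0 i < d2 i" using x0 i by (auto simp: bx_def)
  define t1 where "t1 = (c2 i + x0 i) / 2"
  define t2 where "t2 = (x0 i + d2 i) / 2"
  define v where "v = g x0"
  have t12: "c2 i < t1" "t1 < x0 i" "x0 i < t2" "t2 < d2 i" "c2 i < t2" "t1 < d2 i"
    using x0i by (auto simp: t1_def t2_def)
  \<comment> \<open>Inserts \<open>t\<close> as coordinate \<open>i\<close> into the
    \<open>m0\<close>-tuple \<open>h\<close>, moving the later coordinates up by one.\<close>
  define ins where "ins h t = vecn m (\<lambda>l. if l < i then h l else if l = i then t else h (l - 1))" for h :: "nat \<Rightarrow> real" and t
  define h0 where "h0 = vecn m0 (\<lambda>l. if l < i then x0 l else x0 (Suc l))"
  define c3 where "c3 l = (if l < i then c2 l else c2 (Suc l))" for l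
  define d3 where "d3 l = (if l < i then d2 l else d2 (Suc l))" for l
  have ins_h0: "ins h0 t = x0(i := t)" for t
  proof (rule Rn_ext[of _ m])
    show "x0(i := t) \<in> Rn m" using x0 i by (intro upd_in_Rn) (auto simp: bx_def)
    fix l assume "l < m"
    then show "ins h0 t l = (x0(i := t)) l" using i m by (auto simp: ins_def h0_def)
  qed (simp add: ins_def)
  have ins_mem: "ins h t \<in> bx m c2 d2" if h: "h \<in> bx m0 c3 d3" and t: "c2 i < t" "t < d2 i" for h t
  proof -
    have "c2 l < ins h t l \<and> ins h t l < d2 l" if l: "l < m" for l
    proof -
      consider "l < i" | "l = i" | "i < l" by linarith
      then show ?thesis
      proof cases
        case 1
        then have "l < m0" using i m by simp
        then have "c3 l < h l \<and> h l < d3 l" using h by (simp add: bx_def)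
        then show ?thesis using 1 l by (simp add: ins_def c3_def d3_def)
      next
        case 2
        then show ?thesis using t l by (simp add: ins_def)
      next
        case 3
        then have "l - 1 < m0" "\<not> l - 1 < i" "Suc (l - 1) = l" using l m by auto
        then have "c2 l < h (l - 1)" "h (l - 1) < d2 l"
          using h by (auto simp: bx_def c3_def d3_def)
        then show ?thesis using 3 l by (simp add: ins_def)
      qed
    qed
    then show ?thesis by (simp add: bx_def ins_def)
  qed
  have h0: "h0 \<in> bx m0 c3 d3"
    using x0 m by (auto simp: bx_def h0_def c3_def d3_def)
  have ins_line: "(ins h s)(i := t) = ins h t" for h s t
    using i by (auto simp: ins_def vecn_def fun_eq_iff)
  have ins_uniq: "s = t" if "h \<in> bx m0 c3 d3" "c2 i < t" "t < d2 i" "c2 i < s" "s < d2 i" "g (ins h s) = g (ins h t)" for h s t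
    using inj_line[OF ins_mem[OF that(1-3)], of s] ins_mem[OF that(1,4,5)] that(6) i
    by (simp add: ins_line) (simp add: ins_def)
  have ins_cont: "continuous_on A (\<lambda>h. ins h (T h))" if "continuous_on A T" for A T
    unfolding ins_def
  proof (rule continuous_on_vecn)
    show "continuous_on A (\<lambda>h. if l < i then h l else if l = i then T h else h (l - 1))" for l
      using that by (cases "l < i"; cases "l = i") (auto intro: continuous_on_coord)
  qed
  have g_cont: "continuous_on (bx m0 c3 d3) (\<lambda>h. g (ins h t))" if "c2 i < t" "t < d2 i" for t
    by (rule continuous_on_compose2[OF cont2 ins_cont]) (use ins_mem that in auto)
  have line_cont: "continuous_on {t1..t2} (\<lambda>t. g (ins h t))" if "h \<in> bx m0 c3 d3" for h
  proof -
    have "continuous_on {t1..t2} (\<lambda>t. g ((ins h t1)(i := t)))"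
    proof (rule continuous_on_line[OF cont2])
      fix t assume "t \<in> {t1..t2}"
      then show "(ins h t1)(i := t) \<in> bx m c2 d2"
        unfolding ins_line using t12 by (intro ins_mem that) auto
    qed
    then show ?thesis by (simp only: ins_line)
  qed
  \<comment> \<open>Negative exactly when \<open>v\<close> lies strictly between the values at
    \<open>t1\<close> and \<open>t2\<close>. Being continuous in \<open>h\<close>, this sign
    persists near \<open>h0\<close>, where it holds because a continuous injection of an interval is
    monotone.\<close>
  define G where "G h = (g (ins h t1) - v) * (g (ins h t2) - v)" for h
  have G0: "G h0 < 0"
  proof -
    have "inj_on (\<lambda>t. g (ins h0 t)) {t1..t2}"
    proof (rule inj_onI)
      fix s t assume st: "s \<in> {t1..t2}" "t \<in> {t1..t2}" and eq: "g (ins h0 s) = g (ins h0 t)"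
      have "c2 i < t" "t < d2 i" "c2 i < s" "s < d2 i"
        using st t12 unfolding atLeastAtMost_iff by linarith+
      then show "s = t" by (intro ins_uniq[OF h0 _ _ _ _ eq])
    qed
    from continuous_inj_imp_mono[OF t12(2,3) line_cont[OF h0] this]
    have "(g (ins h0 t1) < v \<and> v < g (ins h0 t2)) \<or> (g (ins h0 t2) < v \<and> v < g (ins h0 t1))"
      by (simp add: ins_h0 v_def)
    then show ?thesis by (auto simp: G_def mult_less_0_iff)
  qed
  have "continuous_on (bx m0 c3 d3) G"
    unfolding G_def using t12 by (intro continuous_intros g_cont) auto
  then obtain dl where dl: "dl > 0" "\<forall>h\<in>bx m0 c3 d3. (\<forall>l<m0. \<bar>h l - h0 l\<bar> < dl) \<longrightarrow> \<bar>G h - G h0\<bar> < - G h0"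
    using h0 G0 unfolding continuous_on_Rn_iff[OF bx_Rn] by (meson neg_0_less_iff_less)
  obtain c4 d4 where 4: "proper m0 c4 d4" "h0 \<in> bx m0 c4 d4" "bx m0 c4 d4 \<subseteq> bx m0 c3 d3"
    "\<forall>l<m0. h0 l - dl < c4 l \<and> c4 l < h0 l \<and> h0 l < d4 l \<and> d4 l < h0 l + dl"
    by (rule openin_contains_bx[OF openin_bx h0 dl(1)])
  have Gneg: "G h < 0" if h: "h \<in> bx m0 c4 d4" for h
  proof -
    have "\<bar>h l - h0 l\<bar> < dl" if "l < m0" for l
      using h that spec[OF 4(4), of l] by (auto simp: bx_def abs_less_iff dest!: spec[of _ l])
    then have "\<bar>G h - G h0\<bar> < - G h0" using dl(2) subsetD[OF 4(3) h] by metis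
    then show ?thesis by linarith
  qed
  let ?P = "\<lambda>h t. t1 < t \<and> t < t2 \<and> g (ins h t) = v"
  have ex1: "\<exists>!t. ?P h t" if h: "h \<in> bx m0 c4 d4" for h
  proof -
    have h3: "h \<in> bx m0 c3 d3" by (rule subsetD[OF 4(3) h])
    have le: "t1 \<le> t2" using t12 by linarith
    have "(g (ins h t1) < v \<and> v < g (ins h t2)) \<or> (g (ins h t2) < v \<and> v < g (ins h t1))"
      using Gneg[OF h] by (auto simp: G_def mult_less_0_iff)
    then obtain t where t: "t1 \<le> t" "t \<le> t2" "g (ins h t) = v" "g (ins h t1) \<noteq> v" "g (ins h t2) \<noteq> v"
    proof
      assume *: "g (ins h t1) < v \<and> v < g (ins h t2)"
      then show thesis using IVT'[of "\<lambda>t. g (ins h t)" t1 v t2, OF _ _ le line_cont[OF h3]] that by force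
    next
      assume *: "g (ins h t2) < v \<and> v < g (ins h t1)"
      then show thesis using IVT2'[of "\<lambda>t. g (ins h t)" t2 v t1, OF _ _ le line_cont[OF h3]] that by force
    qed
    show ?thesis
    proof (rule ex1I[of _ t])
      show "?P h t" using t by (metis order_le_less)
      fix s assume s: "?P h s"
      have b: "c2 i < t" "t < d2 i" "c2 i < s" "s < d2 i" using s t(1,2) t12 by linarith+
      have eq: "g (ins h s) = g (ins h t)" using s t(3) by (simp only:)
      show "s = t" by (rule ins_uniq[OF h3 b eq])
    qed
  qed
  \<comment> \<open>The implicit function: existence comes from intermediate values, uniqueness from
    injectivity along the line. It is definable because its graph is described by that unique
    condition.\<close>
  define \<tau> where "\<tau> h = (if h \<in> bx m0 c4 d4 then THE t. ?P h t else 0)" for h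
  have \<tau>: "?P h (\<tau> h)" if "h \<in> bx m0 c4 d4" for h
    using theI'[OF ex1[OF that]] that by (simp only: \<tau>_def if_True)
  have d\<tau>: "dfun m0 \<tau>"
  proof -
    have "dfn (Suc m0) (\<lambda>z. (vecn m0 z \<in> bx m0 c4 d4 \<and> t1 < z m0 \<and> z m0 < t2 \<and>
      g (ins (vecn m0 z) (z m0)) = v) \<or> (\<not> vecn m0 z \<in> bx m0 c4 d4 \<and> z m0 = 0))"
      unfolding ins_def
      by (intro dfn_intros dfn_subst[OF dfn_bx] df dfun_cases dfun_intros; use i m in \<open>simp add: dfun_coord\<close>)
    then show ?thesis
      unfolding dfun_def
    proof (rule iffD1[OF dfn_cong, rotated])
      fix z
      show "(vecn m0 z \<in> bx m0 c4 d4 \<and> t1 < z m0 \<and> z m0 < t2 \<and> g (ins (vecn m0 z) (z m0)) = v)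
        \<or> (\<not> vecn m0 z \<in> bx m0 c4 d4 \<and> z m0 = 0) \<longleftrightarrow> z m0 = \<tau> (vecn m0 z)"
      proof (cases "vecn m0 z \<in> bx m0 c4 d4")
        case True
        have "?P (vecn m0 z) (z m0) \<longleftrightarrow> z m0 = \<tau> (vecn m0 z)"
        proof
          assume "?P (vecn m0 z) (z m0)"
          from the1_equality[OF ex1[OF True] this] show "z m0 = \<tau> (vecn m0 z)"
            by (simp only: \<tau>_def True if_True)
        next
          assume "z m0 = \<tau> (vecn m0 z)"
          then show "?P (vecn m0 z) (z m0)" by (simp only: \<tau>[OF True])
        qed
        then show ?thesis by (simp only: True not_True_eq_False simp_thms)
      qed (simp add: \<tau>_def)
    qed
  qed
  \<comment> \<open>Continuity is obtained from definability by shrinking the box once more; no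
    derivative of \<open>g\<close> is involved.\<close>
  obtain c5 d5 where 5: "proper m0 c5 d5" "bx m0 c5 d5 \<subseteq> bx m0 c4 d4" "continuous_on (bx m0 c5 d5) \<tau>"
    by (rule generic_continuity[OF d\<tau> 4(1)])
  have \<tau>5: "?P h (\<tau> h)" "h \<in> bx m0 c3 d3" if "h \<in> bx m0 c5 d5" for h
    using \<tau>[OF subsetD[OF 5(2) that]] subsetD[OF 4(3) subsetD[OF 5(2) that]] by auto
  define r where "r h = ins h (\<tau> h)" for h
  have "dfun m0 (\<lambda>h. r h j)" if "j < m" for j
    unfolding r_def ins_def vecn_apply[OF that]
    by (intro dfun_cases d\<tau> dfun_coord) (use i m that in auto)
  moreover have "r ` bx m0 c5 d5 \<subseteq> bx m a b"
  proof
    fix y assume "y \<in> r ` bx m0 c5 d5"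
    then obtain h where h: "h \<in> bx m0 c5 d5" "y = r h" by auto
    have "ins h (\<tau> h) \<in> bx m c2 d2"
      by (rule ins_mem) (use \<tau>5[OF h(1)] t12 in auto)
    then show "y \<in> bx m a b" using sub h by (auto simp: r_def)
  qed
  moreover have "inj_on r (bx m0 c5 d5)"
  proof (rule inj_onI)
    fix h h' assume hh: "h \<in> bx m0 c5 d5" "h' \<in> bx m0 c5 d5" "r h = r h'"
    show "h = h'"
    proof (rule Rn_ext[of _ m0])
      fix l assume l: "l < m0"
      have eq: "ins h (\<tau> h) l' = ins h' (\<tau> h') l'" for l' using hh(3) by (simp add: r_def)
      show "h l = h' l"
      proof (cases "l < i")
        case True
        then show ?thesis using eq[of l] l m by (simp add: ins_def)
      next
        case False
        then show ?thesis using eq[of "Suc l"] l m by (simp add: ins_def)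
      qed
    qed (use hh bx_Rn in auto)
  qed
  moreover have "continuous_on (bx m0 c5 d5) r"
    unfolding r_def by (rule ins_cont[OF 5(3)])
  moreover have "\<forall>x\<in>bx m0 c5 d5. g (r x) = v"
    using \<tau>5(1) by (auto simp: r_def)
  moreover have "\<forall>x. r x \<in> Rn m" by (simp add: r_def ins_def)
  ultimately show ?thesis using m 5(1) by metis
qed

end

section \<open>Cells inside embedded boxes\<close>

lemma subspace_top_eq: "C \<subseteq> Rn n \<Longrightarrow> subspace_top n C = top_of_set C"
  by (subst Euclidean_space_eq) (simp add: subtopology_subtopology Int_absorb1 topspace_Euclidean_space[symmetric])

lemma continuous_map_real_iff:
  fixes f :: "(nat \<Rightarrow> real) \<Rightarrow> real"
  shows "C \<subseteq> Rn n \<Longrightarrow> continuous_map (subspace_top n C) euclideanreal f \<longleftrightarrow> continuous_on C f"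
  by (simp only: subspace_top_eq continuous_map_iff_continuous)

definition cbx :: "nat \<Rightarrow> (nat \<Rightarrow> real) \<Rightarrow> (nat \<Rightarrow> real) \<Rightarrow> (nat \<Rightarrow> real) set"
  where "cbx m a b = {x \<in> Rn m. \<forall>i<m. a i \<le> x i \<and> x i \<le> b i}"

lemma compact_cbx: "compact (cbx m a b)"
proof -
  let ?X = "\<lambda>i. if i < m then {a i..b i} else {0}"
  have "compactin (product_topology (\<lambda>i. euclidean) UNIV) (Pi\<^sub>E UNIV ?X)"
    by (simp add: compactin_PiE)
  moreover have "Pi\<^sub>E UNIV ?X = cbx m a b"
    by (auto simp: cbx_def Rn_iff PiE_iff split: if_splits)
  ultimately show ?thesis
    by (simp add: euclidean_product_topology)
qed

lemma polynomial_fun_continuous: "polynomial_fun n f \<Longrightarrow> continuous_on A f"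
  by (induction rule: polynomial_fun.induct) (auto intro!: continuous_intros continuous_on_coord)

context o_minimal_structure
begin

text \<open>\<open>h\<close> is definable only over \<open>C\<close>, by its graph, so it is not a
  \<open>dfun\<close>; the inequality is expressed by quantifying over a value \<open>t\<close> on
  the graph.\<close>

lemma dfn_graph_less:
  assumes "graph_over n C h \<in> S (Suc n)" "C \<in> S n"
  shows "dfn (Suc n) (\<lambda>z. vecn n z \<in> C \<and> h (vecn n z) < z n)"
    and "dfn (Suc n) (\<lambda>z. vecn n z \<in> C \<and> z n < h (vecn n z))"
proof -
  have mem: "vecn (Suc n) (\<lambda>l. z (if l < n then l else Suc n)) \<in> graph_over n C h \<longleftrightarrow>
      vecn n z \<in> C \<and> z (Suc n) = h (vecn n z)" for z :: "nat \<Rightarrow> real"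
  proof -
    have "vecn n (vecn (Suc n) (\<lambda>l. z (if l < n then l else Suc n))) = vecn n z"
      by (auto simp: vecn_def)
    then show ?thesis by (simp add: graph_over_def upd_Rn_Suc)
  qed
  have "dfn (Suc (Suc n)) (\<lambda>z. vecn (Suc n) (\<lambda>l. z (if l < n then l else Suc n)) \<in> graph_over n C h)"
    by (rule dfn_pick[OF dfn_mem[OF assms(1)]]) auto
  then have *: "dfn (Suc (Suc n)) (\<lambda>z. vecn n z \<in> C \<and> z (Suc n) = h (vecn n z))"
    by (simp only: mem)
  have "dfn (Suc n) (\<lambda>z. \<exists>t. (vecn n z \<in> C \<and> t = h (vecn n z)) \<and> t < z n)"
    by (rule dfn_ex, rule dfn_conj, use * in simp, rule dfn_less) (simp_all add: dfun_coord)
  then show "dfn (Suc n) (\<lambda>z. vecn n z \<in> C \<and> h (vecn n z) < z n)" by simp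
  have "dfn (Suc n) (\<lambda>z. \<exists>t. (vecn n z \<in> C \<and> t = h (vecn n z)) \<and> z n < t)"
    by (rule dfn_ex, rule dfn_conj, use * in simp, rule dfn_less) (simp_all add: dfun_coord)
  then show "dfn (Suc n) (\<lambda>z. vecn n z \<in> C \<and> z n < h (vecn n z))" by simp
qed

lemma dfn_vecn_mem: "C \<in> S n \<Longrightarrow> dfn (Suc n) (\<lambda>z. vecn n z \<in> C)"
  by (rule dfn_subst[OF dfn_mem]) (auto intro: dfun_coord)

lemma dfn_ext_less:
  assumes "cont_definable_ext S n C f" "C \<in> S n"
  shows "dfn (Suc n) (\<lambda>z. vecn n z \<in> C \<and> f (vecn n z) < ereal (z n))"
    and "dfn (Suc n) (\<lambda>z. vecn n z \<in> C \<and> ereal (z n) < f (vecn n z))"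
proof -
  consider h where "cont_definable S n C h" "\<forall>x\<in>C. f x = ereal (h x)"
    | "\<forall>x\<in>C. f x = \<infinity>" | "\<forall>x\<in>C. f x = - \<infinity>"
    using assms(1) unfolding cont_definable_ext_def by metis
  then have "dfn (Suc n) (\<lambda>z. vecn n z \<in> C \<and> f (vecn n z) < ereal (z n)) \<and>
    dfn (Suc n) (\<lambda>z. vecn n z \<in> C \<and> ereal (z n) < f (vecn n z))"
  proof cases
    case 1
    then have g: "graph_over n C h \<in> S (Suc n)" by (simp add: cont_definable_def)
    have "(\<lambda>z. vecn n z \<in> C \<and> f (vecn n z) < ereal (z n)) = (\<lambda>z. vecn n z \<in> C \<and> h (vecn n z) < z n)"
      "(\<lambda>z. vecn n z \<in> C \<and> ereal (z n) < f (vecn n z)) = (\<lambda>z. vecn n z \<in> C \<and> z n < h (vecn n z))"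
      using 1(2) by auto
    then show ?thesis using dfn_graph_less[OF g assms(2)] by simp
  next
    case 2
    then have "(\<lambda>z. vecn n z \<in> C \<and> f (vecn n z) < ereal (z n)) = (\<lambda>z. False)"
      "(\<lambda>z. vecn n z \<in> C \<and> ereal (z n) < f (vecn n z)) = (\<lambda>z. vecn n z \<in> C)"
      by auto
    then show ?thesis using dfn_vecn_mem[OF assms(2)] by (simp add: dfn_const)
  next
    case 3
    then have "(\<lambda>z. vecn n z \<in> C \<and> f (vecn n z) < ereal (z n)) = (\<lambda>z. vecn n z \<in> C)"
      "(\<lambda>z. vecn n z \<in> C \<and> ereal (z n) < f (vecn n z)) = (\<lambda>z. False)"
      by auto
    then show ?thesis using dfn_vecn_mem[OF assms(2)] by (simp add: dfn_const)
  qed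
  then show "dfn (Suc n) (\<lambda>z. vecn n z \<in> C \<and> f (vecn n z) < ereal (z n))"
    "dfn (Suc n) (\<lambda>z. vecn n z \<in> C \<and> ereal (z n) < f (vecn n z))" by simp_all
qed

lemma cell_definable: "cell S n k C \<Longrightarrow> C \<in> S n"
proof (induction rule: cell.induct)
  case base
  show ?case using dfn_const[of 0 True] by (simp add: dfn_def)
next
  case (graph n k C f)
  then show ?case by (simp add: cont_definable_def)
next
  case (band n k C f g)
  have "band_over n C f g = {z \<in> Rn (Suc n). (vecn n z \<in> C \<and> f (vecn n z) < ereal (z n)) \<and>
      (vecn n z \<in> C \<and> ereal (z n) < g (vecn n z))}"
    by (auto simp: band_over_def upd_Rn_Suc)
  moreover have "dfn (Suc n) (\<lambda>z. (vecn n z \<in> C \<and> f (vecn n z) < ereal (z n)) \<and>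
      (vecn n z \<in> C \<and> ereal (z n) < g (vecn n z)))"
    by (intro dfn_conj[OF dfn_ext_less(1) dfn_ext_less(2)] band)
  ultimately show ?case by (simp add: dfn_def)
qed

text \<open>The product of a cell with an interval; such bands provide the extra dimension for cells
  inside images of boxes.\<close>

lemma cell_constant_band:
  assumes "cell S n k C" "p < q"
  shows "cell S (Suc n) (Suc k) (band_over n C (\<lambda>_. ereal p) (\<lambda>_. ereal q))"
proof -
  have C: "C \<in> S n" using assms(1) by (rule cell_definable)
  have "cont_definable S n C (\<lambda>_. r)" for r
  proof -
    have "graph_over n C (\<lambda>_. r) = {z \<in> Rn (Suc n). vecn n z \<in> C \<and> z n = r}"
      by (auto simp: graph_over_def upd_Rn_Suc)
    moreover have "dfn (Suc n) (\<lambda>z. vecn n z \<in> C \<and> z n = r)"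
      by (intro dfn_conj dfn_vecn_mem C dfn_eq dfun_intros) simp
    ultimately show ?thesis by (simp add: cont_definable_def dfn_def)
  qed
  then have "cont_definable_ext S n C (\<lambda>_. ereal r)" for r
    unfolding cont_definable_ext_def by blast
  then show ?thesis using assms by (intro cell.band) auto
qed

text \<open>A closed, hence compact, box inside is wanted because a continuous injection of a
  compact set has a continuous inverse. One third of each side is cut off at both ends.\<close>

lemma shrink_box:
  assumes "proper m a b"
  obtains c d where "proper m c d" "cbx m c d \<subseteq> bx m a b"
proof
  show "proper m (\<lambda>i. a i + (b i - a i) / 3) (\<lambda>i. b i - (b i - a i) / 3)"
    using assms by (auto simp: proper_def field_simps)
  show "cbx m (\<lambda>i. a i + (b i - a i) / 3) (\<lambda>i. b i - (b i - a i) / 3) \<subseteq> bx m a b"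
  proof
    fix x assume x: "x \<in> cbx m (\<lambda>i. a i + (b i - a i) / 3) (\<lambda>i. b i - (b i - a i) / 3)"
    have "a i < x i \<and> x i < b i" if i: "i < m" for i
    proof -
      have "a i + (b i - a i) / 3 \<le> x i" "x i \<le> b i - (b i - a i) / 3" "a i < b i"
        using x i assms by (auto simp: cbx_def proper_def)
      then show ?thesis by (auto simp: field_simps)
    qed
    then show "x \<in> bx m a b" using x by (auto simp: cbx_def bx_def)
  qed
qed

lemma bx_subset_cbx: "bx m a b \<subseteq> cbx m a b"
  by (auto simp: bx_def cbx_def)

text \<open>Where the first \<open>n\<close> coordinates determine the point of the image, the last
  coordinate is a function of them, and the part of the image over a cell below is a graph. The
  statement for \<open>n\<close> is a hypothesis because this is one case of an induction on the
  ambient dimension.\<close>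

lemma cell_over_projection:
  assumes ab: "proper m a b" and ds: "\<forall>j<Suc n. dfun m (\<lambda>x. s x j)"
    and sR: "\<forall>x. s x \<in> Rn (Suc n)" and cont: "continuous_on (bx m a b) s"
    and inj: "inj_on (\<lambda>x. vecn n (s x)) (bx m a b)"
    and IH: "\<forall>c d. proper m c d \<and> bx m c d \<subseteq> bx m a b \<longrightarrow>
      (\<exists>k C. m \<le> k \<and> cell S n k C \<and> C \<subseteq> (\<lambda>x. vecn n (s x)) ` bx m c d)"
  shows "\<exists>k C. m \<le> k \<and> cell S (Suc n) k C \<and> C \<subseteq> s ` bx m a b"
proof -
  let ?s = "\<lambda>x. vecn n (s x)"
  obtain c d where cd: "proper m c d" "cbx m c d \<subseteq> bx m a b"
    by (rule shrink_box[OF ab])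
  have sub: "bx m c d \<subseteq> bx m a b" using cd(2) bx_subset_cbx by (rule order_trans[rotated])
  obtain k C where C: "m \<le> k" "cell S n k C" "C \<subseteq> ?s ` bx m c d"
    using IH cd(1) sub by metis
  let ?K = "cbx m c d"
  have injK: "inj_on ?s ?K" by (rule inj_on_subset[OF inj cd(2)])
  have contK: "continuous_on ?K s" by (rule continuous_on_subset[OF cont cd(2)])
  have comp: "continuous_on ?K (\<lambda>x. s x j)" for j
    by (rule continuous_on_product_then_coordinatewise[OF contK])
  \<comment> \<open>Compactness of \<open>?K\<close> makes the parameter, and with it the last
    coordinate, a continuous function of the first \<open>n\<close> coordinates.\<close>
  have "continuous_on ?K ?s"
    by (rule continuous_on_vecn) (rule comp)
  from continuous_on_inv_into[OF this compact_cbx injK]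
  have inv: "continuous_on (?s ` ?K) (the_inv_into ?K ?s)" .
  define f where "f w = s (the_inv_into ?K ?s w) n" for w
  have fval: "f (?s x) = s x n" if "x \<in> ?K" for x
    using the_inv_into_f_f[OF injK that] by (simp add: f_def)
  have "continuous_on (?s ` ?K) f"
    unfolding f_def
    by (rule continuous_on_compose2[OF comp inv]) (use the_inv_into_into[OF injK] in blast)
  moreover have CK: "C \<subseteq> ?s ` ?K" using C(3) bx_subset_cbx by blast
  ultimately have fC: "continuous_on C f" by (rule continuous_on_subset)
  have CS: "C \<in> S n" by (rule cell_definable[OF C(2)])
  have CR: "C \<subseteq> Rn n" by (rule subset_Rn[OF CS])
  \<comment> \<open>Describing the graph through the parameter \<open>x\<close> gives a first-order
    formula, hence definability of \<open>f\<close> over \<open>C\<close>.\<close>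
  have graph: "graph_over n C f = {z \<in> Rn (Suc n). vecn n z \<in> C \<and>
    (\<exists>x\<in>Rn m. x \<in> bx m c d \<and> (\<forall>j<n. s x j = z j) \<and> s x n = z n)}" (is "?G = ?G'")
  proof (intro equalityI subsetI)
    fix z assume "z \<in> ?G"
    then have z: "z \<in> Rn (Suc n)" "vecn n z \<in> C" "z n = f (vecn n z)"
      by (auto simp: graph_over_def upd_Rn_Suc)
    then obtain x where x: "x \<in> bx m c d" "vecn n z = ?s x" using C(3) by auto
    have "s x n = z n" using z(3) x fval[of x] bx_subset_cbx by (metis subsetD)
    moreover have "s x j = z j" if "j < n" for j
      using fun_cong[OF x(2), of j] that by simp
    ultimately show "z \<in> ?G'" using z x bx_Rn by blast
  next
    fix z assume "z \<in> ?G'"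
    then obtain x where z: "z \<in> Rn (Suc n)" "vecn n z \<in> C" and
      x: "x \<in> bx m c d" "\<forall>j<n. s x j = z j" "s x n = z n" by blast
    have "vecn n z = ?s x" using x(2) by (intro vecn_cong) simp
    then have "z n = f (vecn n z)" using x fval[of x] bx_subset_cbx by (metis subsetD)
    then show "z \<in> ?G" using z by (simp add: graph_over_def upd_Rn_Suc)
  qed
  have dsc: "dfun N (\<lambda>x. s (vecn m (\<lambda>i. G i x)) j)" if "j < Suc n" "\<And>i. i < m \<Longrightarrow> dfun N (G i)" for j N G
    using dfun_comp[OF mp[OF spec[OF ds] that(1)] that(2)] .
  have "dfn (Suc n) (\<lambda>z. vecn n z \<in> C \<and> (\<exists>x\<in>Rn m. x \<in> bx m c d \<and> (\<forall>j<n. s x j = z j) \<and> s x n = z n))"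
    by (intro dfn_conj dfn_vecn_mem CS dfn_exs dfn_subst[OF dfn_bx] dfn_all_less dfn_eq dsc; simp add: dfun_coord)
  then have "cont_definable S n C f"
    unfolding cont_definable_def graph continuous_map_real_iff[OF CR] by (simp add: fC dfn_def)
  then have "cell S (Suc n) k (graph_over n C f)" by (rule cell.graph[OF C(2)])
  moreover have "graph_over n C f \<subseteq> s ` bx m a b"
  proof
    fix z assume "z \<in> graph_over n C f"
    then obtain x where z: "z \<in> Rn (Suc n)" and
      x: "x \<in> bx m c d" "\<forall>j<n. s x j = z j" "s x n = z n" unfolding graph by blast
    have "z = s x"
      using z sR x by (intro Rn_ext[of _ "Suc n"]) (auto simp: less_Suc_eq)
    then show "z \<in> s ` bx m a b" using x sub by blast
  qed
  ultimately show ?thesis using C(1) by blast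
qed

text \<open>If forgetting the last coordinate is injective on some box, the image contains a graph
  over a cell. If not, the fibres of this projection contain intervals, the same rational one over a
  whole box. On a level set of the last coordinate, of dimension \<open>m - 1\<close>, the
  projection is injective, so the induction hypothesis yields a cell of dimension at least
  \<open>m - 1\<close>, and the band over it between the two rationals lies in the image.\<close>

lemma embedded_box_cell:
  assumes "proper m a b" "\<forall>j<n. dfun m (\<lambda>x. s x j)" "\<forall>x. s x \<in> Rn n"
    "continuous_on (bx m a b) s" "inj_on s (bx m a b)"
  shows "\<exists>k C. m \<le> k \<and> cell S n k C \<and> C \<subseteq> s ` bx m a b"
  using assms
proof (induction n arbitrary: m a b s)
  case 0
  have s0: "s x = (\<lambda>_. 0)" for x
    using spec[OF "0.prems"(3), of x] by (auto simp: Rn_iff)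
  obtain x where x: "x \<in> bx m a b" using bx_nonempty[OF "0.prems"(1)] by blast
  \<comment> \<open>An injection into the one-point space leaves no room for a side of positive
    length.\<close>
  have "m = 0"
  proof (rule ccontr)
    assume m: "m \<noteq> 0"
    then have lt: "a 0 < x 0" "x 0 < b 0" using x by (auto simp: bx_def)
    then have "x(0 := (x 0 + b 0) / 2) \<in> bx m a b"
      using x m by (intro bx_line) auto
    then have "x(0 := (x 0 + b 0) / 2) = x"
      by (rule inj_onD[OF "0.prems"(5) _ _ x, rotated]) (simp only: s0)
    then have "(x 0 + b 0) / 2 = x 0" by (metis fun_upd_same)
    then show False using lt by simp
  qed
  moreover have "Rn 0 \<subseteq> s ` bx m a b"
    using x s0 by (auto simp: Rn_iff fun_eq_iff)
  ultimately show ?case using cell.base by blast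
next
  case (Suc n)
  note ab = Suc.prems(1) and ds = Suc.prems(2) and sR = Suc.prems(3) and cont = Suc.prems(4) and inj = Suc.prems(5)
  let ?s = "\<lambda>x. vecn n (s x)"
  let ?g = "\<lambda>x. s x n"
  let ?B = "bx m a b"
  have ds': "dfun m (\<lambda>x. vecn n (s x) j)" if "j < n" for j
    using ds that by simp
  have dsc: "dfun N (\<lambda>x. s (vecn m (\<lambda>i. G i x)) j)" if "j < Suc n" "\<And>i. i < m \<Longrightarrow> dfun N (G i)" for j N G
    using dfun_comp[OF mp[OF spec[OF ds] that(1)] that(2)] .
  have dg: "dfun m ?g" using ds by simp
  have comp: "continuous_on ?B (\<lambda>x. s x j)" for j
    by (rule continuous_on_product_then_coordinatewise[OF cont])
  have s_eq: "s x = s y" if "\<forall>j<n. s x j = s y j" "s x n = s y n" for x y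
    using that sR by (intro Rn_ext[of _ "Suc n"]) (auto simp: less_Suc_eq)
  have vs: "vecn n (s x) = vecn n (s y) \<longleftrightarrow> (\<forall>j<n. s x j = s y j)" for x y
    by (metis vecn_apply vecn_cong)
  have proj: "\<exists>k C. m \<le> k \<and> cell S (Suc n) k C \<and> C \<subseteq> s ` bx m a b"
    if cd: "proper m c d" "bx m c d \<subseteq> ?B" and i: "inj_on ?s (bx m c d)" for c d
  proof -
    have "\<exists>k C. m \<le> k \<and> cell S (Suc n) k C \<and> C \<subseteq> s ` bx m c d"
    proof (rule cell_over_projection[OF cd(1) ds sR continuous_on_subset[OF cont cd(2)] i], intro allI impI)
      fix c' d' assume c': "proper m c' d' \<and> bx m c' d' \<subseteq> bx m c d"
      have "continuous_on (bx m c' d') ?s"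
        by (intro continuous_on_vecn continuous_on_subset[OF comp]) (use c' cd(2) in blast)
      then show "\<exists>k C. m \<le> k \<and> cell S n k C \<and> C \<subseteq> ?s ` bx m c' d'"
        using c' inj_on_subset[OF i] ds' by (intro Suc.IH) auto
    qed
    then show ?thesis using cd(2) by (meson image_mono order_trans)
  qed
  show ?case
  proof (cases "\<exists>c d. proper m c d \<and> bx m c d \<subseteq> ?B \<and> inj_on ?s (bx m c d)")
    case True
    then show ?thesis using proj by metis
  next
    case False
    \<comment> \<open>The last coordinate of \<open>s x\<close> is isolated, with radius
      \<open>e\<close>, among the last coordinates of the image points with the same first
      \<open>n\<close> coordinates.\<close>
    let ?I = "\<lambda>x e. \<forall>y\<in>Rn m. y \<in> ?B \<and> (\<forall>j<n. s y j = s x j) \<and> \<bar>s y n - s x n\<bar> < e \<longrightarrow> s y n = s x n"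
    note dr = dfn_intros dfn_alls dfn_subst[OF dfn_bx] dsc dfun_intros
    have dI: "dfn m (\<lambda>x. ?I x e)" for e
    proof -
      have "dfn m (\<lambda>x. \<forall>y\<in>Rn m. y \<in> ?B \<and> (\<forall>j<n. s y j = s (vecn m x) j) \<and> \<bar>s y n - s (vecn m x) n\<bar> < e
        \<longrightarrow> s y n = s (vecn m x) n)"
        by (intro dr; simp add: dfun_coord)
      then show ?thesis
      proof (rule iffD1[OF dfn_cong, rotated])
        fix x :: "nat \<Rightarrow> real" assume "x \<in> Rn m"
        from vecn_Rn[OF this] show "(\<forall>y\<in>Rn m. y \<in> ?B \<and> (\<forall>j<n. s y j = s (vecn m x) j) \<and> \<bar>s y n - s (vecn m x) n\<bar> < e
          \<longrightarrow> s y n = s (vecn m x) n) \<longleftrightarrow> ?I x e" by (simp only:)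
      qed
    qed
    have dI': "dfn m (\<lambda>x. \<exists>e. 0 < e \<and> ?I x e)"
    proof -
      have "dfn m (\<lambda>x. \<exists>e. 0 < e \<and> (\<forall>y\<in>Rn m. y \<in> ?B \<and> (\<forall>j<n. s y j = s (vecn m x) j) \<and> \<bar>s y n - s (vecn m x) n\<bar> < e
        \<longrightarrow> s y n = s (vecn m x) n))"
        by (intro dr; simp add: dfun_coord)
      then show ?thesis
      proof (rule iffD1[OF dfn_cong, rotated])
        fix x :: "nat \<Rightarrow> real" assume "x \<in> Rn m"
        from vecn_Rn[OF this] show "(\<exists>e. 0 < e \<and> (\<forall>y\<in>Rn m. y \<in> ?B \<and> (\<forall>j<n. s y j = s (vecn m x) j) \<and> \<bar>s y n - s (vecn m x) n\<bar> < e
          \<longrightarrow> s y n = s (vecn m x) n)) \<longleftrightarrow> (\<exists>e. 0 < e \<and> ?I x e)" by (simp only:)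
      qed
    qed
    obtain c d where cd: "proper m c d" "bx m c d \<subseteq> ?B"
      "(\<forall>x\<in>bx m c d. \<exists>e. 0 < e \<and> ?I x e) \<or> (\<forall>x\<in>bx m c d. \<not> (\<exists>e. 0 < e \<and> ?I x e))"
      using box_dichotomy[OF dI' ab] by (elim exE conjE) (rule that)
    have "\<not> (\<forall>x\<in>bx m c d. \<exists>e. 0 < e \<and> ?I x e)"
    proof
      assume iso: "\<forall>x\<in>bx m c d. \<exists>e. 0 < e \<and> ?I x e"
      have "\<forall>x\<in>bx m c d. \<exists>k::nat. ?I x (1 / real (Suc k))"
      proof
        fix x assume "x \<in> bx m c d"
        from bspec[OF iso this] obtain e where e: "0 < e" "?I x e" by (elim exE conjE) (rule that)
        obtain k where k: "1 / real (Suc k) < e" using nat_approx_posE[OF e(1)] by blast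
        have "?I x (1 / real (Suc k))"
        proof (intro ballI impI)
          fix y assume y: "y \<in> Rn m" "y \<in> ?B \<and> (\<forall>j<n. s y j = s x j) \<and> \<bar>s y n - s x n\<bar> < 1 / real (Suc k)"
          then have "y \<in> ?B \<and> (\<forall>j<n. s y j = s x j) \<and> \<bar>s y n - s x n\<bar> < e" using k by (meson less_trans)
          with bspec[OF e(2) y(1)] show "s y n = s x n" by (rule mp)
        qed
        then show "\<exists>k::nat. ?I x (1 / real (Suc k))" by (rule exI)
      qed
      then obtain k c1 d1 where 1: "proper m c1 d1" "bx m c1 d1 \<subseteq> bx m c d" "\<forall>x\<in>bx m c1 d1. ?I x (1 / real (Suc k))"
        by (rule box_cover[OF dI cd(1)])
      have B1: "bx m c1 d1 \<subseteq> ?B" using 1(2) cd(2) by (rule order_trans)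
      have "1 / real (Suc k) > 0" by simp
      then obtain c2 d2 where 2: "proper m c2 d2" "bx m c2 d2 \<subseteq> bx m c1 d1"
        "\<forall>x\<in>bx m c2 d2. \<forall>y\<in>bx m c2 d2. \<bar>s y n - s x n\<bar> < 1 / real (Suc k)"
        by (rule sub_box_small_image[OF 1(1) continuous_on_subset[OF comp B1]])
      have B2: "bx m c2 d2 \<subseteq> ?B" using 2(2) B1 by (rule order_trans)
      \<comment> \<open>The isolation radius is uniform and the last coordinate varies by less than
        it, so points with equal projections have equal last coordinates.\<close>
      have "inj_on ?s (bx m c2 d2)"
      proof (rule inj_onI)
        fix x y assume xy: "x \<in> bx m c2 d2" "y \<in> bx m c2 d2" "?s x = ?s y"
        then have eq: "\<forall>j<n. s y j = s x j" using vs by metis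
        have "\<bar>s y n - s x n\<bar> < 1 / real (Suc k)" using 2(3) xy by metis
        moreover have "?I x (1 / real (Suc k))" using 1(3) xy 2(2) by (meson subsetD)
        moreover have "y \<in> Rn m" "y \<in> ?B" using xy bx_Rn B2 by (meson subsetD)+
        ultimately have "s y n = s x n" using eq by (metis)
        then have "s x = s y" using s_eq eq by metis
        then show "x = y" by (rule inj_onD[OF inj _ subsetD[OF B2 xy(1)] subsetD[OF B2 xy(2)]])
      qed
      then show False using False 2(1) B2 by metis
    qed
    then have none: "\<forall>x\<in>bx m c d. \<not> (\<exists>e. 0 < e \<and> ?I x e)" using cd(3) by argo
    \<comment> \<open>The set of \<open>t\<close> with \<open>?A x t\<close> is the fibre of the
      image over the projection of \<open>s x\<close>. It is a definable subset of the line.\<close>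
    let ?A = "\<lambda>x t. \<exists>y\<in>Rn m. y \<in> ?B \<and> (\<forall>j<n. s y j = s x j) \<and> s y n = t"
    let ?E = "\<lambda>(p, q) x. p < q \<and> (\<forall>t. of_rat p < t \<and> t < of_rat q \<longrightarrow> ?A x t)"
    have dE: "dfn m (?E pq)" for pq :: "rat \<times> rat"
    proof -
      obtain p q where pq: "pq = (p, q)" by (cases pq)
      have "dfn m (\<lambda>x. p < q \<and> (\<forall>t. of_rat p < t \<and> t < of_rat q \<longrightarrow>
          (\<exists>y\<in>Rn m. y \<in> ?B \<and> (\<forall>j<n. s y j = s (vecn m x) j) \<and> s y n = t)))"
        by (intro dr; simp add: dfun_coord)
      then show ?thesis
      proof (rule iffD1[OF dfn_cong, rotated])
        fix x :: "nat \<Rightarrow> real" assume "x \<in> Rn m"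
        from vecn_Rn[OF this] show "(p < q \<and> (\<forall>t. of_rat p < t \<and> t < of_rat q \<longrightarrow>
          (\<exists>y\<in>Rn m. y \<in> ?B \<and> (\<forall>j<n. s y j = s (vecn m x) j) \<and> s y n = t))) \<longleftrightarrow> ?E pq x"
          by (simp only: pq prod.case)
      qed
    qed
    have "\<forall>x\<in>bx m c d. \<exists>pq. ?E pq x"
    proof
      fix x assume x: "x \<in> bx m c d"
      have "dfn 1 (\<lambda>w. \<exists>y\<in>Rn m. y \<in> ?B \<and> (\<forall>j<n. s y j = s x j) \<and> s y n = w 0)"
        by (intro dr; simp add: dfun_coord)
      then obtain F where F: "finite F" "\<forall>I\<in>F. is_interval I" "{t. ?A x t} = \<Union>F"
        by (rule one_dim_intervals)
      \<comment> \<open>A finite fibre would isolate \<open>s x n\<close>, which is excluded on this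
        box.\<close>
      have "\<exists>u v. u < v \<and> {u<..<v} \<subseteq> \<Union>F"
      proof (rule ccontr)
        assume "\<not> ?thesis"
        then have fin: "finite {t. ?A x t}" unfolding F(3) by (intro finite_of_no_pair F)
        from finite_set_avoid[OF fin, of "s x n"]
        obtain dl where dl: "dl > 0" "\<forall>t\<in>{t. ?A x t}. t \<noteq> s x n \<longrightarrow> dl \<le> dist (s x n) t"
          by (elim exE conjE) (rule that)
        have "?I x dl"
        proof (intro ballI impI, rule ccontr)
          fix y assume y: "y \<in> Rn m" "y \<in> ?B \<and> (\<forall>j<n. s y j = s x j) \<and> \<bar>s y n - s x n\<bar> < dl" and ne: "s y n \<noteq> s x n"
          have "s y n \<in> {t. ?A x t}"
            by (intro CollectI bexI[OF _ y(1)] conjI) (use y(2) in simp_all)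
          from mp[OF bspec[OF dl(2) this] ne] have "dl \<le> dist (s x n) (s y n)" .
          then show False using y by (simp add: dist_real_def abs_minus_commute)
        qed
        then have "\<exists>e. 0 < e \<and> ?I x e" using dl(1) by (intro exI[of _ dl] conjI)
        with bspec[OF none x] show False by (rule notE)
      qed
      then obtain u v where uv: "u < v" "{u<..<v} \<subseteq> {t. ?A x t}" unfolding F(3) by metis
      obtain q where q: "u < of_rat q" "of_rat q < v" using of_rat_dense[OF uv(1)] by blast
      obtain p where p: "u < of_rat p" "of_rat p < (of_rat q :: real)" using of_rat_dense[OF q(1)] by blast
      have "?A x t" if "of_rat p < t" "t < of_rat q" for t
      proof -
        have "t \<in> {u<..<v}" using that p q by auto
        with uv(2) have "t \<in> {t. ?A x t}" by (rule subsetD)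
        then show ?thesis by (rule CollectD)
      qed
      moreover have "p < q" using p(2) by (simp add: of_rat_less)
      ultimately have "?E (p, q) x" unfolding prod.case by metis
      then show "\<exists>pq. ?E pq x" by (rule exI)
    qed
    then obtain pq c1 d1 where 1: "proper m c1 d1" "bx m c1 d1 \<subseteq> bx m c d" "\<forall>x\<in>bx m c1 d1. ?E pq x"
      by (rule box_cover[OF dE cd(1)])
    obtain p q where pq: "pq = (p, q)" by (cases pq)
    have B1: "bx m c1 d1 \<subseteq> ?B" using 1(2) cd(2) by (rule order_trans)
    have E: "p < q" "\<forall>x\<in>bx m c1 d1. \<forall>t. of_rat p < t \<and> t < of_rat q \<longrightarrow> ?A x t"
      using 1(3) bx_nonempty[OF 1(1)] unfolding pq prod.case by (metis ex_in_conv, metis)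
    \<comment> \<open>A constant last coordinate on a box would make the projection injective there,
      against the case assumption.\<close>
    have nonconst: "\<forall>c' d'. proper m c' d' \<and> bx m c' d' \<subseteq> bx m c1 d1 \<longrightarrow> (\<exists>x\<in>bx m c' d'. \<exists>y\<in>bx m c' d'. ?g x \<noteq> ?g y)"
    proof (intro allI impI, rule ccontr)
      fix c' d' assume c': "proper m c' d' \<and> bx m c' d' \<subseteq> bx m c1 d1" and
        const: "\<not> (\<exists>x\<in>bx m c' d'. \<exists>y\<in>bx m c' d'. ?g x \<noteq> ?g y)"
      have sub: "bx m c' d' \<subseteq> ?B" using c' B1 by (meson order_trans)
      have "inj_on ?s (bx m c' d')"
      proof (rule inj_onI)
        fix x y assume xy: "x \<in> bx m c' d'" "y \<in> bx m c' d'" "?s x = ?s y"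
        then have "s x = s y" using s_eq vs const by metis
        then show "x = y" by (rule inj_onD[OF inj _ subsetD[OF sub xy(1)] subsetD[OF sub xy(2)]])
      qed
      then show False using False c' sub by metis
    qed
    from level_set_box[OF dg 1(1) continuous_on_subset[OF comp B1] nonconst]
    obtain m0 c2 d2 r v where m: "m = Suc m0" and 2: "proper m0 c2 d2" "\<forall>x. r x \<in> Rn m"
      "\<forall>j<m. dfun m0 (\<lambda>x. r x j)" "r ` bx m0 c2 d2 \<subseteq> bx m c1 d1" "inj_on r (bx m0 c2 d2)"
      "continuous_on (bx m0 c2 d2) r" "\<forall>x\<in>bx m0 c2 d2. s (r x) n = v"
      by (elim exE conjE) (rule that)
    let ?H = "bx m0 c2 d2"
    have rB: "r x \<in> ?B" "r x \<in> bx m c1 d1" if "x \<in> ?H" for x using 2(4) B1 that by blast+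
    have "\<exists>k C. m0 \<le> k \<and> cell S n k C \<and> C \<subseteq> (\<lambda>x. vecn n (s (r x))) ` ?H"
    proof (rule Suc.IH[OF 2(1)])
      show "\<forall>j<n. dfun m0 (\<lambda>x. vecn n (s (r x)) j)"
      proof (intro allI impI)
        fix j assume j: "j < n"
        have "dfun m0 (\<lambda>x. s (vecn m (\<lambda>i. r x i)) j)"
          by (rule dsc) (use j 2(3) in auto)
        then show "dfun m0 (\<lambda>x. vecn n (s (r x)) j)"
          using j 2(2) by (simp add: vecn_Rn)
      qed
      show "continuous_on ?H (\<lambda>x. vecn n (s (r x)))"
      proof (rule continuous_on_vecn)
        show "continuous_on ?H (\<lambda>x. s (r x) i)" for i
          by (rule continuous_on_compose2[OF comp 2(6)]) (use rB in blast)
      qed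
      show "inj_on (\<lambda>x. vecn n (s (r x))) ?H"
      proof (rule inj_onI)
        fix x y assume xy: "x \<in> ?H" "y \<in> ?H" "vecn n (s (r x)) = vecn n (s (r y))"
        then have "s (r x) = s (r y)" using s_eq vs 2(7) by metis
        then have "r x = r y" by (rule inj_onD[OF inj _ rB(1)[OF xy(1)] rB(1)[OF xy(2)]])
        then show "x = y" by (rule inj_onD[OF 2(5) _ xy(1,2)])
      qed
    qed simp
    then obtain k C where C: "m0 \<le> k" "cell S n k C" "C \<subseteq> (\<lambda>x. vecn n (s (r x))) ` ?H" by blast
    \<comment> \<open>Every point of this band is over some \<open>s (r x)\<close>, and the fibre
      there contains all values between \<open>p\<close> and \<open>q\<close>, so the band lies in
      the image.\<close>
    let ?D = "band_over n C (\<lambda>_. ereal (of_rat p)) (\<lambda>_. ereal (of_rat q))"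
    have "cell S (Suc n) (Suc k) ?D"
      by (rule cell_constant_band[OF C(2)]) (simp add: of_rat_less E(1))
    moreover have "?D \<subseteq> s ` ?B"
    proof
      fix z assume "z \<in> ?D"
      then have z: "z \<in> Rn (Suc n)" "vecn n z \<in> C" "of_rat p < z n" "z n < of_rat q"
        by (auto simp: band_over_def upd_Rn_Suc)
      then obtain x where x: "x \<in> ?H" "vecn n z = vecn n (s (r x))" using C(3) by blast
      obtain y where y: "y \<in> ?B" "\<forall>j<n. s y j = s (r x) j" "s y n = z n"
        using E(2) rB(2)[OF x(1)] z(3,4) by metis
      have "s y j = z j" if "j < n" for j
        using y(2) fun_cong[OF x(2), of j] that by simp
      then have "z = s y"
        using z(1) sR y(3) by (intro Rn_ext[of _ "Suc n"]) (auto simp: less_Suc_eq)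
      then show "z \<in> s ` ?B" using y(1) by blast
    qed
    ultimately show ?thesis using C(1) m by (intro exI[of _ "Suc k"] exI[of _ ?D]) simp
  qed
qed

end

section \<open>Definable sections and cells from large projections\<close>

lemma closed_fibre:
  assumes "\<forall>i<m. polynomial_fun n (\<pi> i)"
  shows "closed {x. (\<forall>i<m. \<pi> i x = y i) \<and> (\<forall>i<j. x i = (c i :: real))}"
proof (rule closed_Collect_conj)
  have "closed {x. i < m \<longrightarrow> \<pi> i x = y i}" for i
  proof (cases "i < m")
    case True
    then have "continuous_on UNIV (\<pi> i)" using assms polynomial_fun_continuous by blast
    then have "closed {x. \<pi> i x = y i}" by (intro closed_Collect_eq continuous_on_const)
    then show ?thesis using True by simp
  qed simp
  then show "closed {x. \<forall>i<m. \<pi> i x = y i}" by (rule closed_Collect_all)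
  have "closed {x :: nat \<Rightarrow> real. i < j \<longrightarrow> x i = c i}" for i
  proof (cases "i < j")
    case True
    have "closed {x :: nat \<Rightarrow> real. x i = c i}" by (intro closed_Collect_eq continuous_on_const continuous_on_coord)
    then show ?thesis using True by simp
  qed simp
  then show "closed {x :: nat \<Rightarrow> real. \<forall>i<j. x i = c i}" by (rule closed_Collect_all)
qed

context o_minimal_structure
begin

text \<open>Definable choice by lexicographic minimum: with the first \<open>j\<close> coordinates
  fixed, coordinate \<open>j\<close> is the least value that occurs on the rest of the fibre.
  Compactness lets the minimum be attained, and its uniqueness makes it definable.\<close>

lemma definable_section:
  assumes KS: "K \<in> S n" and K: "compact K" and \<pi>: "\<forall>i<m. polynomial_fun n (\<pi> i)"
    and fib: "\<forall>y\<in>bx m a b. \<exists>x\<in>K. \<forall>i<m. \<pi> i x = y i" and j: "j \<le> n"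
  shows "\<exists>f. (\<forall>i<j. dfun m (f i)) \<and>
    (\<forall>y\<in>bx m a b. \<exists>x\<in>K. (\<forall>i<m. \<pi> i x = y i) \<and> (\<forall>i<j. x i = f i y))"
  using j
proof (induction j)
  case 0
  show ?case using fib by simp
next
  case (Suc j)
  from Suc.IH[OF Suc_leD[OF Suc.prems]] obtain f where f: "\<forall>i<j. dfun m (f i)"
    "\<forall>y\<in>bx m a b. \<exists>x\<in>K. (\<forall>i<m. \<pi> i x = y i) \<and> (\<forall>i<j. x i = f i y)"
    by (elim exE conjE) (rule that)
  have KR: "K \<subseteq> Rn n" by (rule subset_Rn[OF KS])
  have jn: "j < n" using Suc.prems by simp
  let ?V = "\<lambda>y x. x \<in> K \<and> (\<forall>i<m. \<pi> i x = y i) \<and> (\<forall>i<j. x i = f i y)"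
  \<comment> \<open>\<open>t\<close> is the minimum of coordinate \<open>j\<close> over the points
    of the fibre whose earlier coordinates have already been chosen.\<close>
  define M where "M y t \<longleftrightarrow> (\<exists>x\<in>Rn n. ?V y x \<and> x j = t) \<and> (\<forall>x\<in>Rn n. ?V y x \<longrightarrow> t \<le> x j)" for y t
  have exM: "\<exists>t. M y t" if y: "y \<in> bx m a b" for y
  proof -
    have eq: "{x. ?V y x} = K \<inter> {x. (\<forall>i<m. \<pi> i x = y i) \<and> (\<forall>i<j. x i = f i y)}" by auto
    have "compact {x. ?V y x}"
      unfolding eq by (rule compact_Int_closed[OF K closed_fibre[OF \<pi>]])
    then have c: "compact ((\<lambda>x. x j) ` {x. ?V y x})"
      by (rule compact_continuous_image[OF continuous_on_coord])
    have ne: "(\<lambda>x. x j) ` {x. ?V y x} \<noteq> {}"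
      using bspec[OF f(2) y] by auto
    from compact_attains_inf[OF c ne] obtain x where x: "?V y x" "\<forall>x'. ?V y x' \<longrightarrow> x j \<le> x' j"
      by auto
    have "M y (x j)" unfolding M_def
    proof (intro conjI bexI[of _ x] ballI impI)
      show "x \<in> Rn n" using x(1) KR by blast
      fix x' assume "?V y x'"
      then show "x j \<le> x' j" using x(2) by simp
    qed (use x(1) in simp_all)
    then show ?thesis by (rule exI)
  qed
  have uM: "s = t" if "M y s" "M y t" for y s t
    using that unfolding M_def by (metis order_antisym)
  define h where "h y = (if y \<in> bx m a b then (SOME t. M y t) else 0)" for y
  have hM: "M y (h y)" if "y \<in> bx m a b" for y
    using someI_ex[OF exM[OF that]] that by (simp only: h_def if_True)
  have dh: "dfun m h"
  proof -
    have pi: "dfun N (\<lambda>x. \<pi> i (vecn n (\<lambda>l. G l x)))" if "i < m" "\<And>l. l < n \<Longrightarrow> dfun N (G l)" for N i G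
      by (rule dfun_comp[OF dfun_poly]) (use that \<pi> in auto)
    have ff: "dfun N (\<lambda>x. f i (vecn m (\<lambda>l. G l x)))" if "i < j" "\<And>l. l < m \<Longrightarrow> dfun N (G l)" for N i G
      by (rule dfun_comp) (use that f(1) in auto)
    note dr = dfn_conj dfn_disj dfn_exs dfn_alls dfn_imp dfn_all_less dfn_eq dfn_le dfn_not
      dfn_subst[OF dfn_bx] dfn_subst[OF dfn_mem[OF KS]] pi ff dfun_intros
    have "dfn (Suc m) (\<lambda>z. (vecn m z \<in> bx m a b \<and> ((\<exists>x\<in>Rn n. (x \<in> K \<and> (\<forall>i<m. \<pi> i x = vecn m z i) \<and>
        (\<forall>i<j. x i = f i (vecn m z))) \<and> x j = z m) \<and>
        (\<forall>x\<in>Rn n. x \<in> K \<and> (\<forall>i<m. \<pi> i x = vecn m z i) \<and> (\<forall>i<j. x i = f i (vecn m z)) \<longrightarrow> z m \<le> x j))) \<or>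
        (\<not> vecn m z \<in> bx m a b \<and> z m = 0))"
      by (intro dr; use jn in \<open>simp add: dfun_coord\<close>)
    then show ?thesis
      unfolding dfun_def M_def[symmetric]
    proof (rule iffD1[OF dfn_cong, rotated])
      fix z
      show "(vecn m z \<in> bx m a b \<and> M (vecn m z) (z m)) \<or> (\<not> vecn m z \<in> bx m a b \<and> z m = 0) \<longleftrightarrow> z m = h (vecn m z)"
      proof (cases "vecn m z \<in> bx m a b")
        case True
        have "M (vecn m z) (z m) \<longleftrightarrow> z m = h (vecn m z)"
          using uM[of "vecn m z" "z m" "h (vecn m z)"] hM[OF True] by metis
        then show ?thesis using True by (simp only: True not_True_eq_False simp_thms)
      qed (simp add: h_def)
    qed
  qed
  show ?case
  proof (intro exI[of _ "f(j := h)"] conjI allI impI ballI)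
    fix i assume "i < Suc j"
    then show "dfun m ((f(j := h)) i)" using f(1) dh by (cases "i = j") auto
  next
    fix y assume y: "y \<in> bx m a b"
    from hM[OF y] obtain x where x: "x \<in> K" "\<forall>i<m. \<pi> i x = y i" "\<forall>i<j. x i = f i y" "x j = h y"
      unfolding M_def by blast
    then have "\<forall>i<Suc j. x i = (f(j := h)) i y" by (simp add: less_Suc_eq)
    then show "\<exists>x\<in>K. (\<forall>i<m. \<pi> i x = y i) \<and> (\<forall>i<Suc j. x i = (f(j := h)) i y)"
      using x by blast
  qed
qed

lemma generic_continuity_all:
  assumes "\<forall>i<(n::nat). dfun m (f i)" "proper m a b"
  obtains c d where "proper m c d" "bx m c d \<subseteq> bx m a b" "\<forall>i<n. continuous_on (bx m c d) (f i)"
proof -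
  have "\<exists>c d. proper m c d \<and> bx m c d \<subseteq> bx m a b \<and> (\<forall>i<k. continuous_on (bx m c d) (f i))" if "k \<le> n" for k
    using that
  proof (induction k)
    case 0
    show ?case by (intro exI[of _ a] exI[of _ b]) (simp add: assms(2))
  next
    case (Suc k)
    from Suc.IH[OF Suc_leD[OF Suc.prems]] obtain c d where cd: "proper m c d" "bx m c d \<subseteq> bx m a b"
      "\<forall>i<k. continuous_on (bx m c d) (f i)"
      by (elim exE conjE) (rule that)
    have "dfun m (f k)" using assms(1) Suc.prems by simp
    then obtain c' d' where cd': "proper m c' d'" "bx m c' d' \<subseteq> bx m c d" "continuous_on (bx m c' d') (f k)"
      by (rule generic_continuity[OF _ cd(1)])
    have "continuous_on (bx m c' d') (f i)" if "i < Suc k" for i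
    proof (cases "i = k")
      case True
      then show ?thesis using cd'(3) by simp
    next
      case False
      then have "continuous_on (bx m c d) (f i)" using that cd(3) by simp
      then show ?thesis by (rule continuous_on_subset[OF _ cd'(2)])
    qed
    then show ?case using cd'(1) order_trans[OF cd'(2) cd(2)] by blast
  qed
  from this[OF le_refl] show thesis by (elim exE conjE) (rule that)
qed

text \<open>A section of the projection over a box is automatically injective, since the projection
  is its left inverse; once it is definable and continuous, its image is an embedded box inside
  \<open>A\<close>.\<close>

lemma projection_contains_box_imp_cell:
  assumes A: "A \<in> S n" "closed A" and \<pi>: "\<forall>i<m. polynomial_fun n (\<pi> i)" and ab: "proper m a b"
    and fib: "\<forall>y\<in>bx m a b. \<exists>x\<in>A. \<forall>i<m. \<pi> i x = y i"
  shows "\<exists>k C. m \<le> k \<and> cell S n k C \<and> C \<subseteq> A"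
proof -
  have AR: "A \<subseteq> Rn n" by (rule subset_Rn[OF A(1)])
  have pi: "dfun N (\<lambda>x. \<pi> i (vecn n (\<lambda>l. G l x)))" if "i < m" "\<And>l. l < n \<Longrightarrow> dfun N (G l)" for N i G
    by (rule dfun_comp[OF dfun_poly]) (use that \<pi> in auto)
  \<comment> \<open>Closed \<open>A\<close> is exhausted by compact pieces; category finds a single
    radius whose piece projects onto a whole box.\<close>
  define K where "K R = A \<inter> cbx n (\<lambda>_. - real R) (\<lambda>_. real R)" for R
  have dcbx: "dfn n (\<lambda>x. \<forall>i<n. - real R \<le> x i \<and> x i \<le> real R)" for R
    by (intro dfn_intros dfun_intros)
  have dK: "dfn n (\<lambda>x. x \<in> A \<and> (\<forall>i<n. - real R \<le> x i \<and> x i \<le> real R))" for R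
    by (intro dfn_conj dfn_mem A dcbx)
  have Keq: "K R = {x \<in> Rn n. x \<in> A \<and> (\<forall>i<n. - real R \<le> x i \<and> x i \<le> real R)}" for R
    by (auto simp: K_def cbx_def)
  have KS: "K R \<in> S n" for R
    using dK[of R] unfolding dfn_def Keq .
  have KC: "compact (K R)" for R
    unfolding K_def by (rule closed_Int_compact[OF A(2) compact_cbx])
  have dE: "dfn m (\<lambda>y. \<exists>x\<in>Rn n. x \<in> K R \<and> (\<forall>i<m. \<pi> i x = y i))" for R
    by (intro dfn_intros dfn_subst[OF dfn_mem[OF KS]] pi; simp add: dfun_coord)
  have "\<forall>y\<in>bx m a b. \<exists>R. \<exists>x\<in>Rn n. x \<in> K R \<and> (\<forall>i<m. \<pi> i x = y i)"
  proof
    fix y assume "y \<in> bx m a b"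
    then obtain x where x: "x \<in> A" "\<forall>i<m. \<pi> i x = y i" using fib by blast
    obtain R where R: "(\<Sum>i<n. \<bar>x i\<bar>) \<le> real R" using real_arch_simple by blast
    have "\<bar>x i\<bar> \<le> real R" if "i < n" for i
      using member_le_sum[of i "{..<n}" "\<lambda>i. \<bar>x i\<bar>"] that R by simp
    then have "x \<in> K R" using x(1) AR unfolding K_def cbx_def by (force simp: abs_le_iff)
    then show "\<exists>R. \<exists>x\<in>Rn n. x \<in> K R \<and> (\<forall>i<m. \<pi> i x = y i)" using x AR by blast
  qed
  then obtain R c d where cd: "proper m c d" "bx m c d \<subseteq> bx m a b"
    "\<forall>y\<in>bx m c d. \<exists>x\<in>Rn n. x \<in> K R \<and> (\<forall>i<m. \<pi> i x = y i)"
    by (rule box_cover[OF dE ab])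
  have "\<forall>y\<in>bx m c d. \<exists>x\<in>K R. \<forall>i<m. \<pi> i x = y i" using cd(3) by blast
  from definable_section[OF KS KC \<pi> this le_refl]
  obtain f where f: "\<forall>i<n. dfun m (f i)"
    "\<forall>y\<in>bx m c d. \<exists>x\<in>K R. (\<forall>i<m. \<pi> i x = y i) \<and> (\<forall>i<n. x i = f i y)"
    by (elim exE conjE) (rule that)
  obtain c' d' where cd': "proper m c' d'" "bx m c' d' \<subseteq> bx m c d" "\<forall>i<n. continuous_on (bx m c' d') (f i)"
    by (rule generic_continuity_all[OF f(1) cd(1)])
  define s where "s y = vecn n (\<lambda>i. f i y)" for y
  have s: "s y \<in> A" "\<forall>i<m. \<pi> i (s y) = y i" if y: "y \<in> bx m c' d'" for y
  proof -
    from bspec[OF f(2) subsetD[OF cd'(2) y]]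
    obtain x where x: "x \<in> K R" "\<forall>i<m. \<pi> i x = y i" "\<forall>i<n. x i = f i y"
      by (elim bexE conjE) (rule that)
    have "x = s y"
      by (rule Rn_ext[of _ n]) (use x AR in \<open>auto simp: K_def s_def\<close>)
    then show "s y \<in> A" "\<forall>i<m. \<pi> i (s y) = y i" using x by (auto simp: K_def)
  qed
  have "\<exists>k C. m \<le> k \<and> cell S n k C \<and> C \<subseteq> s ` bx m c' d'"
  proof (rule embedded_box_cell[OF cd'(1)])
    show "\<forall>j<n. dfun m (\<lambda>x. s x j)" using f(1) by (simp add: s_def)
    show "\<forall>x. s x \<in> Rn n" by (simp add: s_def)
    show "continuous_on (bx m c' d') s"
      unfolding s_def by (rule continuous_on_vecn) (use cd'(3) in simp)
    show "inj_on s (bx m c' d')"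
    proof (rule inj_onI)
      fix x y assume xy: "x \<in> bx m c' d'" "y \<in> bx m c' d'" "s x = s y"
      show "x = y"
      proof (rule Rn_ext[of _ m])
        show "x \<in> Rn m" "y \<in> Rn m" using xy bx_Rn by blast+
        fix i assume i: "i < m"
        have "\<pi> i (s x) = x i" "\<pi> i (s y) = y i" using s(2)[OF xy(1)] s(2)[OF xy(2)] i by auto
        then show "x i = y i" using xy(3) by simp
      qed
    qed
  qed
  then show ?thesis using s(1) by blast
qed

end

section \<open>The cone as a definable closed cone\<close>

lemma limitin_Rn_iff:
  assumes "\<forall>k. x k \<in> Rn n" "p \<in> Rn n"
  shows "limitin (Euclidean_space n) x p sequentially \<longleftrightarrow> (\<forall>i<n. (\<lambda>k. x k i) \<longlonglongrightarrow> p i)"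
proof
  assume L: "limitin (Euclidean_space n) x p sequentially"
  show "\<forall>i<n. (\<lambda>k. x k i) \<longlonglongrightarrow> p i"
  proof (intro allI impI tendstoI)
    fix i and e :: real assume i: "i < n" and e: "0 < e"
    let ?U = "bx n (\<lambda>i. p i - e) (\<lambda>i. p i + e)"
    have "p \<in> ?U" using assms(2) e by (simp add: bx_def)
    then have "eventually (\<lambda>k. x k \<in> ?U) sequentially"
      using L openin_bx unfolding limitin_def by blast
    then show "eventually (\<lambda>k. dist (x k i) (p i) < e) sequentially"
    proof (rule eventually_mono)
      fix k assume "x k \<in> ?U"
      then have "p i - e < x k i" "x k i < p i + e" using i by (auto simp: bx_def)
      then show "dist (x k i) (p i) < e" by (simp add: dist_real_def abs_less_iff)
    qed
  qed
next
  assume R: "\<forall>i<n. (\<lambda>k. x k i) \<longlonglongrightarrow> p i"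
  show "limitin (Euclidean_space n) x p sequentially"
    unfolding limitin_def
  proof (intro conjI allI impI assms(2))
    fix U assume "openin (Euclidean_space n) U \<and> p \<in> U"
    then obtain r where r: "r > 0" "\<forall>y\<in>Rn n. (\<forall>i<n. \<bar>y i - p i\<bar> < r) \<longrightarrow> y \<in> U"
      using openin_RnD by metis
    have "eventually (\<lambda>k. \<forall>i\<in>{..<n}. \<bar>x k i - p i\<bar> < r) sequentially"
    proof (rule eventually_ball_finite)
      show "\<forall>i\<in>{..<n}. eventually (\<lambda>k. \<bar>x k i - p i\<bar> < r) sequentially"
        using R r(1) by (auto simp: tendsto_iff dist_real_def)
    qed simp
    then show "eventually (\<lambda>k. x k \<in> U) sequentially"
    proof (rule eventually_mono)
      fix k assume "\<forall>i\<in>{..<n}. \<bar>x k i - p i\<bar> < r"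
      then show "x k \<in> U" using r(2) assms(1) by simp
    qed
  qed
qed

lemma C5_iff_sequences:
  assumes "X \<subseteq> Rn n" "p \<in> Rn n"
  shows "v \<in> C5 n X p \<longleftrightarrow> v \<in> Rn n \<and> (\<exists>(x :: nat \<Rightarrow> nat \<Rightarrow> real) (y :: nat \<Rightarrow> nat \<Rightarrow> real) (t :: nat \<Rightarrow> real).
    (\<forall>k. x k \<in> X \<and> y k \<in> X \<and> t k > 0) \<and> (\<forall>i<n. (\<lambda>k. x k i) \<longlonglongrightarrow> p i) \<and>
    (\<forall>i<n. (\<lambda>k. y k i) \<longlonglongrightarrow> p i) \<and> (\<forall>i<n. (\<lambda>k. (x k i - y k i) / t k) \<longlonglongrightarrow> v i))"
proof -
  have lim: "limitin (Euclidean_space n) x p sequentially \<and> limitin (Euclidean_space n) y p sequentially \<and>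
      limitin (Euclidean_space n) (\<lambda>i j. (1 / t i) * (x i j - y i j)) v sequentially \<longleftrightarrow>
      v \<in> Rn n \<and> (\<forall>i<n. (\<lambda>k. x k i) \<longlonglongrightarrow> p i) \<and> (\<forall>i<n. (\<lambda>k. y k i) \<longlonglongrightarrow> p i) \<and>
      (\<forall>i<n. (\<lambda>k. (x k i - y k i) / t k) \<longlonglongrightarrow> v i)"
    if xy: "\<forall>k. x k \<in> X \<and> y k \<in> X \<and> t k > 0" for x y :: "nat \<Rightarrow> nat \<Rightarrow> real" and t :: "nat \<Rightarrow> real"
  proof -
    have R: "\<forall>k. x k \<in> Rn n" "\<forall>k. y k \<in> Rn n" using xy assms(1) by blast+
    then have q: "\<forall>k. (\<lambda>j. (1 / t k) * (x k j - y k j)) \<in> Rn n" by (simp add: Rn_iff)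
    show ?thesis
    proof (cases "v \<in> Rn n")
      case True
      show ?thesis
        by (simp only: limitin_Rn_iff[OF R(1) assms(2)] limitin_Rn_iff[OF R(2) assms(2)]
            limitin_Rn_iff[OF q True] True simp_thms) simp
    next
      case False
      then show ?thesis unfolding limitin_def by blast
    qed
  qed
  have "(\<forall>k. x k \<in> X \<and> y k \<in> X \<and> t k > 0) \<and> limitin (Euclidean_space n) x p sequentially \<and>
      limitin (Euclidean_space n) y p sequentially \<and>
      limitin (Euclidean_space n) (\<lambda>i j. (1 / t i) * (x i j - y i j)) v sequentially \<longleftrightarrow>
      v \<in> Rn n \<and> (\<forall>k. x k \<in> X \<and> y k \<in> X \<and> t k > 0) \<and> (\<forall>i<n. (\<lambda>k. x k i) \<longlonglongrightarrow> p i) \<and>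
      (\<forall>i<n. (\<lambda>k. y k i) \<longlonglongrightarrow> p i) \<and> (\<forall>i<n. (\<lambda>k. (x k i - y k i) / t k) \<longlonglongrightarrow> v i)"
    for x y :: "nat \<Rightarrow> nat \<Rightarrow> real" and t :: "nat \<Rightarrow> real"
  proof (cases "\<forall>k. x k \<in> X \<and> y k \<in> X \<and> t k > 0")
    case True
    then show ?thesis by (simp only: lim[OF True] True simp_thms)
  next
    case False
    then show ?thesis by argo
  qed
  then show ?thesis
    unfolding C5_def mem_Collect_eq by (simp only: ex_simps)
qed

lemma C5_I:
  assumes "X \<subseteq> Rn n" "p \<in> Rn n" "v \<in> Rn n" "\<forall>k. x k \<in> X \<and> y k \<in> X \<and> t k > 0"
    "\<forall>i<n. (\<lambda>k. x k i) \<longlonglongrightarrow> p i" "\<forall>i<n. (\<lambda>k. y k i) \<longlonglongrightarrow> p i"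
    "\<forall>i<n. (\<lambda>k. (x k i - y k i) / t k) \<longlonglongrightarrow> v i"
  shows "v \<in> C5 n X p"
  unfolding C5_iff_sequences[OF assms(1,2)]
  by (rule conjI[OF assms(3)], rule exI[of _ x], rule exI[of _ y], rule exI[of _ t]) (intro conjI assms)

text \<open>The epsilon form of membership in \<open>C5\<close>. The last inequality is multiplied
  by \<open>t\<close>, so no division occurs and the condition is visibly first-order.\<close>

definition C5_near :: "nat \<Rightarrow> (nat \<Rightarrow> real) set \<Rightarrow> (nat \<Rightarrow> real) \<Rightarrow> (nat \<Rightarrow> real) \<Rightarrow> real \<Rightarrow> bool"
  where "C5_near n X p v e \<longleftrightarrow> (\<exists>x\<in>Rn n. \<exists>y\<in>Rn n. \<exists>t. 0 < t \<and> x \<in> X \<and> y \<in> X \<and>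
    (\<forall>i<n. \<bar>x i - p i\<bar> < e) \<and> (\<forall>i<n. \<bar>y i - p i\<bar> < e) \<and> (\<forall>i<n. \<bar>(x i - y i) - t * v i\<bar> < e * t))"

lemma C5_iff_near:
  assumes X: "X \<subseteq> Rn n" and p: "p \<in> Rn n"
  shows "v \<in> C5 n X p \<longleftrightarrow> v \<in> Rn n \<and> (\<forall>e. 0 < e \<longrightarrow> C5_near n X p v e)"
proof
  assume "v \<in> C5 n X p"
  then obtain x y :: "nat \<Rightarrow> nat \<Rightarrow> real" and t :: "nat \<Rightarrow> real"
    where v: "v \<in> Rn n" and xy: "\<forall>k. x k \<in> X \<and> y k \<in> X \<and> t k > 0" and
      lim: "\<forall>i<n. (\<lambda>k. x k i) \<longlonglongrightarrow> p i" "\<forall>i<n. (\<lambda>k. y k i) \<longlonglongrightarrow> p i"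
        "\<forall>i<n. (\<lambda>k. (x k i - y k i) / t k) \<longlonglongrightarrow> v i"
    unfolding C5_iff_sequences[OF assms] by (elim exE conjE) (rule that)
  have "C5_near n X p v e" if e: "0 < e" for e
  proof -
    have ev: "eventually (\<lambda>k. \<forall>i\<in>{..<n}. \<bar>f k i - l i\<bar> < e) sequentially"
      if "\<forall>i<n. (\<lambda>k. f k i) \<longlonglongrightarrow> l i" for f :: "nat \<Rightarrow> nat \<Rightarrow> real" and l
      by (rule eventually_ball_finite) (use that e in \<open>auto simp: tendsto_iff dist_real_def\<close>)
    from eventually_conj[OF ev[OF lim(1)] eventually_conj[OF ev[OF lim(2)] ev[OF lim(3)]]]
    obtain k where k: "\<forall>i\<in>{..<n}. \<bar>x k i - p i\<bar> < e" "\<forall>i\<in>{..<n}. \<bar>y k i - p i\<bar> < e"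
      "\<forall>i\<in>{..<n}. \<bar>(x k i - y k i) / t k - v i\<bar> < e"
      using eventually_happens' sequentially_bot by blast
    have t: "t k > 0" using xy by blast
    have "\<bar>(x k i - y k i) - t k * v i\<bar> < e * t k" if "i < n" for i
    proof -
      have "(x k i - y k i) - t k * v i = ((x k i - y k i) / t k - v i) * t k"
        using t by (simp add: field_simps)
      then have "\<bar>(x k i - y k i) - t k * v i\<bar> = \<bar>(x k i - y k i) / t k - v i\<bar> * t k"
        using t by (simp add: abs_mult)
      then show ?thesis using k(3) that t by simp
    qed
    moreover have "x k \<in> Rn n" "y k \<in> Rn n" "x k \<in> X" "y k \<in> X" using xy X by blast+
    ultimately show ?thesis
      unfolding C5_near_def using k t by (metis lessThan_iff)
  qed
  then show "v \<in> Rn n \<and> (\<forall>e. 0 < e \<longrightarrow> C5_near n X p v e)" using v by blast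
next
  assume R: "v \<in> Rn n \<and> (\<forall>e. 0 < e \<longrightarrow> C5_near n X p v e)"
  have "\<forall>k. \<exists>x y t. (x \<in> X \<and> y \<in> X \<and> 0 < t) \<and> (\<forall>i<n. \<bar>x i - p i\<bar> < 1 / real (Suc k)) \<and>
    (\<forall>i<n. \<bar>y i - p i\<bar> < 1 / real (Suc k)) \<and> (\<forall>i<n. \<bar>(x i - y i) / t - v i\<bar> < 1 / real (Suc k))"
  proof
    fix k
    have "C5_near n X p v (1 / real (Suc k))" using R by simp
    then obtain x y t where *: "0 < t" "x \<in> X" "y \<in> X" "\<forall>i<n. \<bar>x i - p i\<bar> < 1 / real (Suc k)"
      "\<forall>i<n. \<bar>y i - p i\<bar> < 1 / real (Suc k)" "\<forall>i<n. \<bar>(x i - y i) - t * v i\<bar> < 1 / real (Suc k) * t"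
      unfolding C5_near_def by (elim bexE exE conjE) (rule that)
    have "\<bar>(x i - y i) / t - v i\<bar> < 1 / real (Suc k)" if "i < n" for i
    proof -
      have "(x i - y i) / t - v i = ((x i - y i) - t * v i) / t"
        using *(1) by (simp add: field_simps)
      then have "\<bar>(x i - y i) / t - v i\<bar> = \<bar>(x i - y i) - t * v i\<bar> / t"
        using *(1) by simp
      also have "\<dots> < 1 / real (Suc k)"
        using *(1) *(6) that by (simp only: pos_divide_less_eq)
      finally show ?thesis .
    qed
    then show "\<exists>x y t. (x \<in> X \<and> y \<in> X \<and> 0 < t) \<and> (\<forall>i<n. \<bar>x i - p i\<bar> < 1 / real (Suc k)) \<and>
    (\<forall>i<n. \<bar>y i - p i\<bar> < 1 / real (Suc k)) \<and> (\<forall>i<n. \<bar>(x i - y i) / t - v i\<bar> < 1 / real (Suc k))"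
      using *(1-5) by metis
  qed
  then obtain x y :: "nat \<Rightarrow> nat \<Rightarrow> real" and t :: "nat \<Rightarrow> real" where
    *: "\<And>k. x k \<in> X \<and> y k \<in> X \<and> 0 < t k" "\<And>k. \<forall>i<n. \<bar>x k i - p i\<bar> < 1 / real (Suc k)"
    "\<And>k. \<forall>i<n. \<bar>y k i - p i\<bar> < 1 / real (Suc k)" "\<And>k. \<forall>i<n. \<bar>(x k i - y k i) / t k - v i\<bar> < 1 / real (Suc k)"
    by metis
  have lim: "\<forall>i<n. (\<lambda>k. f k i) \<longlonglongrightarrow> l i" if "\<And>k. \<forall>i<n. \<bar>f k i - l i\<bar> < 1 / real (Suc k)"
    for f :: "nat \<Rightarrow> nat \<Rightarrow> real" and l
  proof (intro allI impI)
    fix i assume i: "i < n"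
    have "(\<lambda>k. 1 / real (Suc k)) \<longlonglongrightarrow> 0" by (rule LIMSEQ_inverse_real_of_nat[unfolded inverse_eq_divide])
    moreover have "\<forall>\<^sub>F k in sequentially. norm (f k i - l i) \<le> 1 / real (Suc k)"
      using that i by (intro always_eventually allI) (simp add: less_imp_le)
    ultimately have "(\<lambda>k. f k i - l i) \<longlonglongrightarrow> 0" by (rule Lim_null_comparison[rotated])
    then show "(\<lambda>k. f k i) \<longlonglongrightarrow> l i" by (rule LIM_zero_cancel)
  qed
  show "v \<in> C5 n X p"
  proof (rule C5_I[OF assms, of v x y t])
    show "v \<in> Rn n" using R by blast
    show "\<forall>k. x k \<in> X \<and> y k \<in> X \<and> 0 < t k" using *(1) by blast
    show "\<forall>i<n. (\<lambda>k. x k i) \<longlonglongrightarrow> p i" by (rule lim[OF *(2)])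
    show "\<forall>i<n. (\<lambda>k. y k i) \<longlonglongrightarrow> p i" by (rule lim[OF *(3)])
    show "\<forall>i<n. (\<lambda>k. (x k i - y k i) / t k) \<longlonglongrightarrow> v i"
      using lim[of "\<lambda>k i. (x k i - y k i) / t k" v, OF *(4)] .
  qed
qed

lemma C5_subset_Rn: "X \<subseteq> Rn n \<Longrightarrow> p \<in> Rn n \<Longrightarrow> C5 n X p \<subseteq> Rn n"
  using C5_iff_near by blast

text \<open>The tolerance scales with \<open>t\<close>, so the same pair of points serves a nearby
  vector: an error of half of \<open>e\<close> from the points and half from changing the vector
  adds up to \<open>e * t\<close>.\<close>

lemma closed_C5:
  assumes X: "X \<subseteq> Rn n" and p: "p \<in> Rn n"
  shows "closed (C5 n X p)"
proof -
  have "openin (Euclidean_space n) (Rn n - C5 n X p)"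
    unfolding openin_Rn_iff
  proof (intro conjI ballI)
    fix v assume v: "v \<in> Rn n - C5 n X p"
    then obtain e where e: "0 < e" "\<not> C5_near n X p v e" using C5_iff_near[OF assms] by blast
    have "w \<notin> C5 n X p" if w: "\<forall>i<n. \<bar>w i - v i\<bar> < e / 2" for w
    proof
      assume "w \<in> C5 n X p"
      then have "C5_near n X p w (e / 2)" using C5_iff_near[OF assms] e(1) by simp
      then obtain x y t where *: "x \<in> Rn n" "y \<in> Rn n" "0 < t" "x \<in> X" "y \<in> X" "\<forall>i<n. \<bar>x i - p i\<bar> < e / 2"
        "\<forall>i<n. \<bar>y i - p i\<bar> < e / 2" "\<forall>i<n. \<bar>(x i - y i) - t * w i\<bar> < e / 2 * t"
        unfolding C5_near_def by (elim bexE exE conjE) (rule that)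
      have "\<bar>(x i - y i) - t * v i\<bar> < e * t" if i: "i < n" for i
      proof -
        have 1: "\<bar>t * (w i - v i)\<bar> \<le> t * (e / 2)"
          using w i *(3) by (simp add: abs_mult less_imp_le)
        have 2: "\<bar>(x i - y i) - t * w i\<bar> < e / 2 * t" using *(8) i by blast
        have "(x i - y i) - t * v i = ((x i - y i) - t * w i) + t * (w i - v i)"
          by (simp add: algebra_simps)
        then have "\<bar>(x i - y i) - t * v i\<bar> < e / 2 * t + t * (e / 2)"
          using 1 2 by linarith
        then show ?thesis by (simp add: algebra_simps)
      qed
      moreover have "\<forall>i<n. \<bar>x i - p i\<bar> < e" "\<forall>i<n. \<bar>y i - p i\<bar> < e"
        using *(6,7) e(1) by fastforce+
      ultimately have "C5_near n X p v e"
        unfolding C5_near_def using *(1-5) by blast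
      then show False using e(2) by blast
    qed
    then show "\<exists>r>0. \<forall>y\<in>Rn n. (\<forall>i<n. \<bar>y i - v i\<bar> < r) \<longrightarrow> y \<in> Rn n - C5 n X p"
      using e(1) by (intro exI[of _ "e / 2"]) auto
  qed blast
  then have "closedin (Euclidean_space n) (C5 n X p)"
    using C5_subset_Rn[OF assms] by (simp only: closedin_def)
  then show ?thesis by (rule closedin_Euclidean_imp_closed)
qed

text \<open>Rescaling the \<open>t k\<close> by the absolute value of \<open>c\<close> handles its
  size; for negative \<open>c\<close> the two sequences change places.\<close>

lemma C5_scale:
  assumes X: "X \<subseteq> Rn n" and p: "p \<in> Rn n" and v: "v \<in> C5 n X p" and c: "c \<noteq> 0"
  shows "(\<lambda>i. c * v i) \<in> C5 n X p"
proof -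
  obtain x y :: "nat \<Rightarrow> nat \<Rightarrow> real" and t :: "nat \<Rightarrow> real"
    where vR: "v \<in> Rn n" and xy: "\<forall>k. x k \<in> X \<and> y k \<in> X \<and> t k > 0" and
      lim: "\<forall>i<n. (\<lambda>k. x k i) \<longlonglongrightarrow> p i" "\<forall>i<n. (\<lambda>k. y k i) \<longlonglongrightarrow> p i"
        "\<forall>i<n. (\<lambda>k. (x k i - y k i) / t k) \<longlonglongrightarrow> v i"
    using v unfolding C5_iff_sequences[OF X p] by (elim exE conjE) (rule that)
  have R: "(\<lambda>i. c * v i) \<in> Rn n" using vR by (simp add: Rn_iff)
  have t: "\<forall>k. t k / \<bar>c\<bar> > 0" using xy c by simp
  have mult: "(\<lambda>k. c * ((x k i - y k i) / t k)) \<longlonglongrightarrow> c * v i" if "i < n" for i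
    using lim(3) that by (intro tendsto_mult_left) simp
  show ?thesis
  proof (cases "c > 0")
    case True
    have "\<forall>i<n. (\<lambda>k. (x k i - y k i) / (t k / \<bar>c\<bar>)) \<longlonglongrightarrow> c * v i"
      using mult True by (simp add: mult.commute)
    then show ?thesis
      using xy t by (intro C5_I[OF X p R _ lim(1,2), of "\<lambda>k. t k / \<bar>c\<bar>"]) auto
  next
    case False
    have "\<forall>i<n. (\<lambda>k. (y k i - x k i) / (t k / \<bar>c\<bar>)) \<longlonglongrightarrow> c * v i"
    proof (intro allI impI)
      fix i assume i: "i < n"
      have "(y k i - x k i) / (t k / \<bar>c\<bar>) = c * ((x k i - y k i) / t k)" for k
        using False by (simp add: abs_if algebra_simps diff_divide_distrib)
      then show "(\<lambda>k. (y k i - x k i) / (t k / \<bar>c\<bar>)) \<longlonglongrightarrow> c * v i" using mult[OF i] by (simp only:)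
    qed
    then show ?thesis
      using xy t by (intro C5_I[OF X p R _ lim(2,1), of "\<lambda>k. t k / \<bar>c\<bar>"]) auto
  qed
qed

text \<open>The source of cone vectors: bounded quotients stay in a compact box, so a subsequence of
  the secants converges.\<close>

lemma C5_limit:
  fixes x y :: "nat \<Rightarrow> nat \<Rightarrow> real"
  assumes X: "X \<subseteq> Rn n" and p: "p \<in> Rn n"
    and xy: "\<forall>k. x k \<in> X \<and> y k \<in> X \<and> t k > 0"
    and lim: "\<forall>i<n. (\<lambda>k. x k i) \<longlonglongrightarrow> p i" "\<forall>i<n. (\<lambda>k. y k i) \<longlonglongrightarrow> p i"
    and bound: "\<forall>k. \<forall>i<n. \<bar>x k i - y k i\<bar> \<le> M * t k"
  obtains v r where "v \<in> C5 n X p" "strict_mono (r :: nat \<Rightarrow> nat)"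
    "\<forall>i<n. (\<lambda>k. (x (r k) i - y (r k) i) / t (r k)) \<longlonglongrightarrow> v i"
proof -
  define w where "w k = vecn n (\<lambda>i. (x k i - y k i) / t k)" for k
  have "w k \<in> cbx n (\<lambda>_. - M) (\<lambda>_. M)" for k
  proof -
    have "- M \<le> (x k i - y k i) / t k \<and> (x k i - y k i) / t k \<le> M" if "i < n" for i
    proof -
      have "t k > 0" "\<bar>x k i - y k i\<bar> \<le> M * t k" using bound xy that by blast+
      then show ?thesis by (simp add: pos_le_divide_eq pos_divide_le_eq abs_le_iff)
    qed
    then show ?thesis by (simp add: cbx_def w_def)
  qed
  then obtain v r where v: "v \<in> cbx n (\<lambda>_. - M) (\<lambda>_. M)" "strict_mono r" "(w \<circ> r) \<longlonglongrightarrow> v"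
    using seq_compactE[OF compact_imp_seq_compact[OF compact_cbx]] by metis
  have conv: "(\<lambda>k. (x (r k) i - y (r k) i) / t (r k)) \<longlonglongrightarrow> v i" if "i < n" for i
  proof -
    have "(\<lambda>k. (w \<circ> r) k i) \<longlonglongrightarrow> v i"
      by (rule continuous_on_tendsto_compose[OF continuous_on_product_coordinates v(3)]) auto
    then show ?thesis using that by (simp add: w_def)
  qed
  have "v \<in> C5 n X p"
  proof (rule C5_I[OF X p, of v "\<lambda>k. x (r k)" "\<lambda>k. y (r k)" "\<lambda>k. t (r k)"])
    show "v \<in> Rn n" using v(1) by (simp add: cbx_def)
    show "\<forall>k. x (r k) \<in> X \<and> y (r k) \<in> X \<and> t (r k) > 0" using xy by blast
    show "\<forall>i<n. (\<lambda>k. x (r k) i) \<longlonglongrightarrow> p i" "\<forall>i<n. (\<lambda>k. y (r k) i) \<longlonglongrightarrow> p i"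
      using LIMSEQ_subseq_LIMSEQ[OF _ v(2)] lim by (fastforce simp: o_def)+
    show "\<forall>i<n. (\<lambda>k. (x (r k) i - y (r k) i) / t (r k)) \<longlonglongrightarrow> v i"
      using conv by blast
  qed
  then show thesis using that v(2) conv by blast
qed

section \<open>Definability of the cone and a projection transversal to it\<close>

context o_minimal_structure
begin

lemma C5_definable:
  assumes X: "X \<in> S n" and p: "p \<in> Rn n"
  shows "C5 n X p \<in> S n"
proof -
  note dr = dfn_intros dfn_subst[OF dfn_mem[OF X]] dfun_intros
  have "dfn n (\<lambda>v. \<forall>e. 0 < e \<longrightarrow> C5_near n X p v e)"
    unfolding C5_near_def by (intro dr; simp add: dfun_coord)
  moreover have "C5 n X p = {v \<in> Rn n. \<forall>e. 0 < e \<longrightarrow> C5_near n X p v e}"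
    using C5_iff_near[OF subset_Rn[OF X] p] by blast
  ultimately show ?thesis by (simp add: dfn_def)
qed

text \<open>Descending induction: starting from the zero subspace, the subspace meeting
  \<open>T\<close> only in 0 is enlarged by one dimension at a time. The image of \<open>T\<close>
  in dimension \<open>m + 1 > d\<close> contains no box, so some \<open>y\<close> is missed, and by
  the cone property the line through \<open>y\<close> meets the image at most in 0. The preimage of
  this line is the next subspace.\<close>

lemma transversal_coordinates:
  assumes T: "T \<in> S n" "closed T" and cone: "\<forall>v\<in>T. \<forall>c. c \<noteq> 0 \<longrightarrow> (\<lambda>i. c * v i) \<in> T"
    and small: "\<forall>k C. cell S n k C \<and> C \<subseteq> T \<longrightarrow> k \<le> d" and dn: "d \<le> n"
  shows "\<exists>a. \<forall>x\<in>T. (\<forall>i<d. x i = (\<Sum>j\<in>{d..<n}. a i j * x j)) \<longrightarrow> (\<forall>i<n. x i = 0)"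
  using dn
proof (induction d rule: inc_induct)
  case base
  show ?case by simp
next
  case (step m)
  from step.IH obtain a where a: "\<forall>x\<in>T. (\<forall>i<Suc m. x i = (\<Sum>j\<in>{Suc m..<n}. a i j * x j)) \<longrightarrow> (\<forall>i<n. x i = 0)"
    by (elim exE) (rule that)
  define \<pi> where "\<pi> i x = x i - (\<Sum>j\<in>{Suc m..<n}. a i j * x j)" for i and x :: "nat \<Rightarrow> real"
  have \<pi>: "\<forall>i<Suc m. polynomial_fun n (\<pi> i)"
    unfolding \<pi>_def using step.hyps
    by (intro allI impI polynomial_fun_diff polynomial_fun_sum polynomial_intros) auto
  have pr: "proper (Suc m) (\<lambda>_. 0) (\<lambda>_. 1)" by (simp add: proper_def)
  have "\<not> (\<forall>y\<in>bx (Suc m) (\<lambda>_. 0) (\<lambda>_. 1). \<exists>x\<in>T. \<forall>i<Suc m. \<pi> i x = y i)"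
  proof
    assume "\<forall>y\<in>bx (Suc m) (\<lambda>_. 0) (\<lambda>_. 1). \<exists>x\<in>T. \<forall>i<Suc m. \<pi> i x = y i"
    from projection_contains_box_imp_cell[OF T \<pi> pr this]
    obtain k C where "Suc m \<le> k" "cell S n k C \<and> C \<subseteq> T" by (elim exE conjE) (rule that, assumption, rule conjI)
    moreover from this(2) have "k \<le> d" using small by metis
    ultimately show False using step.hyps by simp
  qed
  \<comment> \<open>The unit box is used because all coordinates of \<open>y\<close> are then
    positive, so the line can be parametrized by coordinate \<open>m\<close>.\<close>
  then obtain y where y: "y \<in> bx (Suc m) (\<lambda>_. 0) (\<lambda>_. 1)" "\<forall>x\<in>T. \<exists>i<Suc m. \<pi> i x \<noteq> y i"
    by metis
  have ym: "y m \<noteq> 0" using y(1) by (auto simp: bx_def dest: spec[of _ m])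
  define w where "w i = y i / y m" for i
  \<comment> \<open>Solving \<open>\<pi> i x = w i * \<pi> m x\<close> for \<open>x i\<close> gives
    these coefficients; together the equations say that \<open>\<pi> x\<close> is a multiple of
    \<open>y\<close>.\<close>
  define b where "b i j = (if j = m then w i else a i j - w i * a m j)" for i j
  have "\<forall>i<n. x i = 0" if x: "x \<in> T" and eq: "\<forall>i<m. x i = (\<Sum>j\<in>{m..<n}. b i j * x j)" for x
  proof -
    define c where "c = \<pi> m x"
    have pc: "\<pi> i x = w i * c" if i: "i < Suc m" for i
    proof (cases "i = m")
      case True
      then show ?thesis using ym by (simp add: w_def c_def)
    next
      case False
      then have "i < m" using i by simp
      then have "x i = (\<Sum>j\<in>{m..<n}. b i j * x j)" using eq by blast
      also have "\<dots> = w i * x m + (\<Sum>j\<in>{Suc m..<n}. (a i j - w i * a m j) * x j)"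
        using step.hyps by (subst sum.atLeast_Suc_lessThan) (auto simp: b_def)
      also have "\<dots> = w i * x m + (\<Sum>j\<in>{Suc m..<n}. a i j * x j) - w i * (\<Sum>j\<in>{Suc m..<n}. a m j * x j)"
        by (simp add: algebra_simps sum_subtractf sum_distrib_left)
      finally show ?thesis by (simp add: \<pi>_def c_def algebra_simps)
    qed
    \<comment> \<open>Otherwise a multiple of \<open>x\<close>, again in \<open>T\<close>, would be
      projected exactly onto the missed point \<open>y\<close>.\<close>
    have "c = 0"
    proof (rule ccontr)
      assume c: "c \<noteq> 0"
      let ?x = "\<lambda>i. (y m / c) * x i"
      have "y m / c \<noteq> 0" using c ym by simp
      then have "?x \<in> T" using cone x by blast
      from bspec[OF y(2) this] obtain i where i: "i < Suc m" "\<pi> i ?x \<noteq> y i" by metis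
      have "\<pi> i ?x = (y m / c) * \<pi> i x"
        by (simp add: \<pi>_def algebra_simps sum_distrib_left)
      also have "\<dots> = y i" using pc[OF i(1)] c ym by (simp add: w_def)
      finally show False using i(2) by blast
    qed
    then have "\<forall>i<Suc m. x i = (\<Sum>j\<in>{Suc m..<n}. a i j * x j)"
      using pc by (simp add: \<pi>_def)
    then show ?thesis using a x by blast
  qed
  then show ?case by blast
qed

end

section \<open>Graphs over a projection transversal to the cone\<close>

text \<open>The linear projection to the first \<open>d\<close> coordinates whose kernel is the
  transversal subspace: a shear of the ambient space followed by the coordinate projection.\<close>

definition shear :: "nat \<Rightarrow> nat \<Rightarrow> (nat \<Rightarrow> nat \<Rightarrow> real) \<Rightarrow> (nat \<Rightarrow> real) \<Rightarrow> nat \<Rightarrow> real"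
  where "shear n d a x = vecn d (\<lambda>i. x i - (\<Sum>j\<in>{d..<n}. a i j * x j))"

lemma shear_in_Rn [simp]: "shear n d a x \<in> Rn d"
  by (simp add: shear_def)

lemma shear_diff: "i < d \<Longrightarrow> shear n d a x i - shear n d a y i = shear n d a (\<lambda>l. x l - y l) i"
  by (simp add: shear_def right_diff_distrib sum_subtractf)

lemma shear_scale: "shear n d a (\<lambda>l. x l / t) i = shear n d a x i / t"
  by (cases "i < d") (simp_all add: shear_def diff_divide_distrib sum_divide_distrib)

lemma shear_tendsto:
  assumes "\<forall>i<n. (\<lambda>k. f k i) \<longlonglongrightarrow> v i" "d \<le> n"
  shows "(\<lambda>k. shear n d a (f k) i) \<longlonglongrightarrow> shear n d a v i"
proof (cases "i < d")
  case True
  have "(\<lambda>k. f k i - (\<Sum>j\<in>{d..<n}. a i j * f k j)) \<longlonglongrightarrow> v i - (\<Sum>j\<in>{d..<n}. a i j * v j)"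
    using assms True by (intro tendsto_diff tendsto_sum tendsto_mult tendsto_const) auto
  then show ?thesis using True by (simp add: shear_def)
qed (simp add: shear_def)

lemma shear_quotient_tendsto:
  assumes "\<forall>i<n. (\<lambda>k. (x k i - y k i) / t k) \<longlonglongrightarrow> v i" "d \<le> n" "i < d"
  shows "(\<lambda>k. (shear n d a (x k) i - shear n d a (y k) i) / t k) \<longlonglongrightarrow> shear n d a v i"
  using shear_tendsto[OF assms(1,2), of a i] by (simp add: shear_diff[OF assms(3)] shear_scale)

text \<open>Without such a bound there are pairs of points tending to \<open>p\<close> whose
  secants, normalized to length 1, are mapped by \<open>shear\<close> to vectors tending to 0. A
  limit of these secants is a nonzero cone vector in the kernel.\<close>

lemma inverse_shear_lipschitz:
  assumes X: "X \<subseteq> Rn n" and p: "p \<in> Rn n" and dn: "d \<le> n"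
    and trans: "\<forall>v\<in>C5 n X p. (\<forall>i<d. v i = (\<Sum>j\<in>{d..<n}. a i j * v j)) \<longrightarrow> (\<forall>i<n. v i = 0)"
  obtains r M where "r > 0" "M > 0"
    "\<forall>x\<in>X. \<forall>y\<in>X. (\<forall>i<n. \<bar>x i - p i\<bar> < r) \<and> (\<forall>i<n. \<bar>y i - p i\<bar> < r) \<longrightarrow>
      (\<forall>i<n. \<bar>x i - y i\<bar> \<le> M * (\<Sum>l<d. \<bar>shear n d a x l - shear n d a y l\<bar>))"
proof (rule ccontr)
  \<comment> \<open>Trying the radius \<open>1 / real (Suc k)\<close> with the constant
    \<open>real (Suc k)\<close> now produces a bad pair for every \<open>k\<close>.\<close>
  assume none: "\<not> thesis"
  let ?\<sigma> = "\<lambda>x y. \<Sum>l<d. \<bar>shear n d a x l - shear n d a y l\<bar>"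
  define P where "P k x y \<longleftrightarrow> (x \<in> X \<and> y \<in> X) \<and> (\<forall>i<n. \<bar>x i - p i\<bar> < 1 / real (Suc k)) \<and>
    (\<forall>i<n. \<bar>y i - p i\<bar> < 1 / real (Suc k)) \<and> (\<exists>i<n. real (Suc k) * ?\<sigma> x y < \<bar>x i - y i\<bar>)" for k x y
  have "\<exists>x y. P k x y" for k
  proof (rule ccontr)
    assume no: "\<not> ?thesis"
    have "thesis"
    proof (rule that[of "1 / real (Suc k)" "real (Suc k)"], simp, simp, intro ballI impI allI, rule ccontr)
      fix x y i
      assume "x \<in> X" "y \<in> X" "(\<forall>i<n. \<bar>x i - p i\<bar> < 1 / real (Suc k)) \<and> (\<forall>i<n. \<bar>y i - p i\<bar> < 1 / real (Suc k))"
        "i < n" "\<not> \<bar>x i - y i\<bar> \<le> real (Suc k) * ?\<sigma> x y"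
      then have "P k x y" unfolding P_def not_le by blast
      then show False using no by blast
    qed
    then show False using none by blast
  qed
  then obtain x y where "\<And>k. P k (x k) (y k)" by metis
  then have xy: "\<And>k. x k \<in> X \<and> y k \<in> X" "\<And>k. \<forall>i<n. \<bar>x k i - p i\<bar> < 1 / real (Suc k)"
    "\<And>k. \<forall>i<n. \<bar>y k i - p i\<bar> < 1 / real (Suc k)" "\<And>k. \<exists>i<n. real (Suc k) * ?\<sigma> (x k) (y k) < \<bar>x k i - y k i\<bar>"
    unfolding P_def by blast+
  \<comment> \<open>The sum norm of the difference; dividing by it gives secants of norm exactly
    1.\<close>
  define t where "t k = (\<Sum>i<n. \<bar>x k i - y k i\<bar>)" for k
  have le: "\<bar>x k i - y k i\<bar> \<le> t k" if "i < n" for i k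
    unfolding t_def using that by (intro member_le_sum) auto
  have \<sigma>: "real (Suc k) * ?\<sigma> (x k) (y k) < t k" for k
  proof -
    obtain i where "i < n" "real (Suc k) * ?\<sigma> (x k) (y k) < \<bar>x k i - y k i\<bar>" using xy(4) by blast
    then show ?thesis using le[of i k] by linarith
  qed
  have tpos: "t k > 0" for k
  proof -
    have "0 \<le> real (Suc k) * ?\<sigma> (x k) (y k)" by (intro mult_nonneg_nonneg sum_nonneg) auto
    then show ?thesis using \<sigma>[of k] by linarith
  qed
  have null: "(\<lambda>k. 1 / real (Suc k)) \<longlonglongrightarrow> 0" by (rule LIMSEQ_inverse_real_of_nat[unfolded inverse_eq_divide])
  have lim: "\<forall>i<n. (\<lambda>k. f k i) \<longlonglongrightarrow> p i" if "\<And>k. \<forall>i<n. \<bar>f k i - p i\<bar> < 1 / real (Suc k)" for f :: "nat \<Rightarrow> nat \<Rightarrow> real"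
  proof (intro allI impI)
    fix i assume i: "i < n"
    have "\<forall>\<^sub>F k in sequentially. norm (f k i - p i) \<le> 1 / real (Suc k)"
      using that i by (intro always_eventually allI) (simp add: less_imp_le)
    then have "(\<lambda>k. f k i - p i) \<longlonglongrightarrow> 0" by (rule Lim_null_comparison[OF _ null])
    then show "(\<lambda>k. f k i) \<longlonglongrightarrow> p i" by (rule LIM_zero_cancel)
  qed
  have "\<forall>k. x k \<in> X \<and> y k \<in> X \<and> t k > 0" using xy(1) tpos by blast
  moreover have "\<forall>k. \<forall>i<n. \<bar>x k i - y k i\<bar> \<le> 1 * t k" using le by simp
  ultimately obtain v r where v: "v \<in> C5 n X p" "strict_mono (r :: nat \<Rightarrow> nat)"
    "\<forall>i<n. (\<lambda>k. (x (r k) i - y (r k) i) / t (r k)) \<longlonglongrightarrow> v i"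
    using lim[OF xy(2)] lim[OF xy(3)] by (elim C5_limit[OF X p])
  have "shear n d a v l = 0" if l: "l < d" for l
  proof -
    have 1: "(\<lambda>k. (shear n d a (x (r k)) l - shear n d a (y (r k)) l) / t (r k)) \<longlonglongrightarrow> shear n d a v l"
      by (rule shear_quotient_tendsto[OF v(3) dn l])
    have "(\<lambda>k. 1 / real (Suc (r k))) \<longlonglongrightarrow> 0"
      using LIMSEQ_subseq_LIMSEQ[OF null v(2)] by (simp add: o_def)
    moreover have "\<forall>\<^sub>F k in sequentially. norm ((shear n d a (x (r k)) l - shear n d a (y (r k)) l) / t (r k)) \<le> 1 / real (Suc (r k))"
    proof (intro always_eventually allI)
      fix k
      have "\<bar>shear n d a (x (r k)) l - shear n d a (y (r k)) l\<bar> \<le> ?\<sigma> (x (r k)) (y (r k))"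
        using l by (intro member_le_sum) auto
      from mult_left_mono[OF this, of "real (Suc (r k))"]
      have "real (Suc (r k)) * \<bar>shear n d a (x (r k)) l - shear n d a (y (r k)) l\<bar> \<le> t (r k)"
        using \<sigma>[of "r k"] by linarith
      moreover have "D / s \<le> 1 / q" if "0 < s" "0 < q" "q * D \<le> s" for D s q :: real
        using that by (simp add: field_simps)
      ultimately have "\<bar>shear n d a (x (r k)) l - shear n d a (y (r k)) l\<bar> / t (r k) \<le> 1 / real (Suc (r k))"
        using tpos[of "r k"] of_nat_0_less_iff[of "Suc (r k)"] by blast
      then show "norm ((shear n d a (x (r k)) l - shear n d a (y (r k)) l) / t (r k)) \<le> 1 / real (Suc (r k))"
        using tpos[of "r k"] by (simp only: real_norm_def abs_divide abs_of_pos)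
    qed
    ultimately have "(\<lambda>k. (shear n d a (x (r k)) l - shear n d a (y (r k)) l) / t (r k)) \<longlonglongrightarrow> 0"
      by (rule Lim_null_comparison[rotated])
    then show ?thesis using 1 LIMSEQ_unique by blast
  qed
  then have v0: "\<forall>i<n. v i = 0" using trans v(1) by (simp add: shear_def)
  \<comment> \<open>The norm of the secants passes to the limit, so it would be both 1 and
    0.\<close>
  have "(\<lambda>k. \<Sum>i<n. \<bar>(x (r k) i - y (r k) i) / t (r k)\<bar>) \<longlonglongrightarrow> (\<Sum>i<n. \<bar>v i\<bar>)"
    using v(3) by (intro tendsto_sum tendsto_rabs) auto
  moreover have "(\<Sum>i<n. \<bar>(x (r k) i - y (r k) i) / t (r k)\<bar>) = 1" for k
  proof -
    have "(\<Sum>i<n. \<bar>(x (r k) i - y (r k) i) / t (r k)\<bar>) = (\<Sum>i<n. \<bar>x (r k) i - y (r k) i\<bar>) / t (r k)"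
      using tpos[of "r k"] by (simp add: sum_divide_distrib)
    then show ?thesis using tpos[of "r k"] by (simp add: t_def)
  qed
  ultimately have "(\<lambda>k::nat. 1) \<longlonglongrightarrow> (0::real)" using v0 by simp
  then show False using LIMSEQ_unique[OF tendsto_const] by fastforce
qed

section \<open>Difference quotients of the graph map\<close>

definition pt :: "nat \<Rightarrow> (nat \<Rightarrow> real) \<Rightarrow> real \<Rightarrow> (nat \<Rightarrow> real) \<Rightarrow> nat \<Rightarrow> real"
  where "pt d u t w = vecn d (\<lambda>l. u l + t * w l)"

lemma pt_in_Rn [simp]: "pt d u t w \<in> Rn d"
  by (simp add: pt_def)

lemma pt_zero: "u \<in> Rn d \<Longrightarrow> pt d u 0 w = u"
  by (simp add: pt_def vecn_Rn)

lemma pt_back: "u \<in> Rn d \<Longrightarrow> pt d (pt d u t w) (- t) w = u"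
  by (rule Rn_ext[of _ d]) (simp_all add: pt_def)

text \<open>\<open>G\<close> inverts \<open>shear\<close> on a piece of \<open>X\<close>, which
  makes that piece a graph over a slanted projection. The bound on cells in the cone is required
  over all of \<open>B\<close>, since derivatives are wanted at all of its points.\<close>

locale skew_graph = o_minimal_structure +
  fixes n d :: nat and X :: "(nat \<Rightarrow> real) set" and a :: "nat \<Rightarrow> nat \<Rightarrow> real"
    and B :: "(nat \<Rightarrow> real) set" and G :: "(nat \<Rightarrow> real) \<Rightarrow> nat \<Rightarrow> real" and M :: real
  assumes dn: "d \<le> n" and XS: "X \<in> S n" and B: "openin (Euclidean_space d) B"
    and GX: "u \<in> B \<Longrightarrow> G u \<in> X" and shear_G: "u \<in> B \<Longrightarrow> shear n d a (G u) = u"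
    and lip: "u \<in> B \<Longrightarrow> u' \<in> B \<Longrightarrow> i < n \<Longrightarrow> \<bar>G u i - G u' i\<bar> \<le> M * (\<Sum>l<d. \<bar>u l - u' l\<bar>)"
    and M: "M > 0"
    and small: "u \<in> B \<Longrightarrow> cell S n k C \<Longrightarrow> C \<subseteq> C5 n X (G u) \<Longrightarrow> k \<le> d"
begin

lemma X_Rn: "X \<subseteq> Rn n"
  by (rule subset_Rn[OF XS])

lemma B_Rn: "B \<subseteq> Rn d"
  using B openin_subset by blast

definition Q :: "(nat \<Rightarrow> real) \<Rightarrow> nat \<Rightarrow> (nat \<Rightarrow> real) \<Rightarrow> real \<Rightarrow> real"
  where "Q w j u t = (G (pt d u t w) j - G u j) / t"

lemma G_continuous: "j < n \<Longrightarrow> continuous_on B (\<lambda>u. G u j)"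
  unfolding continuous_on_Rn_iff[OF B_Rn]
proof (intro ballI allI impI)
  fix u and e :: real assume j: "j < n" and u: "u \<in> B" and e: "0 < e"
  \<comment> \<open>The sum over \<open>d\<close> coordinates contributes the factor
    \<open>d\<close>; \<open>d + 1\<close> gives a strict estimate and avoids division by 0 when
    \<open>d = 0\<close>.\<close>
  let ?\<delta> = "e / (M * (real d + 1))"
  have \<delta>: "?\<delta> > 0" using e M by simp
  have "\<bar>G y j - G u j\<bar> < e" if y: "y \<in> B" "\<forall>i<d. \<bar>y i - u i\<bar> < ?\<delta>" for y
  proof -
    have "(\<Sum>l<d. \<bar>y l - u l\<bar>) \<le> (\<Sum>l<d. ?\<delta>)" using y(2) by (intro sum_mono) (simp add: less_imp_le)
    also have "\<dots> = real d * ?\<delta>" by simp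
    also have "\<dots> < (real d + 1) * ?\<delta>" using \<delta> by (intro mult_strict_right_mono) auto
    finally have "M * (\<Sum>l<d. \<bar>y l - u l\<bar>) < M * ((real d + 1) * ?\<delta>)"
      using M by (rule mult_strict_left_mono)
    moreover have "M * (D * (e / (M * D))) = e" if "D \<noteq> 0" for D using M that by simp
    from this[of "real d + 1"] have "M * ((real d + 1) * ?\<delta>) = e" by linarith
    ultimately have "M * (\<Sum>l<d. \<bar>y l - u l\<bar>) < e" by (simp only:)
    then show ?thesis using lip[OF y(1) u j] by linarith
  qed
  then show "\<exists>\<delta>>0. \<forall>y\<in>B. (\<forall>i<d. \<bar>y i - u i\<bar> < \<delta>) \<longrightarrow> \<bar>G y j - G u j\<bar> < e"
    using \<delta> by (intro exI[of _ ?\<delta>]) blast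
qed

lemma Q_bound:
  assumes "u \<in> B" "pt d u t w \<in> B" "t > 0" "j < n"
  shows "\<bar>Q w j u t\<bar> \<le> M * (\<Sum>l<d. \<bar>w l\<bar>)"
proof -
  have "\<bar>G (pt d u t w) j - G u j\<bar> \<le> M * (\<Sum>l<d. \<bar>pt d u t w l - u l\<bar>)"
    by (rule lip[OF assms(2,1,4)])
  also have "(\<Sum>l<d. \<bar>pt d u t w l - u l\<bar>) = t * (\<Sum>l<d. \<bar>w l\<bar>)"
    using assms(3) by (simp add: pt_def abs_mult sum_distrib_left)
  finally show ?thesis using assms(3) by (simp add: Q_def field_simps)
qed

text \<open>Base point and step are kept while the direction changes, and the bound does not depend
  on the step; this carries extreme values of the quotients over to nearby directions.\<close>

lemma Q_direction:
  assumes "pt d u t w \<in> B" "pt d u t w' \<in> B" "t > 0" "j < n"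
  shows "\<bar>Q w j u t - Q w' j u t\<bar> \<le> M * (\<Sum>l<d. \<bar>w l - w' l\<bar>)"
proof -
  have "\<bar>G (pt d u t w) j - G (pt d u t w') j\<bar> \<le> M * (\<Sum>l<d. \<bar>pt d u t w l - pt d u t w' l\<bar>)"
    by (rule lip[OF assms(1,2,4)])
  also have "(\<Sum>l<d. \<bar>pt d u t w l - pt d u t w' l\<bar>) = t * (\<Sum>l<d. \<bar>w l - w' l\<bar>)"
  proof -
    have "\<bar>pt d u t w l - pt d u t w' l\<bar> = t * \<bar>w l - w' l\<bar>" if "l < d" for l
    proof -
      have "pt d u t w l - pt d u t w' l = t * (w l - w' l)" using that by (simp add: pt_def algebra_simps)
      then show ?thesis using assms(3) by (simp add: abs_mult)
    qed
    then show ?thesis by (simp add: sum_distrib_left)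
  qed
  finally have "\<bar>G (pt d u t w) j - G (pt d u t w') j\<bar> \<le> (M * (\<Sum>l<d. \<bar>w l - w' l\<bar>)) * t"
    by (simp add: mult_ac)
  then have "\<bar>G (pt d u t w) j - G (pt d u t w') j\<bar> / t \<le> M * (\<Sum>l<d. \<bar>w l - w' l\<bar>)"
    using assms(3) by (simp only: pos_divide_le_eq)
  moreover have "\<bar>Q w j u t - Q w' j u t\<bar> = \<bar>G (pt d u t w) j - G (pt d u t w') j\<bar> / t"
    using assms(3) by (simp add: Q_def flip: diff_divide_distrib)
  ultimately show ?thesis by simp
qed

text \<open>The quotients are components of secants of \<open>X\<close>, bounded by the Lipschitz
  condition, so a limit exists in the cone. A value \<open>c\<close> taken arbitrarily close to
  \<open>u0\<close> in direction \<open>w\<close> thus makes the pair \<open>(w, c)\<close> the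
  image of a cone vector under \<open>shear\<close> and coordinate \<open>j\<close>.\<close>

lemma C5_point:
  assumes u0: "u0 \<in> B" and j: "j < n" and \<delta>: "\<delta> \<longlonglongrightarrow> 0"
    and u: "\<And>k. u k \<in> B \<and> pt d (u k) (t k) w \<in> B \<and> 0 < t k \<and> t k < \<delta> k \<and> (\<forall>l<d. \<bar>u k l - u0 l\<bar> < \<delta> k)"
    and c: "\<And>k. Q w j (u k) (t k) = c"
  shows "\<exists>v\<in>C5 n X (G u0). (\<forall>i<d. shear n d a v i = w i) \<and> v j = c"
proof -
  have pR: "G u0 \<in> Rn n" using GX[OF u0] X_Rn by blast
  let ?x = "\<lambda>k. G (pt d (u k) (t k) w)" and ?y = "\<lambda>k. G (u k)"
  let ?W = "\<Sum>l<d. \<bar>w l\<bar>"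
  \<comment> \<open>One bound for both sequences: base points are within
    \<open>real d * \<delta> k\<close> in the sum norm, and the step adds at most
    \<open>?W * \<delta> k\<close>.\<close>
  have lim: "(\<lambda>k. G (z k) i) \<longlonglongrightarrow> G u0 i" if i: "i < n" and
    z: "\<And>k. z k \<in> B \<and> (\<Sum>l<d. \<bar>z k l - u0 l\<bar>) \<le> (real d + ?W) * \<delta> k" for z i
  proof -
    have "\<forall>\<^sub>F k in sequentially. norm (G (z k) i - G u0 i) \<le> M * ((real d + ?W) * \<delta> k)"
    proof (intro always_eventually allI)
      fix k
      have "\<bar>G (z k) i - G u0 i\<bar> \<le> M * (\<Sum>l<d. \<bar>z k l - u0 l\<bar>)" using z by (intro lip u0 i) blast
      also have "\<dots> \<le> M * ((real d + ?W) * \<delta> k)" using z M by (intro mult_left_mono) auto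
      finally show "norm (G (z k) i - G u0 i) \<le> M * ((real d + ?W) * \<delta> k)" by simp
    qed
    moreover have "(\<lambda>k. M * ((real d + ?W) * \<delta> k)) \<longlonglongrightarrow> 0"
      using tendsto_mult_left[OF tendsto_mult_left[OF \<delta>], of M "real d + ?W"] by simp
    ultimately have "(\<lambda>k. G (z k) i - G u0 i) \<longlonglongrightarrow> 0" by (rule Lim_null_comparison)
    then show ?thesis by (rule LIM_zero_cancel)
  qed
  have W0: "?W \<ge> 0" by (simp add: sum_nonneg)
  have \<delta>0: "\<delta> k > 0" for k using u[of k] by linarith
  have s1: "(\<Sum>l<d. \<bar>u k l - u0 l\<bar>) \<le> real d * \<delta> k" for k
  proof -
    have "(\<Sum>l<d. \<bar>u k l - u0 l\<bar>) \<le> (\<Sum>l<d. \<delta> k)" using u[of k] by (intro sum_mono) (simp add: less_imp_le)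
    then show ?thesis by simp
  qed
  have "(\<Sum>l<d. \<bar>pt d (u k) (t k) w l - u0 l\<bar>) \<le> (real d + ?W) * \<delta> k" for k
  proof -
    have "(\<Sum>l<d. \<bar>pt d (u k) (t k) w l - u0 l\<bar>) \<le> (\<Sum>l<d. \<bar>u k l - u0 l\<bar> + \<delta> k * \<bar>w l\<bar>)"
    proof (rule sum_mono)
      fix l assume "l \<in> {..<d}"
      then have "pt d (u k) (t k) w l - u0 l = (u k l - u0 l) + t k * w l" by (simp add: pt_def)
      then have "\<bar>pt d (u k) (t k) w l - u0 l\<bar> \<le> \<bar>u k l - u0 l\<bar> + \<bar>t k * w l\<bar>"
        by (simp only: abs_triangle_ineq)
      moreover have "\<bar>t k * w l\<bar> \<le> \<delta> k * \<bar>w l\<bar>"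
        using u[of k] by (simp add: abs_mult mult_right_mono)
      ultimately show "\<bar>pt d (u k) (t k) w l - u0 l\<bar> \<le> \<bar>u k l - u0 l\<bar> + \<delta> k * \<bar>w l\<bar>" by linarith
    qed
    also have "\<dots> = (\<Sum>l<d. \<bar>u k l - u0 l\<bar>) + \<delta> k * ?W"
      by (simp add: sum.distrib sum_distrib_left)
    finally show ?thesis using s1[of k] by (simp add: algebra_simps)
  qed
  then have lx: "\<forall>i<n. (\<lambda>k. ?x k i) \<longlonglongrightarrow> G u0 i" using u by (intro allI impI lim) auto
  have "(\<Sum>l<d. \<bar>u k l - u0 l\<bar>) \<le> (real d + ?W) * \<delta> k" for k
  proof -
    have "0 \<le> ?W * \<delta> k" using W0 \<delta>0[of k] by (intro mult_nonneg_nonneg) auto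
    then show ?thesis using s1[of k] unfolding distrib_right by linarith
  qed
  then have ly: "\<forall>i<n. (\<lambda>k. ?y k i) \<longlonglongrightarrow> G u0 i" using u by (intro allI impI lim) auto
  have xy: "\<forall>k. ?x k \<in> X \<and> ?y k \<in> X \<and> t k > 0" using u GX by blast
  have "\<forall>k. \<forall>i<n. \<bar>?x k i - ?y k i\<bar> \<le> (M * ?W) * t k"
  proof (intro allI impI)
    fix k i assume i: "i < n"
    have t: "t k > 0" using u by blast
    have "\<bar>Q w i (u k) (t k)\<bar> \<le> M * ?W" using u by (intro Q_bound i) auto
    moreover have "\<bar>?x k i - ?y k i\<bar> = \<bar>Q w i (u k) (t k)\<bar> * t k"
      using t by (simp add: Q_def)
    ultimately show "\<bar>?x k i - ?y k i\<bar> \<le> (M * ?W) * t k" using t by simp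
  qed
  then obtain v r where v: "v \<in> C5 n X (G u0)" "strict_mono (r :: nat \<Rightarrow> nat)"
    "\<forall>i<n. (\<lambda>k. (?x (r k) i - ?y (r k) i) / t (r k)) \<longlonglongrightarrow> v i"
    using xy lx ly by (elim C5_limit[OF X_Rn pR])
  \<comment> \<open>Since \<open>shear\<close> is linear and inverts \<open>G\<close>, every secant
    is mapped to \<open>w\<close> itself, not merely close to it.\<close>
  have "shear n d a v i = w i" if i: "i < d" for i
  proof -
    have "(\<lambda>k. (shear n d a (?x (r k)) i - shear n d a (?y (r k)) i) / t (r k)) \<longlonglongrightarrow> shear n d a v i"
      by (rule shear_quotient_tendsto[OF v(3) dn i])
    moreover have "(shear n d a (?x (r k)) i - shear n d a (?y (r k)) i) / t (r k) = w i" for k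
      using u[of "r k"] i by (simp add: shear_G) (simp add: pt_def)
    ultimately have "(\<lambda>k. w i) \<longlonglongrightarrow> shear n d a v i" by simp
    then show ?thesis using LIMSEQ_unique[OF tendsto_const] by metis
  qed
  moreover have "v j = c"
  proof -
    have "(\<lambda>k. (?x (r k) j - ?y (r k) j) / t (r k)) \<longlonglongrightarrow> v j" using v(3) j by blast
    moreover have "(?x (r k) j - ?y (r k) j) / t (r k) = c" for k using c[of "r k"] by (simp add: Q_def)
    ultimately have "(\<lambda>k. c) \<longlonglongrightarrow> v j" by simp
    then show ?thesis using LIMSEQ_unique[OF tendsto_const] by metis
  qed
  ultimately show ?thesis using v(1) by blast
qed

end

lemma pt_near:
  assumes "\<forall>l<d. \<bar>u l - u0 l\<bar> < e" "\<bar>t\<bar> < e" "\<forall>l<d. \<bar>w l\<bar> \<le> W" "l < d"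
  shows "\<bar>pt d u t w l - u0 l\<bar> < e * (1 + W)"
proof -
  have 1: "\<bar>u l - u0 l\<bar> < e" using assms(1,4) by blast
  have "\<bar>t\<bar> * \<bar>w l\<bar> \<le> e * W" using assms(2-4) by (intro mult_mono) auto
  then have 2: "\<bar>t * w l\<bar> \<le> e * W" by (simp add: abs_mult)
  have "pt d u t w l - u0 l = (u l - u0 l) + t * w l" using assms(4) by (simp add: pt_def)
  then have "\<bar>pt d u t w l - u0 l\<bar> < e + e * W" using 1 2 by linarith
  then show ?thesis by (simp add: algebra_simps)
qed

context skew_graph
begin

text \<open>The admissible pairs of base point and step form a convex set with positive steps. On
  the segment between two of them the quotient is continuous, so the intermediate value theorem
  applies.\<close>

lemma Q_segment_value:
  assumes U: "\<And>u t. near u t \<Longrightarrow> u \<in> B \<and> pt d u t w \<in> B \<and> 0 < t"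
    and conv: "\<And>u t u' t' s. near u t \<Longrightarrow> near u' t' \<Longrightarrow> 0 \<le> s \<Longrightarrow> s \<le> 1 \<Longrightarrow>
      near (vecn d (\<lambda>l. (1 - s) * u l + s * u' l)) ((1 - s) * t + s * t')"
    and j: "j < n" and ut: "near u t" "near u' t'" and c: "Q w j u t \<le> c" "c \<le> Q w j u' t'"
  shows "\<exists>u t. near u t \<and> Q w j u t = c"
proof -
  let ?u = "\<lambda>s. vecn d (\<lambda>l. (1 - s) * u l + s * u' l)" and ?t = "\<lambda>s. (1 - s) * t + s * t'"
  have near: "near (?u s) (?t s)" if "s \<in> {0..1}" for s using conv[OF ut] that by simp
  have cu: "continuous_on {0..1} ?u"
    by (rule continuous_on_vecn) (intro continuous_intros)
  have "continuous_on {0..1} (\<lambda>s. pt d (?u s) (?t s) w)"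
  proof -
    have "pt d (?u s) (?t s) w = vecn d (\<lambda>l. ((1 - s) * u l + s * u' l) + ?t s * w l)" for s
      by (simp add: pt_def cong: vecn_cong)
    moreover have "continuous_on {0..1} (\<lambda>s. vecn d (\<lambda>l. ((1 - s) * u l + s * u' l) + ?t s * w l))"
      by (rule continuous_on_vecn) (intro continuous_intros)
    ultimately show ?thesis by simp
  qed
  then have c1: "continuous_on {0..1} (\<lambda>s. G (pt d (?u s) (?t s) w) j)"
    by (rule continuous_on_compose2[OF G_continuous[OF j]]) (use U near in blast)
  have c2: "continuous_on {0..1} (\<lambda>s. G (?u s) j)"
    by (rule continuous_on_compose2[OF G_continuous[OF j] cu]) (use U near in blast)
  have "continuous_on {0..1} (\<lambda>s. Q w j (?u s) (?t s))"
    unfolding Q_def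
  proof (intro continuous_on_divide continuous_on_diff c1 c2)
    show "continuous_on {0..1} ?t" by (intro continuous_intros)
    show "\<forall>s\<in>{0..1}. ?t s \<noteq> 0" using U near by fastforce
  qed
  moreover have "u \<in> Rn d" "u' \<in> Rn d" using U ut B_Rn by blast+
  then have "?u 0 = u" "?u 1 = u'" by (simp_all add: vecn_Rn)
  ultimately have "\<exists>s. 0 \<le> s \<and> s \<le> 1 \<and> Q w j (?u s) (?t s) = c"
    using c by (intro IVT') auto
  then obtain s where "s \<in> {0..1}" "Q w j (?u s) (?t s) = c" by auto
  then show ?thesis using near by blast
qed

text \<open>Failure gives, arbitrarily close to \<open>u0\<close>, two quotients that differ by at
  least \<open>e\<close>. All values between them are attained, for all directions close to
  \<open>w\<close>, so \<open>shear\<close> together with coordinate \<open>j\<close> maps the cone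
  onto a set containing a box of dimension \<open>d + 1\<close>, against
  \<open>small\<close>.\<close>

lemma Q_cauchy:
  assumes u0: "u0 \<in> B" and j: "j < n" and e: "e > 0"
  obtains \<delta> where "\<delta> > 0" "\<forall>u\<in>Rn d. \<forall>u'\<in>Rn d. \<forall>t t'. (\<forall>l<d. \<bar>u l - u0 l\<bar> < \<delta>) \<and> (\<forall>l<d. \<bar>u' l - u0 l\<bar> < \<delta>) \<and>
    0 < t \<and> t < \<delta> \<and> 0 < t' \<and> t' < \<delta> \<longrightarrow> \<bar>Q w j u t - Q w j u' t'\<bar> < e"
proof (rule ccontr)
  assume none: "\<not> thesis"
  obtain \<rho> where \<rho>: "\<rho> > 0" "\<forall>y\<in>Rn d. (\<forall>l<d. \<bar>y l - u0 l\<bar> < \<rho>) \<longrightarrow> y \<in> B"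
    by (rule openin_RnD[OF B u0])
  \<comment> \<open>The additional 1 leaves room for directions that differ from \<open>w\<close> by
    less than 1 in each coordinate.\<close>
  define W where "W = 1 + (\<Sum>l<d. \<bar>w l\<bar>)"
  have W1: "W \<ge> 1" by (simp add: W_def sum_nonneg)
  have wW: "\<bar>w l\<bar> \<le> W - 1" if "l < d" for l
    using member_le_sum[of l "{..<d}" "\<lambda>l. \<bar>w l\<bar>"] that by (simp add: W_def)
  \<comment> \<open>The factor \<open>1 + W\<close> keeps not only the base points but also the end
    points of the steps within \<open>\<rho>\<close> of \<open>u0\<close>, hence in
    \<open>B\<close>.\<close>
  define \<delta> where "\<delta> k = \<rho> / (1 + W) / real (Suc k)" for k
  have \<delta>0: "\<delta> k > 0" for k using \<rho>(1) W1 by (simp add: \<delta>_def)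
  have \<delta>le: "\<delta> k * (1 + W) \<le> \<rho>" for k
  proof -
    have "\<delta> k * (1 + W) = \<rho> / real (Suc k)" using W1 by (simp add: \<delta>_def)
    also have "\<dots> \<le> \<rho> / 1" using \<rho>(1) by (intro divide_left_mono) auto
    finally show ?thesis by simp
  qed
  have \<delta>lim: "\<delta> \<longlonglongrightarrow> 0"
    unfolding \<delta>_def using tendsto_mult_left[OF LIMSEQ_inverse_real_of_nat, of "\<rho> / (1 + W)"]
    by (simp add: divide_inverse)
  define near where "near k u t \<longleftrightarrow> u \<in> Rn d \<and> (\<forall>l<d. \<bar>u l - u0 l\<bar> < \<delta> k) \<and> 0 < t \<and> t < \<delta> k" for k u t
  have nearB: "u \<in> B \<and> pt d u t w' \<in> B \<and> 0 < t" if "near k u t" "\<forall>l<d. \<bar>w' l\<bar> \<le> W" for k u t w'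
  proof -
    have u: "u \<in> Rn d" "\<forall>l<d. \<bar>u l - u0 l\<bar> < \<delta> k" "0 < t" "\<bar>t\<bar> < \<delta> k" using that(1) by (auto simp: near_def)
    have "\<delta> k \<le> \<rho>"
    proof -
      have "\<delta> k * 1 \<le> \<delta> k * (1 + W)" using \<delta>0[of k] W1 by (intro mult_left_mono) auto
      then show ?thesis using \<delta>le[of k] by simp
    qed
    then have "\<forall>l<d. \<bar>u l - u0 l\<bar> < \<rho>" using u(2) by (meson less_le_trans)
    then have "u \<in> B" using \<rho>(2) u(1) by blast
    moreover have "\<forall>l<d. \<bar>pt d u t w' l - u0 l\<bar> < \<rho>"
      using pt_near[OF u(2,4) that(2)] \<delta>le[of k] by (meson less_le_trans)
    then have "pt d u t w' \<in> B" using \<rho>(2) by simp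
    ultimately show ?thesis using u(3) by blast
  qed
  have near_conv: "near k (vecn d (\<lambda>l. (1 - s) * u l + s * u' l)) ((1 - s) * t + s * t')"
    if "near k u t" "near k u' t'" "0 \<le> s" "s \<le> 1" for k u t u' t' s
  proof -
    have cv: "(1 - s) * x + s * y < z" if "x < z" "y < z" for x y z
      using convex_bound_lt[OF that, of "1 - s" s] \<open>0 \<le> s\<close> \<open>s \<le> 1\<close> by simp
    have cv': "z < (1 - s) * x + s * y" if "z < x" "z < y" for x y z
      using cv[of "- x" "- z" "- y"] that by simp
    have "\<bar>(1 - s) * u l + s * u' l - u0 l\<bar> < \<delta> k" if l: "l < d" for l
    proof -
      have *: "u l < u0 l + \<delta> k" "u' l < u0 l + \<delta> k" "u0 l - \<delta> k < u l" "u0 l - \<delta> k < u' l"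
        using that(1) \<open>near k u t\<close> \<open>near k u' t'\<close> by (auto simp: near_def abs_less_iff dest!: spec[of _ l])
      show ?thesis using cv[OF *(1,2)] cv'[OF *(3,4)] by (simp add: abs_less_iff)
    qed
    then show ?thesis using that(1,2) cv cv' by (simp add: near_def)
  qed
  \<comment> \<open>The pair is ordered so that the second quotient is the larger one; exchanging
    the two points covers the other case.\<close>
  define P where "P k u t u' t' \<longleftrightarrow> near k u t \<and> near k u' t' \<and> Q w j u t + e \<le> Q w j u' t'" for k u t u' t'
  have "\<exists>u t u' t'. P k u t u' t'" for k
  proof (rule ccontr)
    assume no: "\<not> ?thesis"
    have "thesis"
    proof (rule that[OF \<delta>0[of k]], intro ballI allI impI, rule ccontr)
      fix u u' t t'
      assume *: "u \<in> Rn d" "u' \<in> Rn d" "(\<forall>l<d. \<bar>u l - u0 l\<bar> < \<delta> k) \<and> (\<forall>l<d. \<bar>u' l - u0 l\<bar> < \<delta> k) \<and>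
        0 < t \<and> t < \<delta> k \<and> 0 < t' \<and> t' < \<delta> k" "\<not> \<bar>Q w j u t - Q w j u' t'\<bar> < e"
      then have "near k u t" "near k u' t'" by (auto simp: near_def)
      moreover have "Q w j u t + e \<le> Q w j u' t' \<or> Q w j u' t' + e \<le> Q w j u t" using *(4) by linarith
      ultimately have "P k u t u' t' \<or> P k u' t' u t" unfolding P_def by blast
      then show False using no by blast
    qed
    then show False using none by blast
  qed
  then obtain u t u' t' where P: "\<And>k. P k (u k) (t k) (u' k) (t' k)" by metis
  have nu: "near k (u k) (t k)" "near k (u' k) (t' k)" "Q w j (u k) (t k) + e \<le> Q w j (u' k) (t' k)" for k
    using P[of k] by (auto simp: P_def)
  have wW': "\<forall>l<d. \<bar>w l\<bar> \<le> W" using wW by fastforce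
  have "\<forall>k. Q w j (u k) (t k) \<in> {- (M * W)..M * W}"
  proof
    fix k
    have "\<bar>Q w j (u k) (t k)\<bar> \<le> M * (\<Sum>l<d. \<bar>w l\<bar>)"
      using nearB[OF nu(1) wW'] by (intro Q_bound j) auto
    also have "\<dots> \<le> M * W" using M by (intro mult_left_mono) (auto simp: W_def)
    finally show "Q w j (u k) (t k) \<in> {- (M * W)..M * W}" by (simp add: abs_le_iff)
  qed
  then obtain \<alpha> r where "\<alpha> \<in> {- (M * W)..M * W}" and
    r: "strict_mono (r :: nat \<Rightarrow> nat)" "((\<lambda>k. Q w j (u k) (t k)) \<circ> r) \<longlonglongrightarrow> \<alpha>"
    by (rule seq_compactE[OF compact_imp_seq_compact[OF compact_Icc]])
  have "e / 4 > 0" using e by simp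
  from tendstoD[OF r(2) this] have "\<forall>\<^sub>F k in sequentially. \<bar>Q w j (u (r k)) (t (r k)) - \<alpha>\<bar> < e / 4"
    by (simp add: dist_real_def)
  then obtain K where K: "\<And>k. k \<ge> K \<Longrightarrow> \<bar>Q w j (u (r k)) (t (r k)) - \<alpha>\<bar> < e / 4"
    unfolding eventually_sequentially by blast
  define m where "m k = r (k + K)" for k
  have mlim: "(\<lambda>k. \<delta> (m k)) \<longlonglongrightarrow> 0"
    using LIMSEQ_ignore_initial_segment[OF LIMSEQ_subseq_LIMSEQ[OF \<delta>lim r(1)], of K] by (simp add: o_def m_def)
  have Km: "\<bar>Q w j (u (m k)) (t (m k)) - \<alpha>\<bar> < e / 4" for k unfolding m_def by (rule K) simp
  \<comment> \<open>Chosen so that a change of direction by \<open>\<eta>\<close> in each coordinate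
    alters a quotient by at most \<open>e / 8\<close>; the bound 1 fits the room left in
    \<open>W\<close>.\<close>
  define \<eta> where "\<eta> = min 1 (e / (8 * M * (real d + 1)))"
  have \<eta>: "\<eta> > 0" "\<eta> \<le> 1" using e M by (simp_all add: \<eta>_def)
  have \<eta>M: "M * (real d * \<eta>) \<le> e / 8"
  proof -
    have "M * (real d * \<eta>) \<le> M * ((real d + 1) * (e / (8 * M * (real d + 1))))"
      using M e \<eta>(1) by (intro mult_left_mono mult_mono) (auto simp: \<eta>_def)
    also have "\<dots> = e / 8"
    proof -
      have "M * (D * (e / (8 * M * D))) = e / 8" if "D \<noteq> 0" for D using M that by simp
      from this[of "real d + 1"] show ?thesis by linarith
    qed
    finally show ?thesis .
  qed
  \<comment> \<open>The smaller quotients lie below \<open>\<alpha> + e / 4\<close>, the larger ones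
    above \<open>\<alpha> + 3 * e / 4\<close>; the change of direction costs \<open>e / 8\<close> on
    either side, which leaves this interval of length \<open>e / 4\<close>.\<close>
  define lo hi where "lo = \<alpha> + 3 * e / 8" and "hi = \<alpha> + 5 * e / 8"
  have pr: "proper (Suc d) (\<lambda>l. if l < d then w l - \<eta> else lo) (\<lambda>l. if l < d then w l + \<eta> else hi)"
    using \<eta> e by (auto simp: proper_def lo_def hi_def)
  define \<pi> where "\<pi> i v = (if i < d then v i - (\<Sum>l\<in>{d..<n}. a i l * v l) else v j)" for i and v :: "nat \<Rightarrow> real"
  have pR: "G u0 \<in> Rn n" using GX[OF u0] X_Rn by blast
  have "\<forall>y\<in>bx (Suc d) (\<lambda>l. if l < d then w l - \<eta> else lo) (\<lambda>l. if l < d then w l + \<eta> else hi).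
    \<exists>v\<in>C5 n X (G u0). \<forall>i<Suc d. \<pi> i v = y i"
  proof
    fix y assume y: "y \<in> bx (Suc d) (\<lambda>l. if l < d then w l - \<eta> else lo) (\<lambda>l. if l < d then w l + \<eta> else hi)"
    have yw: "\<bar>w l - y l\<bar> < \<eta>" if "l < d" for l
      using y that by (auto simp: bx_def abs_less_iff dest!: spec[of _ l])
    have yc: "lo < y d" "y d < hi" using y by (auto simp: bx_def dest!: spec[of _ d])
    have yW: "\<forall>l<d. \<bar>y l\<bar> \<le> W"
    proof (intro allI impI)
      fix l assume l: "l < d"
      show "\<bar>y l\<bar> \<le> W" using yw[OF l] wW[OF l] \<eta>(2) by linarith
    qed
    have dir: "\<bar>Q w j u t - Q y j u t\<bar> \<le> e / 8" if "near k u t" for k u t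
    proof -
      have "\<bar>Q w j u t - Q y j u t\<bar> \<le> M * (\<Sum>l<d. \<bar>w l - y l\<bar>)"
        using nearB[OF that wW'] nearB[OF that yW] by (intro Q_direction j) auto
      also have "\<dots> \<le> M * (\<Sum>l<d. \<eta>)" using yw M by (intro mult_left_mono sum_mono) (auto simp: less_imp_le)
      also have "\<dots> = M * (real d * \<eta>)" by simp
      finally show ?thesis using \<eta>M by linarith
    qed
    have "\<exists>x s. near (m k) x s \<and> Q y j x s = y d" for k
    proof (rule Q_segment_value[where near = "near (m k)", OF nearB[OF _ yW] near_conv j nu(1,2)])
      show "Q y j (u (m k)) (t (m k)) \<le> y d"
        using dir[OF nu(1)[of "m k"]] Km[of k] yc(1) unfolding lo_def by linarith
      show "y d \<le> Q y j (u' (m k)) (t' (m k))"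
        using dir[OF nu(2)[of "m k"]] Km[of k] yc(2) nu(3)[of "m k"] unfolding hi_def by linarith
    qed
    then obtain x s where xs: "\<And>k. near (m k) (x k) (s k)" "\<And>k. Q y j (x k) (s k) = y d" by metis
    have "\<exists>v\<in>C5 n X (G u0). (\<forall>i<d. shear n d a v i = y i) \<and> v j = y d"
    proof (rule C5_point[OF u0 j mlim])
      show "x k \<in> B \<and> pt d (x k) (s k) y \<in> B \<and> 0 < s k \<and> s k < \<delta> (m k) \<and> (\<forall>l<d. \<bar>x k l - u0 l\<bar> < \<delta> (m k))" for k
        using nearB[OF xs(1) yW, of k] xs(1)[of k] by (auto simp: near_def)
      show "Q y j (x k) (s k) = y d" for k by (rule xs(2))
    qed
    then obtain v where "v \<in> C5 n X (G u0)" "\<forall>i<d. shear n d a v i = y i" "v j = y d" by blast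
    then have "v \<in> C5 n X (G u0)" "\<forall>i<Suc d. \<pi> i v = y i"
      by (auto simp: \<pi>_def shear_def less_Suc_eq)
    then show "\<exists>v\<in>C5 n X (G u0). \<forall>i<Suc d. \<pi> i v = y i" by blast
  qed
  moreover have "\<forall>i<Suc d. polynomial_fun n (\<pi> i)"
  proof (intro allI impI)
    fix i assume "i < Suc d"
    show "polynomial_fun n (\<pi> i)"
    proof (cases "i < d")
      case True
      have "polynomial_fun n (\<lambda>v. v i - (\<Sum>l\<in>{d..<n}. a i l * v l))"
        using True dn by (intro polynomial_fun_diff polynomial_fun_sum polynomial_intros) auto
      then show ?thesis using True by (simp add: \<pi>_def[abs_def])
    next
      case False
      then show ?thesis using j by (simp add: \<pi>_def[abs_def] polynomial_intros)
    qed
  qed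
  ultimately have "\<exists>k C. Suc d \<le> k \<and> cell S n k C \<and> C \<subseteq> C5 n X (G u0)"
    using C5_definable[OF XS pR] closed_C5[OF X_Rn pR] pr by (intro projection_contains_box_imp_cell)
  then show False using small[OF u0] by fastforce
qed

text \<open>The quotients at \<open>u0\<close> form a Cauchy sequence, and its limit is approached
  uniformly over all nearby base points. This uniformity later gives continuity of the
  derivative.\<close>

lemma directional_derivative_uniform:
  assumes u0: "u0 \<in> B" and j: "j < n"
  shows "\<exists>L. \<forall>e>0. \<exists>\<delta>>0. \<forall>u\<in>Rn d. \<forall>t. (\<forall>l<d. \<bar>u l - u0 l\<bar> < \<delta>) \<and> t \<noteq> 0 \<and> \<bar>t\<bar> < \<delta> \<longrightarrow> \<bar>Q w j u t - L\<bar> \<le> e"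
proof -
  have uR: "u0 \<in> Rn d" using u0 B_Rn by blast
  define q where "q k = Q w j u0 (1 / real (Suc k))" for k
  have small_k: "\<exists>K. \<forall>k\<ge>K. 1 / real (Suc k) < \<delta>" if \<delta>: "\<delta> > 0" for \<delta>
  proof -
    obtain K where K: "1 / real (Suc K) < \<delta>" using nat_approx_posE[OF \<delta>] by blast
    have "1 / real (Suc k) \<le> 1 / real (Suc K)" if "k \<ge> K" for k
      using that by (intro divide_left_mono) auto
    then show ?thesis using K by (meson le_less_trans)
  qed
  have "Cauchy q"
    unfolding Cauchy_def
  proof (intro allI impI)
    fix e :: real assume e: "0 < e"
    obtain \<delta> where \<delta>: "\<delta> > 0" "\<forall>u\<in>Rn d. \<forall>u'\<in>Rn d. \<forall>t t'. (\<forall>l<d. \<bar>u l - u0 l\<bar> < \<delta>) \<and> (\<forall>l<d. \<bar>u' l - u0 l\<bar> < \<delta>) \<and>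
      0 < t \<and> t < \<delta> \<and> 0 < t' \<and> t' < \<delta> \<longrightarrow> \<bar>Q w j u t - Q w j u' t'\<bar> < e"
      by (rule Q_cauchy[OF u0 j e])
    obtain K where K: "\<forall>k\<ge>K. 1 / real (Suc k) < \<delta>" using small_k[OF \<delta>(1)] by blast
    have "dist (q k) (q k') < e" if "k \<ge> K" "k' \<ge> K" for k k'
      using bspec[OF bspec[OF \<delta>(2) uR] uR] K that \<delta>(1) by (simp add: q_def dist_real_def)
    then show "\<exists>K. \<forall>m\<ge>K. \<forall>n\<ge>K. dist (q m) (q n) < e" by blast
  qed
  then obtain L where L: "q \<longlonglongrightarrow> L" using Cauchy_convergent convergent_def by blast
  define W where "W = (\<Sum>l<d. \<bar>w l\<bar>)"
  have W0: "W \<ge> 0" by (simp add: W_def sum_nonneg)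
  have wW: "\<forall>l<d. \<bar>w l\<bar> \<le> W" unfolding W_def by (auto intro!: member_le_sum)
  have "\<exists>\<delta>>0. \<forall>u\<in>Rn d. \<forall>t. (\<forall>l<d. \<bar>u l - u0 l\<bar> < \<delta>) \<and> t \<noteq> 0 \<and> \<bar>t\<bar> < \<delta> \<longrightarrow> \<bar>Q w j u t - L\<bar> \<le> e"
    if e: "e > 0" for e
  proof -
    obtain \<delta> where \<delta>: "\<delta> > 0" "\<forall>u\<in>Rn d. \<forall>u'\<in>Rn d. \<forall>t t'. (\<forall>l<d. \<bar>u l - u0 l\<bar> < \<delta>) \<and> (\<forall>l<d. \<bar>u' l - u0 l\<bar> < \<delta>) \<and>
      0 < t \<and> t < \<delta> \<and> 0 < t' \<and> t' < \<delta> \<longrightarrow> \<bar>Q w j u t - Q w j u' t'\<bar> < e"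
      by (rule Q_cauchy[OF u0 j e])
    obtain K where K: "\<forall>k\<ge>K. 1 / real (Suc k) < \<delta>" using small_k[OF \<delta>(1)] by blast
    have pos: "\<bar>Q w j u t - L\<bar> \<le> e" if u: "u \<in> Rn d" "\<forall>l<d. \<bar>u l - u0 l\<bar> < \<delta>" and t: "0 < t" "t < \<delta>" for u t
    proof -
      have "(\<lambda>k. \<bar>Q w j u t - q k\<bar>) \<longlonglongrightarrow> \<bar>Q w j u t - L\<bar>" by (intro tendsto_intros L)
      moreover have "\<bar>Q w j u t - q k\<bar> \<le> e" if "k \<ge> K" for k
        using bspec[OF bspec[OF \<delta>(2) u(1)] uR] u(2) K that \<delta>(1) t by (simp add: q_def less_imp_le)
      ultimately show ?thesis by (intro LIMSEQ_le_const2) blast+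
    qed
    \<comment> \<open>Smaller by the factor \<open>1 + W\<close>, so that the base point moved along
      a negative step is still within \<open>\<delta>\<close>.\<close>
    define \<delta>' where "\<delta>' = \<delta> / (1 + W)"
    have \<delta>': "\<delta>' > 0" "\<delta>' * (1 + W) = \<delta>" "\<delta>' \<le> \<delta>"
      using \<delta>(1) W0 by (simp_all add: \<delta>'_def field_simps)
    have "\<bar>Q w j u t - L\<bar> \<le> e" if u: "u \<in> Rn d" "\<forall>l<d. \<bar>u l - u0 l\<bar> < \<delta>'" and t: "t \<noteq> 0" "\<bar>t\<bar> < \<delta>'" for u t
    proof (cases "t > 0")
      case True
      have "\<forall>l<d. \<bar>u l - u0 l\<bar> < \<delta>" using u(2) \<delta>'(3) by (meson less_le_trans)
      then show ?thesis using t True \<delta>'(3) by (intro pos u) auto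
    next
      case False
      \<comment> \<open>A negative step is a positive step back from its end point.\<close>
      have "Q w j u t = Q w j (pt d u t w) (- t)"
        using t(1) by (simp add: Q_def pt_back[OF u(1)] field_simps)
      moreover have "\<forall>l<d. \<bar>pt d u t w l - u0 l\<bar> < \<delta>"
        using pt_near[OF u(2) t(2) wW] \<delta>'(2) by simp
      ultimately show ?thesis using pos[of "pt d u t w" "- t"] t False \<delta>'(3) by simp
    qed
    then show ?thesis using \<delta>'(1) by blast
  qed
  then show ?thesis by blast
qed

section \<open>The directional derivatives\<close>

definition D :: "(nat \<Rightarrow> real) \<Rightarrow> nat \<Rightarrow> (nat \<Rightarrow> real) \<Rightarrow> real"
  where "D w j u0 = (SOME L. \<forall>e>0. \<exists>\<delta>>0. \<forall>u\<in>Rn d. \<forall>t. (\<forall>l<d. \<bar>u l - u0 l\<bar> < \<delta>) \<and> t \<noteq> 0 \<and> \<bar>t\<bar> < \<delta> \<longrightarrow>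
    \<bar>Q w j u t - L\<bar> \<le> e)"

lemma D_uniform:
  assumes "u0 \<in> B" "j < n" "e > 0"
  obtains \<delta> where "\<delta> > 0" "\<forall>u\<in>Rn d. \<forall>t. (\<forall>l<d. \<bar>u l - u0 l\<bar> < \<delta>) \<and> t \<noteq> 0 \<and> \<bar>t\<bar> < \<delta> \<longrightarrow> \<bar>Q w j u t - D w j u0\<bar> \<le> e"
  using someI_ex[OF directional_derivative_uniform[OF assms(1,2), of w]] assms(3) unfolding D_def[symmetric] by blast

lemma D_derivative:
  assumes u: "u \<in> B" and j: "j < n"
  shows "((\<lambda>t. G (pt d u t w) j) has_real_derivative D w j u) (at 0)"
  unfolding DERIV_def LIM_eq
proof (intro allI impI)
  fix e :: real assume "0 < e"
  then have e: "e / 2 > 0" by simp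
  have uR: "u \<in> Rn d" using u B_Rn by blast
  obtain \<delta> where \<delta>: "\<delta> > 0" "\<forall>z\<in>Rn d. \<forall>t. (\<forall>l<d. \<bar>z l - u l\<bar> < \<delta>) \<and> t \<noteq> 0 \<and> \<bar>t\<bar> < \<delta> \<longrightarrow> \<bar>Q w j z t - D w j u\<bar> \<le> e / 2"
    by (rule D_uniform[OF u j e])
  have "norm ((G (pt d u (0 + t) w) j - G (pt d u 0 w) j) / t - D w j u) < e" if "t \<noteq> 0" "\<bar>t\<bar> < \<delta>" for t
    using bspec[OF \<delta>(2) uR] that \<delta>(1) e by (fastforce simp: Q_def pt_zero[OF uR])
  then show "\<exists>s>0. \<forall>x. x \<noteq> 0 \<and> norm (x - 0) < s \<longrightarrow>
      norm ((G (pt d u (0 + x) w) j - G (pt d u 0 w) j) / x - D w j u) < e"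
    using \<delta>(1) by (intro exI[of _ \<delta>]) simp
qed

text \<open>A quotient at \<open>u\<close> with one sufficiently short step is close both to the
  derivative at \<open>u\<close> and, by uniformity in the base point, to the derivative at
  \<open>u0\<close>.\<close>

lemma D_continuous:
  assumes j: "j < n"
  shows "continuous_on B (D w j)"
  unfolding continuous_on_Rn_iff[OF B_Rn]
proof (intro ballI allI impI)
  fix u0 and e :: real assume u0: "u0 \<in> B" and "0 < e"
  then have e: "e / 3 > 0" by simp
  obtain \<delta> where \<delta>: "\<delta> > 0" "\<forall>z\<in>Rn d. \<forall>t. (\<forall>l<d. \<bar>z l - u0 l\<bar> < \<delta>) \<and> t \<noteq> 0 \<and> \<bar>t\<bar> < \<delta> \<longrightarrow> \<bar>Q w j z t - D w j u0\<bar> \<le> e / 3"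
    by (rule D_uniform[OF u0 j e])
  have "\<bar>D w j u - D w j u0\<bar> < e" if u: "u \<in> B" "\<forall>l<d. \<bar>u l - u0 l\<bar> < \<delta>" for u
  proof -
    have uR: "u \<in> Rn d" using u(1) B_Rn by blast
    obtain \<epsilon> where \<epsilon>: "\<epsilon> > 0" "\<forall>z\<in>Rn d. \<forall>t. (\<forall>l<d. \<bar>z l - u l\<bar> < \<epsilon>) \<and> t \<noteq> 0 \<and> \<bar>t\<bar> < \<epsilon> \<longrightarrow> \<bar>Q w j z t - D w j u\<bar> \<le> e / 3"
      by (rule D_uniform[OF u(1) j e])
    let ?t = "min \<delta> \<epsilon> / 2"
    have t: "?t \<noteq> 0" "\<bar>?t\<bar> < \<delta>" "\<bar>?t\<bar> < \<epsilon>" using \<delta>(1) \<epsilon>(1) by auto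
    have "\<bar>Q w j u ?t - D w j u0\<bar> \<le> e / 3" using bspec[OF \<delta>(2) uR] u(2) t by blast
    moreover have "\<bar>Q w j u ?t - D w j u\<bar> \<le> e / 3" using bspec[OF \<epsilon>(2) uR] \<epsilon>(1) t by simp
    ultimately show ?thesis using e by linarith
  qed
  then show "\<exists>d'>0. \<forall>y\<in>B. (\<forall>i<d. \<bar>y i - u0 i\<bar> < d') \<longrightarrow> \<bar>D w j y - D w j u0\<bar> < e"
    using \<delta>(1) by blast
qed

end

section \<open>From the cone to smoothness\<close>

lemma openin_preimage_Rn:
  assumes "openin (Euclidean_space n) Y" "continuous_on Y f" "\<forall>y\<in>Y. f y \<in> Rn m" "openin (Euclidean_space m) W"
  shows "openin (Euclidean_space n) {y \<in> Y. f y \<in> W}"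
proof -
  obtain TY where TY: "open TY" "Y = Rn n \<inter> TY" using assms(1) unfolding openin_Rn_open by blast
  obtain TW where TW: "open TW" "W = Rn m \<inter> TW" using assms(4) unfolding openin_Rn_open by blast
  have "openin (top_of_set Y) (Y \<inter> f -` TW)" by (rule continuous_openin_preimage_gen[OF assms(2) TW(1)])
  then obtain T where T: "open T" "Y \<inter> f -` TW = Y \<inter> T" unfolding openin_open by blast
  have "{y \<in> Y. f y \<in> W} = Y \<inter> f -` TW" using assms(3) TW(2) by auto
  also have "\<dots> = Rn n \<inter> (TY \<inter> T)" using T(2) TY(2) by auto
  finally show ?thesis unfolding openin_Rn_open using TY(1) T(1) by blast
qed

section \<open>Calculus with C1 functions\<close>

lemma C1_realI:
  assumes "U \<subseteq> Rn n" "\<And>i. i < n \<Longrightarrow> continuous_on U (D i)"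
    "\<And>i x. i < n \<Longrightarrow> x \<in> U \<Longrightarrow> ((\<lambda>t. f (x(i := t))) has_real_derivative D i x) (at (x i))"
  shows "C1_real n U f"
  unfolding C1_real_def continuous_map_real_iff[OF assms(1)] using assms(2,3) by blast

lemma C1_realE:
  assumes "C1_real n U f" "U \<subseteq> Rn n"
  obtains D where "\<forall>i<n. continuous_on U (D i)"
    "\<forall>i<n. \<forall>x\<in>U. ((\<lambda>t. f (x(i := t))) has_real_derivative D i x) (at (x i))"
proof -
  have "\<forall>i. \<exists>D. i < n \<longrightarrow> continuous_on U D \<and> (\<forall>x\<in>U. ((\<lambda>t. f (x(i := t))) has_real_derivative D x) (at (x i)))"
    using assms(1) unfolding C1_real_def continuous_map_real_iff[OF assms(2)] by blast
  then obtain D where "\<forall>i. i < n \<longrightarrow> continuous_on U (D i) \<and> (\<forall>x\<in>U. ((\<lambda>t. f (x(i := t))) has_real_derivative D i x) (at (x i)))"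
    by metis
  then show thesis using that[of D] by blast
qed

lemma C1_real_const: "U \<subseteq> Rn n \<Longrightarrow> C1_real n U (\<lambda>x. c)"
  by (rule C1_realI[where D = "\<lambda>i x. 0"]) auto

lemma C1_real_coord: "U \<subseteq> Rn n \<Longrightarrow> C1_real n U (\<lambda>x. x j)"
proof (rule C1_realI[where D = "\<lambda>i x. if i = j then 1 else 0"])
  fix i and x :: "nat \<Rightarrow> real"
  show "((\<lambda>t. (x(i := t)) j) has_real_derivative (if i = j then 1 else 0)) (at (x i))"
    by (cases "i = j") (auto intro!: derivative_eq_intros)
qed auto

lemma C1_real_add:
  assumes "C1_real n U f" "C1_real n U g" "U \<subseteq> Rn n"
  shows "C1_real n U (\<lambda>x. f x + g x)"
proof -
  obtain D where D: "\<forall>i<n. continuous_on U (D i)" "\<forall>i<n. \<forall>x\<in>U. ((\<lambda>t. f (x(i := t))) has_real_derivative D i x) (at (x i))"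
    by (rule C1_realE[OF assms(1,3)])
  obtain E where E: "\<forall>i<n. continuous_on U (E i)" "\<forall>i<n. \<forall>x\<in>U. ((\<lambda>t. g (x(i := t))) has_real_derivative E i x) (at (x i))"
    by (rule C1_realE[OF assms(2,3)])
  show ?thesis
    by (rule C1_realI[OF assms(3), where D = "\<lambda>i x. D i x + E i x"])
      (use D E in \<open>auto intro!: continuous_on_add DERIV_add\<close>)
qed

lemma C1_real_cmult:
  assumes "C1_real n U f" "U \<subseteq> Rn n"
  shows "C1_real n U (\<lambda>x. c * f x)"
proof -
  obtain D where D: "\<forall>i<n. continuous_on U (D i)" "\<forall>i<n. \<forall>x\<in>U. ((\<lambda>t. f (x(i := t))) has_real_derivative D i x) (at (x i))"
    by (rule C1_realE[OF assms])
  show ?thesis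
    by (rule C1_realI[OF assms(2), where D = "\<lambda>i x. c * D i x"])
      (use D in \<open>auto intro!: continuous_on_mult continuous_on_const DERIV_cmult\<close>)
qed

lemma C1_real_diff:
  assumes "C1_real n U f" "C1_real n U g" "U \<subseteq> Rn n"
  shows "C1_real n U (\<lambda>x. f x - g x)"
  using C1_real_add[OF assms(1) C1_real_cmult[OF assms(2,3), of "-1"] assms(3)] by simp

lemma C1_real_sum:
  assumes "finite I" "\<And>l. l \<in> I \<Longrightarrow> C1_real n U (f l)" "U \<subseteq> Rn n"
  shows "C1_real n U (\<lambda>x. \<Sum>l\<in>I. f l x)"
  using assms(1,2)
proof (induction I rule: finite_induct)
  case empty
  then show ?case by (simp add: C1_real_const assms(3))
next
  case (insert l I)
  then have "C1_real n U (\<lambda>x. f l x + (\<Sum>l\<in>I. f l x))"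
    by (intro C1_real_add assms(3)) auto
  then show ?case using insert.hyps by simp
qed

text \<open>A partial derivative involves neighbouring points, so agreement on \<open>U\<close>
  suffices because \<open>U\<close> is open. It is applied to replace \<open>inv_into\<close> by an
  explicit inverse.\<close>

lemma C1_real_cong:
  assumes U: "openin (Euclidean_space n) U" and f: "C1_real n U f" and eq: "\<And>x. x \<in> U \<Longrightarrow> g x = f x"
  shows "C1_real n U g"
proof -
  have UR: "U \<subseteq> Rn n" using U openin_subset by blast
  obtain D where D: "\<forall>i<n. continuous_on U (D i)" "\<forall>i<n. \<forall>x\<in>U. ((\<lambda>t. f (x(i := t))) has_real_derivative D i x) (at (x i))"
    by (rule C1_realE[OF f UR])
  show ?thesis
  proof (rule C1_realI[OF UR, where D = D])
    fix i x assume i: "i < n" and x: "x \<in> U"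
    obtain r where r: "r > 0" "\<forall>y\<in>Rn n. (\<forall>l<n. \<bar>y l - x l\<bar> < r) \<longrightarrow> y \<in> U"
      by (rule openin_RnD[OF U x])
    have xR: "x \<in> Rn n" using x UR by blast
    show "((\<lambda>t. g (x(i := t))) has_real_derivative D i x) (at (x i))"
    proof (rule has_field_derivative_transform_within[OF _ r(1)])
      show "((\<lambda>t. f (x(i := t))) has_real_derivative D i x) (at (x i))" using D(2) i x by blast
      fix t assume "dist t (x i) < r"
      then have "x(i := t) \<in> U"
        using r upd_in_Rn[OF xR i] by (auto simp: dist_real_def)
      then show "f (x(i := t)) = g (x(i := t))" using eq by simp
    qed simp
  qed (use D(1) in blast)
qed

lemma shear_cmult: "shear n d a (\<lambda>l. c * x l) i = c * shear n d a x i"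
  by (cases "i < d") (simp_all add: shear_def right_diff_distrib sum_distrib_left mult.left_commute)

definition unit_vec :: "nat \<Rightarrow> nat \<Rightarrow> real"
  where "unit_vec i = (\<lambda>l. if l = i then 1 else 0)"

text \<open>Changing one coordinate of \<open>x\<close> moves its projection along a straight line,
  so partial derivatives of \<open>G\<close> after \<open>shear\<close> are directional derivatives
  of \<open>G\<close>.\<close>

lemma shear_line: "shear n d a (x(i := t)) = pt d (shear n d a x) (t - x i) (shear n d a (unit_vec i))"
proof (rule Rn_ext[of _ d])
  fix l assume l: "l < d"
  have "(\<lambda>l. (x(i := t)) l - x l) = (\<lambda>l. (t - x i) * unit_vec i l)"
    by (auto simp: unit_vec_def)
  then have "shear n d a (x(i := t)) l - shear n d a x l = (t - x i) * shear n d a (unit_vec i) l"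
    unfolding shear_diff[OF l] by (simp only: shear_cmult)
  then show "shear n d a (x(i := t)) l = pt d (shear n d a x) (t - x i) (shear n d a (unit_vec i)) l"
    using l by (simp add: pt_def)
qed simp_all

lemma vecn_line: "vecn d (x(i := t)) = pt d (vecn d x) (t - x i) (vecn d (unit_vec i))"
  by (rule Rn_ext[of _ d]) (auto simp: pt_def unit_vec_def)

lemma continuous_on_shear: "continuous_on A (shear n d a)"
  unfolding shear_def[abs_def]
  by (intro continuous_on_vecn continuous_intros continuous_on_coord)

lemma continuous_on_vecn_id: "continuous_on A (vecn d)"
  by (rule continuous_on_vecn[of d A "\<lambda>x i. x i"]) (rule continuous_on_coord)

section \<open>The straightening chart of a graph\<close>

context skew_graph
begin

text \<open>The map \<open>h\<close> is only required to be affine along coordinate lines, which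
  covers \<open>shear\<close> for the chart and \<open>vecn d\<close> for its inverse.\<close>

lemma C1_real_G_comp:
  assumes U: "U \<subseteq> Rn n" and h: "\<And>x. x \<in> U \<Longrightarrow> h x \<in> B" "continuous_on U h"
    and line: "\<And>x i t. h (x(i := t)) = pt d (h x) (t - x i) (w i)" and j: "j < n"
  shows "C1_real n U (\<lambda>x. G (h x) j)"
proof (rule C1_realI[OF U, where D = "\<lambda>i x. D (w i) j (h x)"])
  show "continuous_on U (\<lambda>x. D (w i) j (h x))" for i
    by (rule continuous_on_compose2[OF D_continuous[OF j] h(2)]) (use h(1) in blast)
  fix i x assume x: "x \<in> U"
  have "((\<lambda>t. G (pt d (h x) t (w i)) j) has_real_derivative D (w i) j (h x)) (at (x i - x i))"
    using D_derivative[OF h(1)[OF x] j, of "w i"] by simp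
  moreover have "((\<lambda>t. t - x i) has_real_derivative 1) (at (x i))"
    by (auto intro!: derivative_eq_intros)
  ultimately have "((\<lambda>t. G (pt d (h x) (t - x i) (w i)) j) has_real_derivative D (w i) j (h x) * 1) (at (x i))"
    by (rule DERIV_chain2)
  then show "((\<lambda>t. G (h (x(i := t))) j) has_real_derivative D (w i) j (h x)) (at (x i))"
    by (simp add: line)
qed

text \<open>The chart takes the projection as its first \<open>d\<close> coordinates and subtracts
  the graph from the remaining ones, so that \<open>X\<close> becomes the set where these vanish.
  Its inverse is explicit and has the same regularity.\<close>

lemma C1_smooth_at_graph:
  assumes W: "openin (Euclidean_space n) W" and XW: "\<And>x. x \<in> X \<inter> W \<Longrightarrow> shear n d a x \<in> B \<and> G (shear n d a x) = x"
    and p: "p \<in> X" "p \<in> W"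
  shows "C1_smooth_at n d X p"
proof -
  let ?sh = "shear n d a"
  define \<Phi> where "\<Phi> x = vecn n (\<lambda>j. if j < d then ?sh x j else x j - G (?sh x) j)" for x
  \<comment> \<open>The coordinates from \<open>d\<close> on are recovered by adding
    \<open>G\<close>; the first \<open>d\<close> then follow by undoing the shear with these
    recovered values.\<close>
  define \<Psi> where "\<Psi> y = vecn n (\<lambda>i. if i < d then y i + (\<Sum>l\<in>{d..<n}. a i l * (y l + G (vecn d y) l))
    else y i + G (vecn d y) i)" for y
  define U where "U = {x \<in> W. ?sh x \<in> B}"
  define Y where "Y = {y \<in> Rn n. vecn d y \<in> B}"
  \<comment> \<open>As a preimage under the continuous \<open>\<Psi>\<close> this is open, and it is
    exactly what makes \<open>\<Phi>\<close> and \<open>\<Psi>\<close> inverse bijections between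
    \<open>U\<close> and \<open>V\<close>.\<close>
  define V where "V = {y \<in> Y. \<Psi> y \<in> W}"
  have WR: "W \<subseteq> Rn n" using W openin_subset by blast
  have U: "openin (Euclidean_space n) U"
    unfolding U_def by (rule openin_preimage_Rn[OF W continuous_on_shear _ B]) simp
  have Y: "openin (Euclidean_space n) Y"
    unfolding Y_def by (rule openin_preimage_Rn[OF openin_topspace continuous_on_vecn_id _ B]) simp
  have GY: "continuous_on Y (\<lambda>y. G (vecn d y) j)" if "j < n" for j
    by (rule continuous_on_compose2[OF G_continuous[OF that] continuous_on_vecn_id]) (auto simp: Y_def)
  have "continuous_on Y \<Psi>"
    unfolding \<Psi>_def
  proof (rule continuous_on_vecn)
    fix i assume i: "i < n"
    show "continuous_on Y (\<lambda>y. if i < d then y i + (\<Sum>l\<in>{d..<n}. a i l * (y l + G (vecn d y) l)) else y i + G (vecn d y) i)"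
      using i by (cases "i < d") (auto intro!: continuous_intros continuous_on_coord GY)
  qed
  then have V: "openin (Euclidean_space n) V"
    unfolding V_def by (rule openin_preimage_Rn[OF Y _ _ W]) (simp add: \<Psi>_def)
  have UR: "U \<subseteq> Rn n" and VR: "V \<subseteq> Rn n" using U V openin_subset by blast+
  have v\<Phi>: "vecn d (\<Phi> x) = ?sh x" for x
    using dn by (intro Rn_ext[of _ d]) (auto simp: \<Phi>_def)
  have sh\<Psi>: "?sh (\<Psi> y) = vecn d y" for y
    using dn by (intro Rn_ext[of _ d]) (auto simp: shear_def \<Psi>_def)
  have \<Psi>\<Phi>: "\<Psi> (\<Phi> x) = x" if x: "x \<in> U" for x
  proof (rule Rn_ext[of _ n])
    show "\<Psi> (\<Phi> x) \<in> Rn n" by (simp add: \<Psi>_def)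
    show "x \<in> Rn n" using x UR by blast
    fix i assume i: "i < n"
    show "\<Psi> (\<Phi> x) i = x i"
      using i dn by (cases "i < d") (auto simp: \<Psi>_def v\<Phi>, auto simp: \<Phi>_def shear_def)
  qed
  have \<Phi>\<Psi>: "\<Phi> (\<Psi> y) = y" if y: "y \<in> V" for y
  proof (rule Rn_ext[of _ n])
    show "\<Phi> (\<Psi> y) \<in> Rn n" by (simp add: \<Phi>_def)
    show "y \<in> Rn n" using y VR by blast
    fix i assume i: "i < n"
    show "\<Phi> (\<Psi> y) i = y i"
      using i dn by (cases "i < d") (auto simp: \<Phi>_def sh\<Psi>, auto simp: \<Psi>_def)
  qed
  have \<Phi>U: "\<Phi> x \<in> V" if "x \<in> U" for x
    using that \<Psi>\<Phi>[OF that] by (simp add: V_def Y_def v\<Phi> U_def) (simp add: \<Phi>_def)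
  have \<Psi>V: "\<Psi> y \<in> U" if "y \<in> V" for y
    using that by (simp add: V_def U_def sh\<Psi> Y_def)
  have bij: "bij_betw \<Phi> U V"
    by (rule bij_betw_byWitness[where f' = \<Psi>]) (use \<Psi>\<Phi> \<Phi>\<Psi> \<Phi>U \<Psi>V in auto)
  have inv: "inv_into U \<Phi> y = \<Psi> y" if "y \<in> V" for y
  proof (rule inv_into_f_eq[OF bij_betw_imp_inj_on[OF bij]])
    show "\<Psi> y \<in> U" by (rule \<Psi>V[OF that])
    show "\<Phi> (\<Psi> y) = y" by (rule \<Phi>\<Psi>[OF that])
  qed
  have c1\<Phi>: "C1_real n U (\<lambda>x. \<Phi> x j)" if j: "j < n" for j
  proof (cases "j < d")
    case True
    have "C1_real n U (\<lambda>x. x j - (\<Sum>l\<in>{d..<n}. a j l * x l))"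
      by (intro C1_real_diff C1_real_sum C1_real_cmult C1_real_coord UR) simp
    then show ?thesis using True j by (simp add: \<Phi>_def shear_def)
  next
    case False
    have "C1_real n U (\<lambda>x. G (?sh x) j)"
      by (rule C1_real_G_comp[OF UR _ continuous_on_shear shear_line j]) (simp add: U_def)
    then have "C1_real n U (\<lambda>x. x j - G (?sh x) j)"
      by (intro C1_real_diff C1_real_coord UR)
    then show ?thesis using False j by (simp add: \<Phi>_def)
  qed
  have c1G: "C1_real n V (\<lambda>y. y j + G (vecn d y) j)" if j: "j < n" for j
  proof -
    have "C1_real n V (\<lambda>x. G (vecn d x) j)"
      by (rule C1_real_G_comp[OF VR _ continuous_on_vecn_id vecn_line j]) (simp add: V_def Y_def)
    then show ?thesis by (intro C1_real_add C1_real_coord VR)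
  qed
  have c1\<Psi>: "C1_real n V (\<lambda>y. \<Psi> y j)" if j: "j < n" for j
  proof (cases "j < d")
    case True
    have "C1_real n V (\<lambda>y. y j + (\<Sum>l\<in>{d..<n}. a j l * (y l + G (vecn d y) l)))"
      by (intro C1_real_add C1_real_sum C1_real_cmult C1_real_coord c1G VR) simp_all
    then show ?thesis using True j by (simp add: \<Psi>_def)
  next
    case False
    then show ?thesis using c1G[OF j] j by (simp add: \<Psi>_def)
  qed
  have "C1_real n V (\<lambda>y. inv_into U \<Phi> y j)" if "j < n" for j
    by (rule C1_real_cong[OF V c1\<Psi>[OF that]]) (simp add: inv)
  then have diffeo: "C1_diffeo n U V \<Phi>"
    unfolding C1_diffeo_def using U V bij c1\<Phi> by blast
  have pU: "p \<in> U" using XW p by (simp add: U_def)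
  have "\<Phi> ` (U \<inter> X) = V \<inter> Rn d"
  proof (intro equalityI subsetI)
    fix y assume "y \<in> \<Phi> ` (U \<inter> X)"
    then obtain x where x: "x \<in> U" "x \<in> X" "y = \<Phi> x" by blast
    then have "G (?sh x) = x" using XW by (simp add: U_def)
    then have "\<Phi> x i = 0" if "d \<le> i" for i
      using that by (cases "i < n") (auto simp: \<Phi>_def)
    then show "y \<in> V \<inter> Rn d" using \<Phi>U x by (simp add: Rn_iff)
  next
    fix y assume y: "y \<in> V \<inter> Rn d"
    let ?g = "G (vecn d y)"
    have vB: "vecn d y \<in> B" using y by (simp add: V_def Y_def)
    have y0: "y i = 0" if "d \<le> i" for i using y that by (simp add: Rn_iff)
    \<comment> \<open>With vanishing last coordinates nothing is added to the graph, so
      \<open>\<Psi>\<close> returns the graph point over the projection of \<open>y\<close>.\<close>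
    have "\<Psi> y = ?g"
    proof (rule Rn_ext[of _ n])
      show "\<Psi> y \<in> Rn n" by (simp add: \<Psi>_def)
      show "?g \<in> Rn n" using GX[OF vB] X_Rn by blast
      fix i assume i: "i < n"
      show "\<Psi> y i = ?g i"
      proof (cases "i < d")
        case True
        have "?sh ?g i = y i" using shear_G[OF vB] True by simp
        moreover have "(\<Sum>l\<in>{d..<n}. a i l * (y l + ?g l)) = (\<Sum>l\<in>{d..<n}. a i l * ?g l)"
          by (intro sum.cong) (auto simp: y0)
        ultimately show ?thesis using True i by (simp add: \<Psi>_def shear_def)
      next
        case False
        then show ?thesis using i y0[of i] by (simp add: \<Psi>_def)
      qed
    qed
    then have "\<Psi> y \<in> X" using GX[OF vB] by simp
    then have "\<Psi> y \<in> U \<inter> X" using \<Psi>V y by blast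
    then show "y \<in> \<Phi> ` (U \<inter> X)" using \<Phi>\<Psi> y by (metis IntD1 image_eqI)
  qed
  then show ?thesis
    unfolding C1_smooth_at_def using dn diffeo pU by blast
qed

end

lemma cell_dim_le: "cell S n k C \<Longrightarrow> k \<le> n"
  by (induction rule: cell.induct) auto

text \<open>The inverse of a manifold chart followed by \<open>f\<close> is a continuous injection
  of an open subset of the \<open>d\<close>-dimensional space into that space, so invariance of
  domain makes its image open.\<close>

lemma topological_manifold_graph_image:
  assumes X: "X \<subseteq> Rn n" and mf: "topological_manifold d (subspace_top n X)" and p: "p \<in> X" and N: "openin (Euclidean_space n) N" "p \<in> N"
    and inj: "inj_on f (X \<inter> N)" and cont: "continuous_on UNIV f" and f: "\<forall>x. f x \<in> Rn d"
  obtains W where "openin (Euclidean_space n) W" "p \<in> W" "W \<subseteq> N" "openin (Euclidean_space d) (f ` (X \<inter> W))"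
proof -
  have "p \<in> topspace (subspace_top n X)" using p X by auto
  then obtain U V where UV: "openin (subspace_top n X) U" "p \<in> U" "openin (Euclidean_space d) V"
    "subtopology (subspace_top n X) U homeomorphic_space subtopology (Euclidean_space d) V"
    using mf unfolding topological_manifold_def by blast
  obtain O1 where O1: "openin (Euclidean_space n) O1" "U = O1 \<inter> X"
    using UV(1) unfolding openin_subtopology by blast
  have UX: "U \<subseteq> X" using O1(2) by blast
  then have sub: "subtopology (subspace_top n X) U = subspace_top n U"
    by (simp add: subtopology_subtopology Int_absorb1)
  have VR: "V \<subseteq> Rn d" using UV(3) openin_subset by blast
  obtain h g where hg: "homeomorphic_maps (subspace_top n U) (subtopology (Euclidean_space d) V) h g"
    using UV(4) unfolding sub homeomorphic_space_def by blast
  have tU: "topspace (subspace_top n U) = U" using UX X by auto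
  have tV: "topspace (subtopology (Euclidean_space d) V) = V" using VR by auto
  have g: "continuous_map (subtopology (Euclidean_space d) V) (Euclidean_space n) g" "\<forall>v\<in>V. g v \<in> U"
    using hg tU tV unfolding homeomorphic_maps_def continuous_map_in_subtopology by (auto simp: Pi_iff)
  have hh: "\<forall>x\<in>U. h x \<in> V \<and> g (h x) = x" "\<forall>v\<in>V. h (g v) = v"
    using hg tU tV unfolding homeomorphic_maps_def continuous_map_in_subtopology by (auto simp: Pi_iff)
  have cg: "continuous_on V g"
    using g(1) unfolding cm_Euclidean_space_iff_continuous_on tV by blast
  define W where "W = O1 \<inter> N"
  have W: "openin (Euclidean_space n) W" unfolding W_def using O1(1) N(1) by blast
  define V' where "V' = {v \<in> V. g v \<in> W}"
  have V': "openin (Euclidean_space d) V'"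
    unfolding V'_def by (rule openin_preimage_Rn[OF UV(3) cg _ W]) (use g(2) UX X in blast)
  have im: "g ` V' = X \<inter> W"
  proof (intro equalityI subsetI)
    fix x assume "x \<in> X \<inter> W"
    then have "x \<in> U" "x \<in> W" using O1(2) by (auto simp: W_def)
    then have "h x \<in> V'" "x = g (h x)" using hh(1) by (auto simp: V'_def)
    then show "x \<in> g ` V'" by blast
  qed (use g(2) UX in \<open>auto simp: V'_def\<close>)
  have "openin (Euclidean_space d) ((\<lambda>v. f (g v)) ` V')"
  proof (rule invariance_of_domain_Euclidean_space[OF V'])
    have "continuous_on V' (\<lambda>v. f (g v))"
      by (rule continuous_on_compose2[OF cont continuous_on_subset[OF cg]]) (auto simp: V'_def)
    moreover have "topspace (subtopology (Euclidean_space d) V') = V'" using VR by (auto simp: V'_def)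
    ultimately show "continuous_map (subtopology (Euclidean_space d) V') (Euclidean_space d) (\<lambda>v. f (g v))"
      unfolding cm_Euclidean_space_iff_continuous_on using f by simp
    show "inj_on (\<lambda>v. f (g v)) V'"
    proof (rule inj_onI)
      fix u v assume uv: "u \<in> V'" "v \<in> V'" "f (g u) = f (g v)"
      have "g u \<in> X \<inter> N" "g v \<in> X \<inter> N" using uv im by (auto simp: W_def)
      then have "g u = g v" using inj_onD[OF inj, OF uv(3)] by blast
      then show "u = v" using hh(2) uv by (metis (mono_tags, lifting) V'_def mem_Collect_eq)
    qed
  qed
  then have "openin (Euclidean_space d) (f ` (X \<inter> W))" by (simp add: im image_image flip: im)
  moreover have "p \<in> W" "W \<subseteq> N" using UV(2) O1(2) N(2) by (auto simp: W_def)
  ultimately show thesis using W that by blast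
qed

context o_minimal_structure
begin

text \<open>The Lipschitz estimate makes the projection injective on a neighbourhood
  \<open>N\<close>, and the manifold chart cuts \<open>N\<close> down to \<open>W\<close>, over
  which the projected set is open. The inverse of the projection on \<open>X \<inter> W\<close> is
  the map \<open>G\<close> of the graph.\<close>

lemma C1_smooth_if_C5_dim:
  assumes XS: "X \<in> S n" and dX: "has_dim S n X d"
    and mf: "topological_manifold d (subspace_top n X)" and C5: "\<forall>p\<in>X. has_dim S n (C5 n X p) d"
  shows "C1_smooth n d X"
  unfolding C1_smooth_def
proof
  fix p assume p: "p \<in> X"
  have X: "X \<subseteq> Rn n" by (rule subset_Rn[OF XS])
  have pR: "p \<in> Rn n" using p X by blast
  have dn: "d \<le> n" using dX cell_dim_le unfolding has_dim_def by blast
  have small: "\<forall>k C. cell S n k C \<and> C \<subseteq> C5 n X q \<longrightarrow> k \<le> d" if "q \<in> X" for q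
    using C5 that unfolding has_dim_def by blast
  have "\<forall>v\<in>C5 n X p. \<forall>c. c \<noteq> 0 \<longrightarrow> (\<lambda>i. c * v i) \<in> C5 n X p"
    using C5_scale[OF X pR] by blast
  from transversal_coordinates[OF C5_definable[OF XS pR] closed_C5[OF X pR] this small[OF p] dn]
  obtain a where a: "\<forall>v\<in>C5 n X p. (\<forall>i<d. v i = (\<Sum>j\<in>{d..<n}. a i j * v j)) \<longrightarrow> (\<forall>i<n. v i = 0)"
    by (elim exE) (rule that)
  let ?sh = "shear n d a"
  obtain r M where rM: "r > 0" "M > 0"
    "\<forall>x\<in>X. \<forall>y\<in>X. (\<forall>i<n. \<bar>x i - p i\<bar> < r) \<and> (\<forall>i<n. \<bar>y i - p i\<bar> < r) \<longrightarrow>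
      (\<forall>i<n. \<bar>x i - y i\<bar> \<le> M * (\<Sum>l<d. \<bar>?sh x l - ?sh y l\<bar>))"
    by (rule inverse_shear_lipschitz[OF X pR dn a])
  define N where "N = bx n (\<lambda>i. p i - r) (\<lambda>i. p i + r)"
  have pN: "p \<in> N" using pR rM(1) by (simp add: N_def bx_def)
  have near: "\<forall>i<n. \<bar>x i - p i\<bar> < r" if "x \<in> N" for x
    using that by (auto simp: N_def bx_def abs_less_iff dest: spec)
  have lip: "\<bar>x i - y i\<bar> \<le> M * (\<Sum>l<d. \<bar>?sh x l - ?sh y l\<bar>)" if "x \<in> X \<inter> N" "y \<in> X \<inter> N" "i < n" for x y i
    using rM(3) that near by blast
  have inj: "inj_on ?sh (X \<inter> N)"
  proof (rule inj_onI)
    fix x y assume xy: "x \<in> X \<inter> N" "y \<in> X \<inter> N" "?sh x = ?sh y"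
    show "x = y"
    proof (rule Rn_ext[of _ n])
      fix i assume "i < n"
      then show "x i = y i" using lip[OF xy(1,2)] xy(3) by fastforce
    qed (use xy X in blast)+
  qed
  have N: "openin (Euclidean_space n) N" unfolding N_def by (rule openin_bx)
  obtain W where W: "openin (Euclidean_space n) W" "p \<in> W" "W \<subseteq> N" "openin (Euclidean_space d) (?sh ` (X \<inter> W))"
    by (rule topological_manifold_graph_image[OF X mf p N pN inj continuous_on_shear]) simp
  define G where "G = the_inv_into (X \<inter> W) ?sh"
  have injW: "inj_on ?sh (X \<inter> W)" by (rule inj_on_subset[OF inj]) (use W(3) in blast)
  have GW: "G u \<in> X \<inter> W" "?sh (G u) = u" if "u \<in> ?sh ` (X \<inter> W)" for u
    using the_inv_into_into[OF injW that order_refl] f_the_inv_into_f[OF injW that] by (simp_all add: G_def)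
  have Gsh: "G (?sh x) = x" if "x \<in> X \<inter> W" for x
    using the_inv_into_f_f[OF injW that] by (simp add: G_def)
  interpret skew_graph S n d X a "?sh ` (X \<inter> W)" G M
  proof unfold_locales
    show "d \<le> n" "X \<in> S n" "M > 0" by (rule dn XS rM(2))+
    show "openin (Euclidean_space d) (?sh ` (X \<inter> W))" by (rule W(4))
    fix u assume u: "u \<in> ?sh ` (X \<inter> W)"
    show "G u \<in> X" "?sh (G u) = u" using GW[OF u] by auto
    show "k \<le> d" if "cell S n k C" "C \<subseteq> C5 n X (G u)" for k C
      using small[of "G u"] GW(1)[OF u] that by blast
    fix u' i assume u': "u' \<in> ?sh ` (X \<inter> W)" and i: "i < n"
    have "G u \<in> X \<inter> N" "G u' \<in> X \<inter> N" using GW(1)[OF u] GW(1)[OF u'] W(3) by auto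
    from lip[OF this i] show "\<bar>G u i - G u' i\<bar> \<le> M * (\<Sum>l<d. \<bar>u l - u' l\<bar>)"
      by (simp add: GW(2)[OF u] GW(2)[OF u'])
  qed
  show "C1_smooth_at n d X p"
    by (rule C1_smooth_at_graph[OF W(1) _ p W(2)]) (use Gsh in auto)
qed

end

section \<open>From smoothness to the cone\<close>

lemma mean_value_bound:
  fixes \<phi> :: "real \<Rightarrow> real"
  assumes "\<And>t. min x y \<le> t \<Longrightarrow> t \<le> max x y \<Longrightarrow> (\<phi> has_real_derivative \<phi>' t) (at t) \<and> \<bar>\<phi>' t - c\<bar> \<le> e"
  shows "\<bar>\<phi> y - \<phi> x - c * (y - x)\<bar> \<le> e * \<bar>y - x\<bar>"
proof -
  have main: "\<bar>\<phi> v - \<phi> u - c * (v - u)\<bar> \<le> e * \<bar>v - u\<bar>" if uv: "u < v" and d: "\<And>t. u \<le> t \<Longrightarrow> t \<le> v \<Longrightarrow> (\<phi> has_real_derivative \<phi>' t) (at t) \<and> \<bar>\<phi>' t - c\<bar> \<le> e" for u v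
  proof -
    obtain z where z: "u < z" "z < v" "\<phi> v - \<phi> u = (v - u) * \<phi>' z"
      using MVT2[OF uv, of \<phi> \<phi>'] d by blast
    have "\<phi> v - \<phi> u - c * (v - u) = (\<phi>' z - c) * (v - u)" unfolding z(3) by (simp add: algebra_simps)
    then have "\<bar>\<phi> v - \<phi> u - c * (v - u)\<bar> = \<bar>\<phi>' z - c\<bar> * \<bar>v - u\<bar>" by (simp only: abs_mult)
    also have "\<dots> \<le> e * \<bar>v - u\<bar>" using d[of z] z by (intro mult_right_mono) auto
    finally show ?thesis .
  qed
  consider "x < y" | "x = y" | "y < x" by linarith
  then show ?thesis
  proof cases
    case 1
    then show ?thesis using main[OF 1] assms by (simp add: min_def max_def)
  next
    case 3
    have "\<bar>\<phi> x - \<phi> y - c * (x - y)\<bar> \<le> e * \<bar>x - y\<bar>" using main[OF 3] assms 3 by (simp add: min_def max_def)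
    moreover have "\<phi> y - \<phi> x - c * (y - x) = - (\<phi> x - \<phi> y - c * (x - y))" by (simp add: algebra_simps)
    ultimately show ?thesis by (simp add: abs_minus_commute)
  qed simp
qed

text \<open>Differentiability with both points moving, measured in the sum norm. Vectors of
  \<open>C5\<close> come from secants neither of whose end points is fixed, so differentiability at
  \<open>p\<close> alone would not control them.\<close>

definition strict_diff :: "nat \<Rightarrow> ((nat \<Rightarrow> real) \<Rightarrow> real) \<Rightarrow> (nat \<Rightarrow> real) \<Rightarrow> (nat \<Rightarrow> real) \<Rightarrow> bool"
  where "strict_diff n f p c \<longleftrightarrow> (\<forall>e>0. \<exists>\<delta>>0. \<forall>x\<in>Rn n. \<forall>y\<in>Rn n.
    (\<forall>i<n. \<bar>x i - p i\<bar> < \<delta>) \<and> (\<forall>i<n. \<bar>y i - p i\<bar> < \<delta>) \<longrightarrow>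
    \<bar>f y - f x - (\<Sum>i<n. c i * (y i - x i))\<bar> \<le> e * (\<Sum>i<n. \<bar>y i - x i\<bar>))"

lemma strict_diffE:
  assumes "strict_diff n f p c" "e > 0"
  obtains \<delta> where "\<delta> > 0" "\<forall>x\<in>Rn n. \<forall>y\<in>Rn n.
    (\<forall>i<n. \<bar>x i - p i\<bar> < \<delta>) \<and> (\<forall>i<n. \<bar>y i - p i\<bar> < \<delta>) \<longrightarrow>
    \<bar>f y - f x - (\<Sum>i<n. c i * (y i - x i))\<bar> \<le> e * (\<Sum>i<n. \<bar>y i - x i\<bar>)"
  using mp[OF spec[OF assms(1)[unfolded strict_diff_def]] assms(2)] by (elim exE conjE) (rule that)

text \<open>The increment from \<open>x\<close> to \<open>y\<close> is split into changes of one
  coordinate at a time. All intermediate points stay in the cube around \<open>p\<close>, where the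
  partial derivatives are close to their values at \<open>p\<close>, so the mean value theorem
  applies to each change.\<close>

lemma C1_real_strict_diff:
  assumes U: "openin (Euclidean_space n) U" and f: "C1_real n U f" and p: "p \<in> U"
  obtains c where "strict_diff n f p c"
proof -
  have UR: "U \<subseteq> Rn n" using U openin_subset by blast
  obtain D where D: "\<forall>i<n. continuous_on U (D i)" "\<forall>i<n. \<forall>x\<in>U. ((\<lambda>t. f (x(i := t))) has_real_derivative D i x) (at (x i))"
    by (rule C1_realE[OF f UR])
  obtain r where r: "r > 0" "\<forall>y\<in>Rn n. (\<forall>l<n. \<bar>y l - p l\<bar> < r) \<longrightarrow> y \<in> U"
    by (rule openin_RnD[OF U p])
  have "strict_diff n f p (\<lambda>i. D i p)"
    unfolding strict_diff_def
  proof (intro allI impI)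
    fix e :: real assume e: "0 < e"
    have "\<forall>i. \<exists>\<delta>>0. i < n \<longrightarrow> (\<forall>z\<in>U. (\<forall>l<n. \<bar>z l - p l\<bar> < \<delta>) \<longrightarrow> \<bar>D i z - D i p\<bar> < e)"
    proof
      fix i
      show "\<exists>\<delta>>0. i < n \<longrightarrow> (\<forall>z\<in>U. (\<forall>l<n. \<bar>z l - p l\<bar> < \<delta>) \<longrightarrow> \<bar>D i z - D i p\<bar> < e)"
      proof (cases "i < n")
        case True
        then have "continuous_on U (D i)" using D(1) by blast
        then show ?thesis using p e unfolding continuous_on_Rn_iff[OF UR] by meson
      next
        case False
        then show ?thesis by (intro exI[of _ 1]) simp
      qed
    qed
    then obtain dl where dl: "\<And>i. dl i > 0" "\<And>i z. i < n \<Longrightarrow> z \<in> U \<Longrightarrow> (\<forall>l<n. \<bar>z l - p l\<bar> < dl i) \<Longrightarrow> \<bar>D i z - D i p\<bar> < e"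
      by metis
    define \<delta> where "\<delta> = Min (insert r (dl ` {..<n}))"
    have \<delta>0: "\<delta> > 0" using r(1) dl(1) by (auto simp: \<delta>_def)
    have \<delta>r: "\<delta> \<le> r" by (simp add: \<delta>_def)
    have \<delta>dl: "\<delta> \<le> dl i" if "i < n" for i unfolding \<delta>_def using that by (intro Min_le) auto
    have near: "z \<in> U \<and> (\<forall>i<n. \<bar>D i z - D i p\<bar> \<le> e)" if z: "z \<in> Rn n" "\<forall>l<n. \<bar>z l - p l\<bar> < \<delta>" for z
    proof -
      have "\<forall>l<n. \<bar>z l - p l\<bar> < r" using z(2) \<delta>r by (meson less_le_trans)
      then have zU: "z \<in> U" using r(2) z(1) by blast
      have "\<bar>D i z - D i p\<bar> \<le> e" if i: "i < n" for i
      proof -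
        have "\<forall>l<n. \<bar>z l - p l\<bar> < dl i" using z(2) \<delta>dl[OF i] by (meson less_le_trans)
        from dl(2)[OF i zU this] show ?thesis by simp
      qed
      then show ?thesis using zU by blast
    qed
    have "\<bar>f y - f x - (\<Sum>i<n. D i p * (y i - x i))\<bar> \<le> e * (\<Sum>i<n. \<bar>y i - x i\<bar>)"
      if x: "x \<in> Rn n" "\<forall>i<n. \<bar>x i - p i\<bar> < \<delta>" and y: "y \<in> Rn n" "\<forall>i<n. \<bar>y i - p i\<bar> < \<delta>" for x y
    proof -
      \<comment> \<open>The path replaces the coordinates of \<open>x\<close> by those of
        \<open>y\<close> one after the other, from \<open>z 0 = x\<close> to
        \<open>z n = y\<close>.\<close>
      define z where "z k = (\<lambda>l. if l < k then y l else x l)" for k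
      have zR: "z k \<in> Rn n" for k using x(1) y(1) by (simp add: z_def Rn_iff)
      have zk: "z k k = x k" "(z k)(k := y k) = z (Suc k)" "(z k)(k := x k) = z k" for k
        by (auto simp: z_def)
      have step: "\<bar>f (z (Suc k)) - f (z k) - D k p * (y k - x k)\<bar> \<le> e * \<bar>y k - x k\<bar>" if k: "k < n" for k
      proof -
        have "((\<lambda>t. f ((z k)(k := t))) has_real_derivative D k ((z k)(k := t))) (at t) \<and> \<bar>D k ((z k)(k := t)) - D k p\<bar> \<le> e"
          if t: "min (x k) (y k) \<le> t" "t \<le> max (x k) (y k)" for t
        proof -
          have "\<bar>((z k)(k := t)) l - p l\<bar> < \<delta>" if l: "l < n" for l
          proof (cases "l = k")
            case True
            have "\<bar>x k - p k\<bar> < \<delta>" "\<bar>y k - p k\<bar> < \<delta>" using x(2) y(2) k by blast+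
            then show ?thesis using t True by (auto simp: abs_less_iff min_def max_def split: if_splits)
          next
            case False
            then show ?thesis using x(2) y(2) l by (simp add: z_def)
          qed
          moreover have "(z k)(k := t) \<in> Rn n" using zR k by (rule upd_in_Rn)
          ultimately have nr: "(z k)(k := t) \<in> U" "\<bar>D k ((z k)(k := t)) - D k p\<bar> \<le> e"
            using near[of "(z k)(k := t)"] k by blast+
          have "((\<lambda>s. f (((z k)(k := t))(k := s))) has_real_derivative D k ((z k)(k := t))) (at (((z k)(k := t)) k))"
            using D(2) k nr(1) by blast
          then show ?thesis using nr(2) by simp
        qed
        from mean_value_bound[of "x k" "y k" "\<lambda>t. f ((z k)(k := t))" "\<lambda>t. D k ((z k)(k := t))", OF this]
        show ?thesis by (simp add: zk)
      qed
      have "z 0 = x" by (simp add: z_def)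
      moreover have "z n = y" using x(1) y(1) by (intro Rn_ext[of _ n]) (auto simp: z_def Rn_iff)
      ultimately have "f y - f x = (\<Sum>k<n. f (z (Suc k)) - f (z k))"
        using sum_lessThan_telescope[of "\<lambda>k. f (z k)" n] by simp
      then have "f y - f x - (\<Sum>i<n. D i p * (y i - x i)) = (\<Sum>k<n. f (z (Suc k)) - f (z k) - D k p * (y k - x k))"
        by (simp add: sum_subtractf)
      also have "\<bar>\<dots>\<bar> \<le> (\<Sum>k<n. e * \<bar>y k - x k\<bar>)"
        by (rule order_trans[OF sum_abs]) (intro sum_mono step, simp)
      finally show ?thesis by (simp add: sum_distrib_left)
    qed
    then show "\<exists>\<delta>>0. \<forall>x\<in>Rn n. \<forall>y\<in>Rn n. (\<forall>i<n. \<bar>x i - p i\<bar> < \<delta>) \<and> (\<forall>i<n. \<bar>y i - p i\<bar> < \<delta>) \<longrightarrow>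
        \<bar>f y - f x - (\<Sum>i<n. D i p * (y i - x i))\<bar> \<le> e * (\<Sum>i<n. \<bar>y i - x i\<bar>)"
      using \<delta>0 by blast
  qed
  then show thesis by (rule that)
qed

text \<open>The chain rule for secants: a strictly differentiable function carries a converging
  sequence of secants to one that converges to the image under its differential.\<close>

lemma strict_diff_quotient:
  assumes f: "strict_diff n f p c" and R: "\<And>k. x k \<in> Rn n \<and> y k \<in> Rn n \<and> t k > 0"
    and x: "\<forall>i<n. (\<lambda>k. x k i) \<longlonglongrightarrow> p i" and y: "\<forall>i<n. (\<lambda>k. y k i) \<longlonglongrightarrow> p i"
    and v: "\<forall>i<n. (\<lambda>k. (x k i - y k i) / t k) \<longlonglongrightarrow> v i"
  shows "(\<lambda>k. (f (x k) - f (y k)) / t k) \<longlonglongrightarrow> (\<Sum>i<n. c i * v i)"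
proof -
  let ?q = "\<lambda>k i. (x k i - y k i) / t k"
  have lin: "(\<lambda>k. \<Sum>i<n. c i * ?q k i) \<longlonglongrightarrow> (\<Sum>i<n. c i * v i)"
    using v by (intro tendsto_sum tendsto_mult tendsto_const) auto
  have nrm: "(\<lambda>k. \<Sum>i<n. \<bar>?q k i\<bar>) \<longlonglongrightarrow> (\<Sum>i<n. \<bar>v i\<bar>)"
    using v by (intro tendsto_sum tendsto_rabs) auto
  \<comment> \<open>Strictly above the norm of the limit, hence eventually a bound for the norms of
    the quotients.\<close>
  define V where "V = (\<Sum>i<n. \<bar>v i\<bar>) + 1"
  have V: "V > 0" unfolding V_def by (intro add_nonneg_pos sum_nonneg) auto
  have ev: "\<forall>\<^sub>F k in sequentially. \<forall>i\<in>{..<n}. \<bar>z k i - p i\<bar> < \<delta>"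
    if "\<forall>i<n. (\<lambda>k. z k i) \<longlonglongrightarrow> p i" "\<delta> > 0" for z :: "nat \<Rightarrow> nat \<Rightarrow> real" and \<delta>
    by (rule eventually_ball_finite) (use that in \<open>auto simp: tendsto_iff dist_real_def\<close>)
  have "(\<lambda>k. (f (x k) - f (y k)) / t k - (\<Sum>i<n. c i * ?q k i)) \<longlonglongrightarrow> 0"
  proof (rule tendstoI)
    fix e :: real assume e: "0 < e"
    define e' where "e' = e / 2 / V"
    have e': "e' > 0" "e' * V < e" using e V by (simp_all add: e'_def)
    obtain \<delta> where \<delta>: "\<delta> > 0" "\<forall>x\<in>Rn n. \<forall>y\<in>Rn n. (\<forall>i<n. \<bar>x i - p i\<bar> < \<delta>) \<and> (\<forall>i<n. \<bar>y i - p i\<bar> < \<delta>) \<longrightarrow>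
        \<bar>f y - f x - (\<Sum>i<n. c i * (y i - x i))\<bar> \<le> e' * (\<Sum>i<n. \<bar>y i - x i\<bar>)"
      by (rule strict_diffE[OF f e'(1)])
    have "\<forall>\<^sub>F k in sequentially. (\<Sum>i<n. \<bar>?q k i\<bar>) < V"
      using order_tendstoD(2)[OF nrm, of V] by (simp add: V_def)
    with ev[OF x \<delta>(1)] ev[OF y \<delta>(1)]
    show "\<forall>\<^sub>F k in sequentially. dist ((f (x k) - f (y k)) / t k - (\<Sum>i<n. c i * ?q k i)) 0 < e"
    proof eventually_elim
      case (elim k)
      have t: "t k > 0" using R by blast
      have "\<bar>f (x k) - f (y k) - (\<Sum>i<n. c i * (x k i - y k i))\<bar> \<le> e' * (\<Sum>i<n. \<bar>x k i - y k i\<bar>)"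
        using \<delta>(2) R elim(1,2) by simp
      then have "\<bar>f (x k) - f (y k) - (\<Sum>i<n. c i * (x k i - y k i))\<bar> / t k \<le> e' * (\<Sum>i<n. \<bar>x k i - y k i\<bar>) / t k"
        using t by (intro divide_right_mono) auto
      also have "e' * (\<Sum>i<n. \<bar>x k i - y k i\<bar>) / t k = e' * (\<Sum>i<n. \<bar>?q k i\<bar>)"
      proof -
        have "(\<Sum>i<n. \<bar>x k i - y k i\<bar>) / t k = (\<Sum>i<n. \<bar>?q k i\<bar>)"
          using t by (simp add: sum_divide_distrib)
        then show ?thesis by (simp only: times_divide_eq_right[symmetric])
      qed
      also have "\<dots> \<le> e' * V" using elim(3) e'(1) by (intro mult_left_mono) auto
      finally have "\<bar>f (x k) - f (y k) - (\<Sum>i<n. c i * (x k i - y k i))\<bar> / t k < e" using e'(2) by linarith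
      moreover have "(f (x k) - f (y k)) / t k - (\<Sum>i<n. c i * ?q k i) = (f (x k) - f (y k) - (\<Sum>i<n. c i * (x k i - y k i))) / t k"
      proof -
        have "(\<Sum>i<n. c i * ?q k i) = (\<Sum>i<n. c i * (x k i - y k i)) / t k"
          by (simp add: sum_divide_distrib)
        then show ?thesis by (simp only: diff_divide_distrib[symmetric])
      qed
      ultimately show ?case using t by (simp add: dist_real_def)
    qed
  qed
  from tendsto_add[OF this lin] show ?thesis by simp
qed

text \<open>\<open>C1_real\<close> speaks only of partial derivatives; continuity of the function
  itself follows from the two-point estimate with \<open>e = 1\<close> and one point fixed.\<close>

lemma C1_real_continuous_on:
  assumes U: "openin (Euclidean_space n) U" and f: "C1_real n U f"
  shows "continuous_on U f"
proof -
  have UR: "U \<subseteq> Rn n" using U openin_subset by blast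
  show ?thesis
    unfolding continuous_on_Rn_iff[OF UR]
  proof (intro ballI allI impI)
    fix p and e :: real assume p: "p \<in> U" and e: "0 < e"
    have pR: "p \<in> Rn n" using p UR by blast
    obtain c where c: "strict_diff n f p c" by (rule C1_real_strict_diff[OF U f p])
    obtain \<delta> where \<delta>: "\<delta> > 0" "\<forall>x\<in>Rn n. \<forall>y\<in>Rn n. (\<forall>i<n. \<bar>x i - p i\<bar> < \<delta>) \<and> (\<forall>i<n. \<bar>y i - p i\<bar> < \<delta>) \<longrightarrow>
        \<bar>f y - f x - (\<Sum>i<n. c i * (y i - x i))\<bar> \<le> 1 * (\<Sum>i<n. \<bar>y i - x i\<bar>)"
      by (rule strict_diffE[OF c zero_less_one])
    \<comment> \<open>The inner 1 accounts for the error term; the outer 1 keeps \<open>K\<close>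
      positive for \<open>n = 0\<close> and makes the final estimate strict.\<close>
    define K where "K = (\<Sum>i<n. \<bar>c i\<bar> + 1) + 1"
    have K: "K > 0" unfolding K_def by (intro add_nonneg_pos sum_nonneg) auto
    have "\<bar>f y - f p\<bar> < e" if y: "y \<in> U" "\<forall>i<n. \<bar>y i - p i\<bar> < min \<delta> (e / K)" for y
    proof -
      have "\<bar>f y - f p - (\<Sum>i<n. c i * (y i - p i))\<bar> \<le> (\<Sum>i<n. \<bar>y i - p i\<bar>)"
        using bspec[OF bspec[OF \<delta>(2) pR], of y] y UR \<delta>(1) by auto
      moreover have "\<bar>\<Sum>i<n. c i * (y i - p i)\<bar> \<le> (\<Sum>i<n. \<bar>c i\<bar> * \<bar>y i - p i\<bar>)"
        by (rule order_trans[OF sum_abs]) (simp add: abs_mult)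
      ultimately have "\<bar>f y - f p\<bar> \<le> (\<Sum>i<n. \<bar>c i\<bar> * \<bar>y i - p i\<bar>) + (\<Sum>i<n. \<bar>y i - p i\<bar>)" by linarith
      also have "\<dots> = (\<Sum>i<n. (\<bar>c i\<bar> + 1) * \<bar>y i - p i\<bar>)" by (simp add: algebra_simps sum.distrib)
      also have "\<dots> \<le> (\<Sum>i<n. (\<bar>c i\<bar> + 1) * (e / K))" using y(2) by (intro sum_mono mult_left_mono) (auto simp: less_imp_le)
      also have "\<dots> = (\<Sum>i<n. \<bar>c i\<bar> + 1) * (e / K)" by (simp only: sum_distrib_right)
      also have "\<dots> = (K - 1) * (e / K)" by (simp add: K_def)
      also have "\<dots> < K * (e / K)" using e K by (intro mult_strict_right_mono) auto
      also have "\<dots> = e" using K by simp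
      finally show ?thesis .
    qed
    then show "\<exists>d>0. \<forall>y\<in>U. (\<forall>i<n. \<bar>y i - p i\<bar> < d) \<longrightarrow> \<bar>f y - f p\<bar> < e"
      using \<delta>(1) e K by (intro exI[of _ "min \<delta> (e / K)"]) auto
  qed
qed

lemma C1_map_continuous_on:
  assumes U: "openin (Euclidean_space n) U" and f: "\<forall>j<n. C1_real n U (\<lambda>x. f x j)" and R: "\<forall>x\<in>U. f x \<in> Rn n"
  shows "continuous_on U f"
proof (rule continuous_on_coordinatewise_then_product)
  fix j
  show "continuous_on U (\<lambda>x. f x j)"
  proof (cases "j < n")
    case True
    then show ?thesis using f U C1_real_continuous_on by blast
  next
    case False
    then have "f x j = 0" if "x \<in> U" for x using R that by (auto simp: Rn_iff)
    then show ?thesis by (subst continuous_on_cong[OF refl, of U _ "\<lambda>_. 0"]) auto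
  qed
qed

lemma continuous_on_Rn_sequence:
  assumes U: "openin (Euclidean_space n) U" and f: "continuous_on U f" and x: "\<And>k. x k \<in> U" and p: "p \<in> U"
    and lim: "\<forall>i<n. (\<lambda>k. x k i) \<longlonglongrightarrow> p i"
  shows "(\<lambda>k. f (x k) j) \<longlonglongrightarrow> (f p j :: real)"
proof -
  have UR: "U \<subseteq> Rn n" using U openin_subset by blast
  have fj: "continuous_on U (\<lambda>x. f x j)" by (rule continuous_on_product_then_coordinatewise[OF f])
  show ?thesis
  proof (rule tendstoI)
    fix e :: real assume "0 < e"
    then obtain d where d: "d > 0" "\<forall>y\<in>U. (\<forall>i<n. \<bar>y i - p i\<bar> < d) \<longrightarrow> \<bar>f y j - f p j\<bar> < e"
      using fj p unfolding continuous_on_Rn_iff[OF UR] by meson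
    have "\<forall>\<^sub>F k in sequentially. \<forall>i\<in>{..<n}. \<bar>x k i - p i\<bar> < d"
      by (rule eventually_ball_finite) (use lim d(1) in \<open>auto simp: tendsto_iff dist_real_def\<close>)
    then show "\<forall>\<^sub>F k in sequentially. dist (f (x k) j) (f p j) < e"
      by eventually_elim (use d(2) x in \<open>simp add: dist_real_def\<close>)
  qed
qed

text \<open>\<open>J\<close> and \<open>K\<close> are the differentials of the inverse chart and of the chart.\<close>

lemma C5_smooth:
  assumes X: "X \<subseteq> Rn n" and p: "p \<in> X" and sm: "C1_smooth_at n d X p"
  obtains J K where
    "\<forall>v\<in>C5 n X p. \<forall>l<n. d \<le> l \<longrightarrow> (\<Sum>i<n. K l i * v i) = 0"
    "\<forall>v\<in>C5 n X p. \<forall>j<n. v j = (\<Sum>l<n. J j l * (\<Sum>i<n. K l i * v i))"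
    "\<forall>c\<in>Rn d. vecn n (\<lambda>j. \<Sum>l<n. J j l * c l) \<in> C5 n X p \<and> (\<forall>l<n. (\<Sum>i<n. K l i * (\<Sum>m<n. J i m * c m)) = c l)"
proof -
  obtain U V \<Phi> where dn: "d \<le> n" and df: "C1_diffeo n U V \<Phi>" and pU: "p \<in> U" and im: "\<Phi> ` (U \<inter> X) = V \<inter> Rn d"
    using sm unfolding C1_smooth_at_def by blast
  define \<Psi> where "\<Psi> = inv_into U \<Phi>"
  have U: "openin (Euclidean_space n) U" and V: "openin (Euclidean_space n) V" and bij: "bij_betw \<Phi> U V"
    and c1\<Phi>: "\<forall>j<n. C1_real n U (\<lambda>x. \<Phi> x j)" and c1\<Psi>: "\<forall>j<n. C1_real n V (\<lambda>y. \<Psi> y j)"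
    using df unfolding C1_diffeo_def \<Psi>_def by blast+
  have UR: "U \<subseteq> Rn n" and VR: "V \<subseteq> Rn n" using U V openin_subset by blast+
  have \<Phi>V: "\<Phi> x \<in> V" if "x \<in> U" for x using bij that by (auto simp: bij_betw_def)
  have \<Psi>U: "\<Psi> y \<in> U" if "y \<in> V" for y unfolding \<Psi>_def using bij that by (metis bij_betw_imp_surj_on inv_into_into)
  have \<Psi>\<Phi>: "\<Psi> (\<Phi> x) = x" if "x \<in> U" for x unfolding \<Psi>_def using bij that by (simp add: bij_betw_inv_into_left)
  have \<Phi>\<Psi>: "\<Phi> (\<Psi> y) = y" if "y \<in> V" for y unfolding \<Psi>_def using bij that by (simp add: bij_betw_inv_into_right)
  have ct\<Phi>: "continuous_on U \<Phi>" by (rule C1_map_continuous_on[OF U c1\<Phi>]) (use \<Phi>V VR in blast)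
  have ct\<Psi>: "continuous_on V \<Psi>" by (rule C1_map_continuous_on[OF V c1\<Psi>]) (use \<Psi>U UR in blast)
  define q where "q = \<Phi> p"
  have qV: "q \<in> V" and qd: "q \<in> Rn d" and \<Psi>q: "\<Psi> q = p"
    using im pU p \<Phi>V \<Psi>\<Phi> by (auto simp: q_def)
  have pR: "p \<in> Rn n" using p X by blast
  have "\<forall>j. \<exists>c. j < n \<longrightarrow> strict_diff n (\<lambda>x. \<Phi> x j) p c"
    using C1_real_strict_diff[OF U _ pU] c1\<Phi> by metis
  then obtain K where K: "\<And>j. j < n \<Longrightarrow> strict_diff n (\<lambda>x. \<Phi> x j) p (K j)" by metis
  have "\<forall>j. \<exists>c. j < n \<longrightarrow> strict_diff n (\<lambda>x. \<Psi> x j) q c"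
    using C1_real_strict_diff[OF V _ qV] c1\<Psi> by metis
  then obtain J where J: "\<And>j. j < n \<Longrightarrow> strict_diff n (\<lambda>x. \<Psi> x j) q (J j)" by metis
  have XU: "\<Phi> x \<in> Rn d" if "x \<in> U" "x \<in> X" for x using im that by blast
  have fwd: "(\<forall>l<n. d \<le> l \<longrightarrow> (\<Sum>i<n. K l i * v i) = 0) \<and> (\<forall>j<n. v j = (\<Sum>l<n. J j l * (\<Sum>i<n. K l i * v i)))"
    if "v \<in> C5 n X p" for v
  proof -
    obtain x0 y0 :: "nat \<Rightarrow> nat \<Rightarrow> real" and t0 :: "nat \<Rightarrow> real"
      where xy0: "\<forall>k. x0 k \<in> X \<and> y0 k \<in> X \<and> t0 k > 0" and
        lim0: "\<forall>i<n. (\<lambda>k. x0 k i) \<longlonglongrightarrow> p i" "\<forall>i<n. (\<lambda>k. y0 k i) \<longlonglongrightarrow> p i"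
        "\<forall>i<n. (\<lambda>k. (x0 k i - y0 k i) / t0 k) \<longlonglongrightarrow> v i"
      using \<open>v \<in> C5 n X p\<close> unfolding C5_iff_sequences[OF X pR] by (elim exE conjE) (rule that)
    have evU: "\<forall>\<^sub>F k in sequentially. z k \<in> U" if z: "\<forall>k. z k \<in> X" "\<forall>i<n. (\<lambda>k. z k i) \<longlonglongrightarrow> p i" for z
    proof -
      have "\<forall>k. z k \<in> Rn n" using z(1) X by blast
      then have "limitin (Euclidean_space n) z p sequentially" using limitin_Rn_iff[OF _ pR] z(2) by blast
      then show ?thesis using U pU unfolding limitin_def by blast
    qed
    have "\<forall>\<^sub>F k in sequentially. x0 k \<in> U \<and> y0 k \<in> U"
      using evU[of x0] evU[of y0] xy0 lim0 by (intro eventually_conj) auto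
    then obtain k0 where k0: "\<And>k. k \<ge> k0 \<Longrightarrow> x0 k \<in> U \<and> y0 k \<in> U" unfolding eventually_sequentially by blast
    \<comment> \<open>The sequences enter the chart domain only eventually, so they are replaced by
      tails that lie in it from the start.\<close>
    define x y t where "x k = x0 (k + k0)" and "y k = y0 (k + k0)" and "t k = t0 (k + k0)" for k
    have xy: "x k \<in> X" "y k \<in> X" "t k > 0" "x k \<in> U" "y k \<in> U" for k
      using xy0 k0[of "k + k0"] by (auto simp: x_def y_def t_def)
    have lim: "\<forall>i<n. (\<lambda>k. x k i) \<longlonglongrightarrow> p i" "\<forall>i<n. (\<lambda>k. y k i) \<longlonglongrightarrow> p i"
        "\<forall>i<n. (\<lambda>k. (x k i - y k i) / t k) \<longlonglongrightarrow> v i"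
    proof -
      have shift: "\<forall>i<n. (\<lambda>k. z (k + k0) i) \<longlonglongrightarrow> l i" if "\<forall>i<n. (\<lambda>k. z k i) \<longlonglongrightarrow> l i"
        for z :: "nat \<Rightarrow> nat \<Rightarrow> real" and l
      proof (intro allI impI)
        fix i assume "i < n"
        then have "(\<lambda>k. z k i) \<longlonglongrightarrow> l i" using that by blast
        from LIMSEQ_ignore_initial_segment[OF this, of k0] show "(\<lambda>k. z (k + k0) i) \<longlonglongrightarrow> l i" .
      qed
      show "\<forall>i<n. (\<lambda>k. x k i) \<longlonglongrightarrow> p i" "\<forall>i<n. (\<lambda>k. y k i) \<longlonglongrightarrow> p i"
        using shift[OF lim0(1)] shift[OF lim0(2)] by (simp_all only: x_def y_def)
      show "\<forall>i<n. (\<lambda>k. (x k i - y k i) / t k) \<longlonglongrightarrow> v i"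
        using shift[of "\<lambda>k i. (x0 k i - y0 k i) / t0 k", OF lim0(3)] by (simp only: x_def y_def t_def)
    qed
    have aV: "\<Phi> (x k) \<in> V" "\<Phi> (y k) \<in> V" "\<Phi> (x k) \<in> Rn d" "\<Phi> (y k) \<in> Rn d" for k
      using xy \<Phi>V XU by auto
    have w: "\<forall>l<n. (\<lambda>k. (\<Phi> (x k) l - \<Phi> (y k) l) / t k) \<longlonglongrightarrow> (\<Sum>i<n. K l i * v i)"
      using strict_diff_quotient[OF K _ lim] xy UR by blast
    have alim: "\<forall>i<n. (\<lambda>k. \<Phi> (x k) i) \<longlonglongrightarrow> q i" "\<forall>i<n. (\<lambda>k. \<Phi> (y k) i) \<longlonglongrightarrow> q i"
      using continuous_on_Rn_sequence[OF U ct\<Phi> _ pU] xy lim unfolding q_def by blast+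
    have "(\<Sum>i<n. K l i * v i) = 0" if l: "l < n" "d \<le> l" for l
    proof -
      have "(\<lambda>k. (\<Phi> (x k) l - \<Phi> (y k) l) / t k) = (\<lambda>k. 0)"
        using aV(3,4) l(2) by (simp add: Rn_iff)
      then have "(\<lambda>k::nat. 0 :: real) \<longlonglongrightarrow> (\<Sum>i<n. K l i * v i)" using w l(1) by metis
      then show ?thesis using LIMSEQ_unique[OF tendsto_const] by metis
    qed
    \<comment> \<open>The chart carries the secants of \<open>X\<close> to secants of the
      straightened set and the inverse chart carries them back, so the two differentials together
      fix \<open>v\<close>.\<close>
    moreover have "v j = (\<Sum>l<n. J j l * (\<Sum>i<n. K l i * v i))" if j: "j < n" for j
    proof -
      have "(\<lambda>k. (\<Psi> (\<Phi> (x k)) j - \<Psi> (\<Phi> (y k)) j) / t k) \<longlonglongrightarrow> (\<Sum>l<n. J j l * (\<Sum>i<n. K l i * v i))"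
        using strict_diff_quotient[OF J[OF j] _ alim w] aV xy(3) VR by blast
      then have "(\<lambda>k. (x k j - y k j) / t k) \<longlonglongrightarrow> (\<Sum>l<n. J j l * (\<Sum>i<n. K l i * v i))"
        by (simp add: \<Psi>\<Phi> xy)
      moreover have "(\<lambda>k. (x k j - y k j) / t k) \<longlonglongrightarrow> v j" using lim(3) j by blast
      ultimately show ?thesis using LIMSEQ_unique by blast
    qed
    ultimately show ?thesis by blast
  qed
  have bwd: "vecn n (\<lambda>j. \<Sum>l<n. J j l * c l) \<in> C5 n X p \<and> (\<forall>l<n. (\<Sum>i<n. K l i * (\<Sum>m<n. J i m * c m)) = c l)"
    if c: "c \<in> Rn d" for c
  proof -
    obtain r where r: "r > 0" "\<forall>y\<in>Rn n. (\<forall>i<n. \<bar>y i - q i\<bar> < r) \<longrightarrow> y \<in> V" by (rule openin_RnD[OF V qV])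
    \<comment> \<open>Small enough for all steps up to \<open>s\<close> in direction
      \<open>c\<close> from \<open>q\<close> to stay in the cube contained in
      \<open>V\<close>.\<close>
    define s where "s = r / (1 + (\<Sum>i<n. \<bar>c i\<bar>))"
    have S1: "1 + (\<Sum>i<n. \<bar>c i\<bar>) > 0" by (intro add_pos_nonneg sum_nonneg) auto
    have s: "s > 0" "s * (1 + (\<Sum>i<n. \<bar>c i\<bar>)) = r" using r(1) S1 by (simp_all add: s_def)
    define t where "t k = s / real (Suc k)" for k
    have t: "t k > 0" "t k \<le> s" for k using s(1) by (simp_all add: t_def divide_le_eq)
    have t0: "t \<longlonglongrightarrow> 0"
      unfolding t_def using tendsto_mult_left[OF LIMSEQ_inverse_real_of_nat, of s] by (simp add: divide_inverse)
    \<comment> \<open>Points on a straight segment in the flat image. Their preimages lie in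
      \<open>X\<close>, and the secants from \<open>p\<close> to them converge to the image of
      \<open>c\<close> under \<open>J\<close>.\<close>
    define b where "b k l = q l + t k * c l" for k l
    have bd: "b k \<in> Rn d" for k using qd c by (simp add: b_def Rn_iff)
    have bV: "b k \<in> V" for k
    proof -
      have "\<bar>b k i - q i\<bar> < r" if i: "i < n" for i
      proof -
        have "\<bar>c i\<bar> < 1 + (\<Sum>i<n. \<bar>c i\<bar>)" using member_le_sum[of i "{..<n}" "\<lambda>i. \<bar>c i\<bar>"] i by simp
        then have "s * \<bar>c i\<bar> < r" using s by (metis mult_strict_left_mono)
        moreover have "t k * \<bar>c i\<bar> \<le> s * \<bar>c i\<bar>" using t(2) by (intro mult_right_mono) auto
        ultimately show ?thesis using t(1)[of k] by (simp add: b_def abs_mult)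
      qed
      then show ?thesis using r(2) bd Rn_mono[OF dn] by blast
    qed
    have xX: "\<Psi> (b k) \<in> X" for k
    proof -
      have "b k \<in> \<Phi> ` (U \<inter> X)" using im bV bd by blast
      then obtain x where "x \<in> U" "x \<in> X" "b k = \<Phi> x" by blast
      then show ?thesis using \<Psi>\<Phi> by simp
    qed
    have blim: "\<forall>i<n. (\<lambda>k. b k i) \<longlonglongrightarrow> q i"
      using tendsto_add[OF tendsto_const tendsto_mult_right[OF t0]] by (auto simp: b_def)
    have qlim: "\<forall>i<n. (\<lambda>k. q i) \<longlonglongrightarrow> q i" by simp
    have quot: "\<forall>i<n. (\<lambda>k. (b k i - q i) / t k) \<longlonglongrightarrow> c i"
    proof -
      have "(b k i - q i) / t k = c i" for k i using t(1)[of k] by (simp add: b_def)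
      then show ?thesis by simp
    qed
    have v: "\<forall>j<n. (\<lambda>k. (\<Psi> (b k) j - p j) / t k) \<longlonglongrightarrow> (\<Sum>l<n. J j l * c l)"
    proof (intro allI impI)
      fix j assume j: "j < n"
      have "(\<lambda>k. (\<Psi> (b k) j - \<Psi> q j) / t k) \<longlonglongrightarrow> (\<Sum>l<n. J j l * c l)"
        by (rule strict_diff_quotient[OF J[OF j] _ blim qlim quot]) (use bV qV VR t(1) in blast)
      then show "(\<lambda>k. (\<Psi> (b k) j - p j) / t k) \<longlonglongrightarrow> (\<Sum>l<n. J j l * c l)" by (simp add: \<Psi>q)
    qed
    have xlim: "\<forall>i<n. (\<lambda>k. \<Psi> (b k) i) \<longlonglongrightarrow> p i"
      using continuous_on_Rn_sequence[OF V ct\<Psi> bV qV blim] by (simp add: \<Psi>q)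
    have plim: "\<forall>i<n. (\<lambda>k. p i) \<longlonglongrightarrow> p i" by simp
    have "vecn n (\<lambda>j. \<Sum>l<n. J j l * c l) \<in> C5 n X p"
      by (rule C5_I[OF X pR _ _ xlim plim]) (use xX p t(1) v in auto)
    moreover have "(\<Sum>i<n. K l i * (\<Sum>m<n. J i m * c m)) = c l" if l: "l < n" for l
    proof -
      have "(\<lambda>k. (\<Phi> (\<Psi> (b k)) l - \<Phi> p l) / t k) \<longlonglongrightarrow> (\<Sum>i<n. K l i * (\<Sum>m<n. J i m * c m))"
        by (rule strict_diff_quotient[OF K[OF l] _ xlim plim v]) (use \<Psi>U[OF bV] UR pR t(1) in blast)
      then have "(\<lambda>k. (b k l - q l) / t k) \<longlonglongrightarrow> (\<Sum>i<n. K l i * (\<Sum>m<n. J i m * c m))"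
        by (simp add: \<Phi>\<Psi>[OF bV] q_def)
      moreover have "(\<lambda>k. (b k l - q l) / t k) \<longlonglongrightarrow> c l" using quot l by blast
      ultimately show ?thesis using LIMSEQ_unique by blast
    qed
    ultimately show ?thesis by blast
  qed
  show thesis
    by (rule that[of K J]) (use fwd bwd in blast)+
qed

text \<open>The restriction of the straightening chart to \<open>X\<close> is a homeomorphism onto
  an open piece of the \<open>d\<close>-dimensional space; the Hausdorff property and second
  countability are inherited by subspaces.\<close>

lemma C1_smooth_topological_manifold:
  assumes X: "X \<subseteq> Rn n" and sm: "C1_smooth n d X"
  shows "topological_manifold d (subspace_top n X)"
  unfolding topological_manifold_def
proof (intro conjI ballI)
  show "Hausdorff_space (subspace_top n X)"
    by (intro Hausdorff_space_subtopology Hausdorff_Euclidean_space)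
  have "second_countable (euclidean :: (nat \<Rightarrow> real) topology)"
  proof -
    obtain \<B> :: "(nat \<Rightarrow> real) set set" where B: "countable \<B>" "\<And>C. C \<in> \<B> \<Longrightarrow> open C"
      "\<And>S. open S \<Longrightarrow> \<exists>U. U \<subseteq> \<B> \<and> S = \<Union>U"
      by (rule univ_second_countable) blast
    have "\<exists>V\<in>\<B>. x \<in> V \<and> V \<subseteq> U" if "open U" "x \<in> U" for U and x :: "nat \<Rightarrow> real"
      using B(3)[OF that(1)] that(2) by blast
    then show ?thesis unfolding second_countable_def using B(1,2) by (intro exI[of _ \<B>]) auto
  qed
  then show "second_countable (subspace_top n X)"
    unfolding subspace_top_eq[OF X] by (rule second_countable_subtopology)
  fix p assume "p \<in> topspace (subspace_top n X)"
  then have p: "p \<in> X" by simp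
  then have "C1_smooth_at n d X p" using sm unfolding C1_smooth_def by blast
  then obtain U V \<Phi> where dn: "d \<le> n" and df: "C1_diffeo n U V \<Phi>" and pU: "p \<in> U" and im: "\<Phi> ` (U \<inter> X) = V \<inter> Rn d"
    unfolding C1_smooth_at_def by blast
  define \<Psi> where "\<Psi> = inv_into U \<Phi>"
  have U: "openin (Euclidean_space n) U" and V: "openin (Euclidean_space n) V" and bij: "bij_betw \<Phi> U V"
    and c1\<Phi>: "\<forall>j<n. C1_real n U (\<lambda>x. \<Phi> x j)" and c1\<Psi>: "\<forall>j<n. C1_real n V (\<lambda>y. \<Psi> y j)"
    using df unfolding C1_diffeo_def \<Psi>_def by blast+
  have UR: "U \<subseteq> Rn n" and VR: "V \<subseteq> Rn n" using U V openin_subset by blast+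
  have \<Phi>V: "\<Phi> x \<in> V" if "x \<in> U" for x using bij that by (auto simp: bij_betw_def)
  have \<Psi>U: "\<Psi> y \<in> U" if "y \<in> V" for y unfolding \<Psi>_def using bij that by (metis bij_betw_imp_surj_on inv_into_into)
  have \<Psi>\<Phi>: "\<Psi> (\<Phi> x) = x" if "x \<in> U" for x unfolding \<Psi>_def using bij that by (simp add: bij_betw_inv_into_left)
  have \<Phi>\<Psi>: "\<Phi> (\<Psi> y) = y" if "y \<in> V" for y unfolding \<Psi>_def using bij that by (simp add: bij_betw_inv_into_right)
  have ct\<Phi>: "continuous_on U \<Phi>" by (rule C1_map_continuous_on[OF U c1\<Phi>]) (use \<Phi>V VR in blast)
  have ct\<Psi>: "continuous_on V \<Psi>" by (rule C1_map_continuous_on[OF V c1\<Psi>]) (use \<Psi>U UR in blast)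
  have \<Psi>X: "\<Psi> y \<in> U \<inter> X" if y: "y \<in> V \<inter> Rn d" for y
  proof -
    obtain x where "x \<in> U \<inter> X" "y = \<Phi> x" using im y by blast
    then show ?thesis using \<Psi>\<Phi> by simp
  qed
  have oV: "openin (Euclidean_space d) (V \<inter> Rn d)"
  proof -
    obtain T where "open T" "V = Rn n \<inter> T" using V unfolding openin_Rn_open by blast
    then show ?thesis unfolding openin_Rn_open using Rn_mono[OF dn] by blast
  qed
  have oU: "openin (subspace_top n X) (U \<inter> X)" using U unfolding openin_subtopology by blast
  have s1: "subtopology (subspace_top n X) (U \<inter> X) = top_of_set (U \<inter> X)"
    unfolding subspace_top_eq[OF X] by (simp add: subtopology_subtopology Int_absorb1 Int_commute)
  have s2: "subtopology (Euclidean_space d) (V \<inter> Rn d) = top_of_set (V \<inter> Rn d)"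
    by (rule subspace_top_eq) simp
  have "homeomorphic_maps (top_of_set (U \<inter> X)) (top_of_set (V \<inter> Rn d)) \<Phi> \<Psi>"
    unfolding homeomorphic_maps_def
  proof (intro conjI ballI)
    show "continuous_map (top_of_set (U \<inter> X)) (top_of_set (V \<inter> Rn d)) \<Phi>"
      using continuous_on_subset[OF ct\<Phi>, of "U \<inter> X"] im by (auto simp: continuous_map_in_subtopology)
    show "continuous_map (top_of_set (V \<inter> Rn d)) (top_of_set (U \<inter> X)) \<Psi>"
      using continuous_on_subset[OF ct\<Psi>, of "V \<inter> Rn d"] \<Psi>X by (auto simp: continuous_map_in_subtopology)
  qed (use \<Psi>\<Phi> \<Phi>\<Psi> in auto)
  then have "subtopology (subspace_top n X) (U \<inter> X) homeomorphic_space subtopology (Euclidean_space d) (V \<inter> Rn d)"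
    unfolding s1 s2 homeomorphic_space_def by blast
  then show "\<exists>U V. openin (subspace_top n X) U \<and> p \<in> U \<and> openin (Euclidean_space d) V \<and>
      subtopology (subspace_top n X) U homeomorphic_space subtopology (Euclidean_space d) V"
    using oU oV pU p by blast
qed

section \<open>The dimension of cells and of the tangent space\<close>

lemma openin_preimage_open:
  fixes f :: "(nat \<Rightarrow> real) \<Rightarrow> 'a::topological_space"
  assumes "openin (Euclidean_space n) Y" "continuous_on Y f" "open T"
  shows "openin (Euclidean_space n) {y \<in> Y. f y \<in> T}"
proof -
  obtain TY where TY: "open TY" "Y = Rn n \<inter> TY" using assms(1) unfolding openin_Rn_open by blast
  have "openin (top_of_set Y) (Y \<inter> f -` T)" by (rule continuous_openin_preimage_gen[OF assms(2,3)])
  then obtain T' where T': "open T'" "Y \<inter> f -` T = Y \<inter> T'" unfolding openin_open by blast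
  have "{y \<in> Y. f y \<in> T} = Y \<inter> f -` T" by auto
  also have "\<dots> = Rn n \<inter> (TY \<inter> T')" using T'(2) TY(2) by auto
  finally show ?thesis unfolding openin_Rn_open using TY(1) T'(1) by blast
qed

text \<open>For \<open>d < k\<close> the map, read as one into the larger space, would have open
  image by invariance of domain; but coordinate \<open>d\<close> vanishes on the image, and changing
  it by \<open>r / 2\<close> leaves the image.\<close>

lemma no_embedding_lower_dim:
  assumes U: "openin (Euclidean_space k) U" "U \<noteq> {}" and f: "continuous_on U f" "inj_on f U" "\<forall>x\<in>U. f x \<in> Rn d"
  shows "k \<le> d"
proof (rule ccontr)
  assume "\<not> k \<le> d"
  then have dk: "d < k" by simp
  have UR: "U \<subseteq> Rn k" using U openin_subset by blast
  have "topspace (subtopology (Euclidean_space k) U) = U" using UR by auto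
  then have "continuous_map (subtopology (Euclidean_space k) U) (Euclidean_space k) f"
    unfolding cm_Euclidean_space_iff_continuous_on using f Rn_mono[OF less_imp_le[OF dk]] by auto
  then have op: "openin (Euclidean_space k) (f ` U)"
    by (rule invariance_of_domain_Euclidean_space[OF U(1) _ f(2)])
  obtain y where y: "y \<in> f ` U" using U(2) by blast
  obtain r where r: "r > 0" "\<forall>z\<in>Rn k. (\<forall>i<k. \<bar>z i - y i\<bar> < r) \<longrightarrow> z \<in> f ` U" by (rule openin_RnD[OF op y])
  have yd: "y \<in> Rn d" using y f(3) by blast
  then have "y(d := r / 2) \<in> Rn k" using dk by (auto simp: Rn_iff)
  moreover have "\<forall>i<k. \<bar>(y(d := r / 2)) i - y i\<bar> < r" using r(1) yd by (auto simp: Rn_iff)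
  ultimately have "y(d := r / 2) \<in> f ` U" using bspec[OF r(2), of "y(d := r / 2)"] by blast
  moreover have "f ` U \<subseteq> Rn d" using f(3) by (simp only: image_subset_iff)
  ultimately have "y(d := r / 2) \<in> Rn d" by (rule subsetD[rotated])
  then show False using r(1) by (auto simp: Rn_iff dest: spec[of _ d])
qed

context o_minimal_structure
begin

lemma openin_ext_less:
  assumes h: "cont_definable_ext S n C h" and C: "C \<subseteq> Rn n" and U: "openin (Euclidean_space k) U"
    and i: "continuous_on U \<iota>" "\<iota> ` U \<subseteq> C"
  shows "openin (Euclidean_space k) {u \<in> U. h (\<iota> u) < ereal p}"
    and "openin (Euclidean_space k) {u \<in> U. ereal p < h (\<iota> u)}"
proof -
  consider f where "cont_definable S n C f" "\<forall>x\<in>C. h x = ereal (f x)"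
    | "\<forall>x\<in>C. h x = \<infinity>" | "\<forall>x\<in>C. h x = - \<infinity>"
    using h unfolding cont_definable_ext_def by metis
  then have "openin (Euclidean_space k) {u \<in> U. h (\<iota> u) < ereal p} \<and> openin (Euclidean_space k) {u \<in> U. ereal p < h (\<iota> u)}"
  proof cases
    case 1
    then have "continuous_on C f" unfolding cont_definable_def continuous_map_real_iff[OF C] by blast
    then have c: "continuous_on U (\<lambda>u. f (\<iota> u))" by (rule continuous_on_compose2[OF _ i])
    have eqs: "{u \<in> U. h (\<iota> u) < ereal p} = {u \<in> U. f (\<iota> u) \<in> {..<p}}" "{u \<in> U. ereal p < h (\<iota> u)} = {u \<in> U. f (\<iota> u) \<in> {p<..}}"
      using 1(2) i(2) by auto
    show ?thesis
      unfolding eqs by (intro conjI openin_preimage_open[OF U c] open_lessThan open_greaterThan)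
  next
    case 2
    then have eqs: "{u \<in> U. h (\<iota> u) < ereal p} = {}" "{u \<in> U. ereal p < h (\<iota> u)} = U" using i(2) by auto
    show ?thesis unfolding eqs using U by simp
  next
    case 3
    then have eqs: "{u \<in> U. h (\<iota> u) < ereal p} = U" "{u \<in> U. ereal p < h (\<iota> u)} = {}" using i(2) by auto
    show ?thesis unfolding eqs using U by simp
  qed
  then show "openin (Euclidean_space k) {u \<in> U. h (\<iota> u) < ereal p}" "openin (Euclidean_space k) {u \<in> U. ereal p < h (\<iota> u)}"
    by blast+
qed

text \<open>Gives cell dimension a topological meaning: a cell of dimension \<open>k\<close>
  contains an injective continuous image of a nonempty open set of that dimension, which invariance
  of domain can compare with \<open>d\<close>.\<close>

lemma cell_contains_open_embedding:
  "cell S n k C \<Longrightarrow> \<exists>U \<iota>. openin (Euclidean_space k) U \<and> U \<noteq> {} \<and> continuous_on U \<iota> \<and> inj_on \<iota> U \<and> \<iota> ` U \<subseteq> C"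
proof (induction rule: cell.induct)
  case base
  have "openin (Euclidean_space 0) (Rn 0)" by (rule openin_topspace)
  moreover have "Rn 0 \<noteq> {}" by (metis vecn_in_Rn empty_iff)
  ultimately show ?case
    by (intro exI[of _ "Rn 0"] exI[of _ id]) auto
next
  case (graph n k C f)
  then obtain U \<iota> where U: "openin (Euclidean_space k) U" "U \<noteq> {}" "continuous_on U \<iota>" "inj_on \<iota> U" "\<iota> ` U \<subseteq> C"
    by blast
  have C: "C \<subseteq> Rn n" by (rule subset_Rn[OF cell_definable[OF graph(1)]])
  have "continuous_on C f" using graph(2) unfolding cont_definable_def continuous_map_real_iff[OF C] by blast
  then have fc: "continuous_on U (\<lambda>u. f (\<iota> u))" by (rule continuous_on_compose2[OF _ U(3,5)])
  let ?i = "\<lambda>u. (\<iota> u)(n := f (\<iota> u))"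
  have vi: "vecn n (?i u) = \<iota> u" if "u \<in> U" for u using U(5) C that by (intro vecn_upd) blast
  have "continuous_on U ?i"
  proof (rule continuous_on_coordinatewise_then_product)
    show "continuous_on U (\<lambda>u. (?i u) l)" for l
      using fc continuous_on_product_then_coordinatewise[OF U(3)] by (cases "l = n") auto
  qed
  moreover have "inj_on ?i U"
  proof (rule inj_onI)
    fix u u' assume u: "u \<in> U" "u' \<in> U" "?i u = ?i u'"
    have "\<iota> u = \<iota> u'" using vi[OF u(1)] vi[OF u(2)] u(3) by metis
    then show "u = u'" using inj_onD[OF U(4)] u(1,2) by blast
  qed
  moreover have "?i u \<in> graph_over n C f" if u: "u \<in> U" for u
  proof -
    have R: "\<iota> u \<in> Rn n" "\<iota> u \<in> C" using U(5) C u by blast+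
    have "(?i u)(n := 0) = \<iota> u"
      using upd_Rn_Suc[OF upd_in_Rn_Suc[OF R(1)]] vecn_upd[OF R(1)] by metis
    then show ?thesis using upd_in_Rn_Suc[OF R(1)] R(2) by (simp add: graph_over_def del: fun_upd_upd)
  qed
  ultimately show ?case using U(1,2) by blast
next
  case (band n k C f g)
  then obtain U \<iota> where U: "openin (Euclidean_space k) U" "U \<noteq> {}" "continuous_on U \<iota>" "inj_on \<iota> U" "\<iota> ` U \<subseteq> C"
    by blast
  have C: "C \<subseteq> Rn n" by (rule subset_Rn[OF cell_definable[OF band(1)]])
  obtain u0 where u0: "u0 \<in> U" using U(2) by blast
  have UR: "U \<subseteq> Rn k" using U(1) openin_subset by blast
  have "f (\<iota> u0) < g (\<iota> u0)" using band(4) U(5) u0 by blast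
  \<comment> \<open>Real constants between the two walls at one point remain between them nearby, so
    a slab with constant walls fits into the band even where the walls are infinite.\<close>
  then obtain q where q: "f (\<iota> u0) < ereal q" "ereal q < g (\<iota> u0)" using ereal_dense2 by blast
  then obtain p where p: "f (\<iota> u0) < ereal p" "ereal p < ereal q" using ereal_dense2 by blast
  have pq: "p < q" using p(2) by simp
  define U1 where "U1 = {u \<in> U. f (\<iota> u) < ereal p} \<inter> {u \<in> U. ereal q < g (\<iota> u)}"
  have U1: "openin (Euclidean_space k) U1"
    unfolding U1_def by (intro openin_Int openin_ext_less[OF _ C U(1,3,5)] band)
  have u01: "u0 \<in> U1" using u0 p(1) q(2) by (simp add: U1_def)
  define W where "W = {z \<in> {z \<in> Rn (Suc k). vecn k z \<in> U1}. z k \<in> {p<..<q}}"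
  have "openin (Euclidean_space (Suc k)) {z \<in> Rn (Suc k). vecn k z \<in> U1}"
    by (rule openin_preimage_Rn[OF openin_topspace continuous_on_vecn_id _ U1]) simp
  then have W: "openin (Euclidean_space (Suc k)) W"
    unfolding W_def by (rule openin_preimage_open[OF _ continuous_on_coord]) simp
  let ?i = "\<lambda>z. (\<iota> (vecn k z))(n := z k)"
  have zU: "vecn k z \<in> U" "\<iota> (vecn k z) \<in> C" "\<iota> (vecn k z) \<in> Rn n" "z \<in> Rn (Suc k)" if "z \<in> W" for z
  proof -
    show *: "vecn k z \<in> U" and "z \<in> Rn (Suc k)" using that by (simp_all add: W_def U1_def)
    show "\<iota> (vecn k z) \<in> C" using * U(5) by blast
    then show "\<iota> (vecn k z) \<in> Rn n" using C by blast
  qed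
  have ic: "continuous_on W (\<lambda>z. \<iota> (vecn k z))"
    by (rule continuous_on_compose2[OF U(3) continuous_on_vecn_id]) (use zU in blast)
  have "continuous_on W ?i"
  proof (rule continuous_on_coordinatewise_then_product)
    show "continuous_on W (\<lambda>z. (?i z) l)" for l
      using continuous_on_coord continuous_on_product_then_coordinatewise[OF ic] by (cases "l = n") auto
  qed
  moreover have "inj_on ?i W"
  proof (rule inj_onI)
    fix z z' assume z: "z \<in> W" "z' \<in> W" "?i z = ?i z'"
    have "\<iota> (vecn k z) = \<iota> (vecn k z')"
      using vecn_upd[OF zU(3)[OF z(1)]] vecn_upd[OF zU(3)[OF z(2)]] z(3) by metis
    then have v: "vecn k z = vecn k z'" using inj_onD[OF U(4)] zU(1) z by blast
    have "z k = z' k" using fun_cong[OF z(3), of n] by simp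
    then show "z = z'" using v vecn_upd_last zU(4) z by metis
  qed
  moreover have "?i z \<in> band_over n C f g" if z: "z \<in> W" for z
  proof -
    note R = zU[OF z]
    have u: "f (\<iota> (vecn k z)) < ereal p" "ereal q < g (\<iota> (vecn k z))" "p < z k" "z k < q"
      using z by (simp_all add: W_def U1_def)
    have "f (\<iota> (vecn k z)) < ereal (z k)" "ereal (z k) < g (\<iota> (vecn k z))"
      using u by (meson less_ereal.simps(1) less_trans)+
    moreover have "(?i z)(n := 0) = \<iota> (vecn k z)"
      using upd_Rn_Suc[OF upd_in_Rn_Suc[OF R(3)]] vecn_upd[OF R(3)] by metis
    ultimately show ?thesis using upd_in_Rn_Suc[OF R(3)] R(2) by (simp add: band_over_def del: fun_upd_upd)
  qed
  moreover have "W \<noteq> {}"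
  proof -
    have "u0 \<in> Rn k" using u0 UR by blast
    then have "u0(k := (p + q) / 2) \<in> W"
      using u01 pq by (simp add: W_def upd_in_Rn_Suc)
    then show ?thesis by blast
  qed
  ultimately show ?case using W by blast
qed

text \<open>\<open>K\<close> maps the cone injectively into the \<open>d\<close>-dimensional space,
  since \<open>J\<close> recovers the vector, so no cell in the cone has dimension above
  \<open>d\<close>. Conversely \<open>J\<close> embeds a \<open>d\<close>-dimensional box into the
  cone, which therefore contains a cell of dimension at least \<open>d\<close>.\<close>

lemma C5_dim_of_smooth:
  assumes XS: "X \<in> S n" and sm: "C1_smooth n d X" and p: "p \<in> X"
  shows "has_dim S n (C5 n X p) d"
proof -
  have X: "X \<subseteq> Rn n" by (rule subset_Rn[OF XS])
  have pR: "p \<in> Rn n" using p X by blast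
  have sp: "C1_smooth_at n d X p" using sm p unfolding C1_smooth_def by blast
  then have dn: "d \<le> n" unfolding C1_smooth_at_def by blast
  obtain J K where JK: "\<forall>v\<in>C5 n X p. \<forall>l<n. d \<le> l \<longrightarrow> (\<Sum>i<n. K l i * v i) = 0"
    "\<forall>v\<in>C5 n X p. \<forall>j<n. v j = (\<Sum>l<n. J j l * (\<Sum>i<n. K l i * v i))"
    "\<forall>c\<in>Rn d. vecn n (\<lambda>j. \<Sum>l<n. J j l * c l) \<in> C5 n X p \<and> (\<forall>l<n. (\<Sum>i<n. K l i * (\<Sum>m<n. J i m * c m)) = c l)"
    by (rule C5_smooth[OF X p sp])
  define w where "w v = vecn n (\<lambda>l. \<Sum>i<n. K l i * v i)" for v
  have upper: "k \<le> d" if "cell S n k C" "C \<subseteq> C5 n X p" for k C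
  proof -
    obtain U \<iota> where U: "openin (Euclidean_space k) U" "U \<noteq> {}" "continuous_on U \<iota>" "inj_on \<iota> U" "\<iota> ` U \<subseteq> C"
      using cell_contains_open_embedding[OF \<open>cell S n k C\<close>] by blast
    have T: "\<iota> u \<in> C5 n X p" if "u \<in> U" for u using U(5) \<open>C \<subseteq> C5 n X p\<close> that by blast
    show ?thesis
    proof (rule no_embedding_lower_dim[OF U(1,2), where f = "\<lambda>u. w (\<iota> u)"])
      show "continuous_on U (\<lambda>u. w (\<iota> u))"
        unfolding w_def
        by (intro continuous_on_vecn continuous_intros continuous_on_product_then_coordinatewise[OF U(3)])
      show "inj_on (\<lambda>u. w (\<iota> u)) U"
      proof (rule inj_onI)
        fix u u' assume u: "u \<in> U" "u' \<in> U" "w (\<iota> u) = w (\<iota> u')"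
        have eq: "(\<Sum>i<n. K l i * \<iota> u i) = (\<Sum>i<n. K l i * \<iota> u' i)" if "l < n" for l
          using fun_cong[OF u(3), of l] that by (simp add: w_def)
        have "\<iota> u = \<iota> u'"
        proof (rule Rn_ext[of _ n])
          show "\<iota> u \<in> Rn n" "\<iota> u' \<in> Rn n" using T u C5_subset_Rn[OF X pR] by blast+
          fix j assume j: "j < n"
          have "\<iota> u j = (\<Sum>l<n. J j l * (\<Sum>i<n. K l i * \<iota> u i))" "\<iota> u' j = (\<Sum>l<n. J j l * (\<Sum>i<n. K l i * \<iota> u' i))"
            using JK(2) T u j by blast+
          moreover have "(\<Sum>l<n. J j l * (\<Sum>i<n. K l i * \<iota> u i)) = (\<Sum>l<n. J j l * (\<Sum>i<n. K l i * \<iota> u' i))"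
            by (intro sum.cong refl) (simp add: eq)
          ultimately show "\<iota> u j = \<iota> u' j" by simp
        qed
        then show "u = u'" using inj_onD[OF U(4)] u(1,2) by blast
      qed
      show "\<forall>x\<in>U. w (\<iota> x) \<in> Rn d"
      proof
        fix u assume u: "u \<in> U"
        have "w (\<iota> u) l = 0" if "d \<le> l" for l
          using JK(1) T[OF u] that by (cases "l < n") (auto simp: w_def)
        then show "w (\<iota> u) \<in> Rn d" by (simp add: Rn_iff)
      qed
    qed
  qed
  \<comment> \<open>The truncation to \<open>d\<close> coordinates makes each component a polynomial
    in \<open>d\<close> variables, hence a definable function on the whole space.\<close>
  define s where "s c = vecn n (\<lambda>j. \<Sum>l<n. J j l * vecn d c l)" for c
  have "proper d (\<lambda>_. 0) (\<lambda>_. 1)" by (simp add: proper_def)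
  then have "\<exists>k C. d \<le> k \<and> cell S n k C \<and> C \<subseteq> s ` bx d (\<lambda>_. 0) (\<lambda>_. 1)"
  proof (rule embedded_box_cell)
    show "\<forall>j<n. dfun d (\<lambda>c. s c j)"
    proof (intro allI impI)
      fix j assume j: "j < n"
      have "polynomial_fun d (\<lambda>c. vecn d c l)" for l
        by (cases "l < d") (simp_all add: polynomial_intros)
      then have "dfun d (\<lambda>c. \<Sum>l<n. J j l * vecn d c l)"
        by (intro dfun_poly polynomial_fun_sum polynomial_fun.mult polynomial_fun.const) auto
      then show "dfun d (\<lambda>c. s c j)" using j by (simp add: s_def)
    qed
    show "\<forall>x. s x \<in> Rn n" by (simp add: s_def)
    show "continuous_on (bx d (\<lambda>_. 0) (\<lambda>_. 1)) s"
      unfolding s_def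
      by (intro continuous_on_vecn continuous_intros continuous_on_product_then_coordinatewise[OF continuous_on_vecn_id])
    show "inj_on s (bx d (\<lambda>_. 0) (\<lambda>_. 1))"
    proof (rule inj_onI)
      fix c c' assume c: "c \<in> bx d (\<lambda>_. 0) (\<lambda>_. 1)" "c' \<in> bx d (\<lambda>_. 0) (\<lambda>_. 1)" "s c = s c'"
      have R: "c \<in> Rn d" "c' \<in> Rn d" using c bx_Rn by blast+
      have eq: "(\<Sum>l<n. J i l * c l) = (\<Sum>l<n. J i l * c' l)" if "i < n" for i
        using fun_cong[OF c(3), of i] that R by (simp add: s_def vecn_Rn)
      show "c = c'"
      proof (rule Rn_ext[OF R])
        fix l assume "l < d"
        then have l: "l < n" using dn by simp
        have "c l = (\<Sum>i<n. K l i * (\<Sum>m<n. J i m * c m))" "c' l = (\<Sum>i<n. K l i * (\<Sum>m<n. J i m * c' m))"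
          using JK(3) R l by simp_all
        moreover have "(\<Sum>i<n. K l i * (\<Sum>m<n. J i m * c m)) = (\<Sum>i<n. K l i * (\<Sum>m<n. J i m * c' m))"
          by (intro sum.cong refl) (simp add: eq)
        ultimately show "c l = c' l" by simp
      qed
    qed
  qed
  then obtain k C where C: "d \<le> k" "cell S n k C" "C \<subseteq> s ` bx d (\<lambda>_. 0) (\<lambda>_. 1)" by blast
  have "s ` bx d (\<lambda>_. 0) (\<lambda>_. 1) \<subseteq> C5 n X p"
  proof
    fix v assume "v \<in> s ` bx d (\<lambda>_. 0) (\<lambda>_. 1)"
    then obtain c where c: "c \<in> Rn d" "v = s c" using bx_Rn by blast
    then have "v = vecn n (\<lambda>j. \<Sum>l<n. J j l * c l)" by (simp add: s_def vecn_Rn)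
    then show "v \<in> C5 n X p" using JK(3) c(1) by simp
  qed
  then have CT: "C \<subseteq> C5 n X p" using C(3) by blast
  moreover have "k = d" using upper[OF C(2) CT] C(1) by simp
  ultimately show ?thesis unfolding has_dim_def using upper C(2) by blast
qed

end

theorem theorem3p23:
  fixes S :: "nat \<Rightarrow> (nat \<Rightarrow> real) set set" and X :: "(nat \<Rightarrow> real) set" and n d :: nat
  assumes "o_minimal_structure S"
    and "X \<in> S n"
    and "has_dim S n X d"
  shows "C1_smooth n d X \<longleftrightarrow>
    topological_manifold d (subtopology (Euclidean_space n) X) \<and> (\<forall>p\<in>X. has_dim S n (C5 n X p) d)"
proof -
  interpret o_minimal_structure S by (rule assms(1))
  show ?thesis
    using C1_smooth_topological_manifold[OF subset_Rn[OF assms(2)]] C5_dim_of_smooth[OF assms(2)]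
      C1_smooth_if_C5_dim[OF assms(2,3)] by blast
qed

end
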